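(* Let $k$ be a field and let $\mathcal{A}$ be a $k$-linear abelian category with enough injectives. The characteristic morphism $\chi_{\mathcal{A}}:HH^2_{\mathrm{ab}}(\mathcal{A})\to\mathfrak{Z}^2D^+(\mathcal{A})$ satisfies, for every $c\in HH^2_{\mathrm{ab}}(\mathcal{A})$, $$\chi_{\mathcal{A}}(c)=(o_C)_{C\in D^+(\mathcal{A})},$$ where $o_C\in\operatorname{Ext}^2_{\mathcal{A}}(C,C)$ is the obstruction to deforming $C$ into an object of $D^+(\mathcal{A}_c)$. For $C\in D^b(\mathcal{A})$, this is equally the obstruction to deforming $C$ into an object of $D^b(\mathcal{A}_c)$.
   Context: Hochschild complex. Graded means $\mathbb{Z}$-graded, with the Koszul sign rule; $[M,N]^p=\prod_i\operatorname{Hom}_k(M^i,N^{i+p})$; $(\Sigma M)^i=M^{i+1}$, and $\sigma m\in\Sigma M$ is the element of degree $|m|-1$ corresponding to $m$. For a quiver $\mathfrak{b}$ (a set of objects and graded $k$-modules $\mathfrak{b}(B,B')$), $\mathbf{C}_{br}(\mathfrak{b})=\prod_{n\ge0}\prod_{B_0,\dots,B_n}[\Sigma\mathfrak{b}(B_{n-1},B_n)\otimes\cdots\otimes\Sigma\mathfrak{b}(B_0,B_1),\Sigma\mathfrak{b}(B_0,B_n)]$ with braces $\phi\{\phi_1,\dots,\phi_r\}=\sum\phi(1\otimes\cdots\otimes\phi_1\otimes1\otimes\cdots\otimes\phi_r\otimes1\otimes\cdots\otimes1)$ (sum over order-preserving insertions) and $\langle x,y\rangle=x\{y\}-(-1)^{|x||y|}y\{x\}$.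 A dg structure is $b\in\mathbf{C}^1_{br}(\mathfrak{b})$ with $b\{b\}=0$ and only components of arity $1,2$ nonzero. The Hochschild complex is $\mathbf{C}(\mathfrak{b})=\Sigma^{-1}\mathbf{C}_{br}(\mathfrak{b})$ with differential induced by $\langle b,-\rangle$; $HH^n(\mathfrak{b})=H^n\mathbf{C}(\mathfrak{b})$. An element $\phi\in\mathbf{C}^{i,n}(\mathfrak{b})=\prod[\mathfrak{b}(B_{n-1},B_n)\otimes\cdots\otimes\mathfrak{b}(B_0,B_1),\mathfrak{b}(B_0,B_n)]^i$ has arity $n$ and Hochschild degree $i+n$, and corresponds to the element of $\mathbf{C}_{br}$ sending $(\sigma f_n,\dots,\sigma f_1)$ to $(-1)^{ni+(n-1)|f_n|+\cdots+|f_2|}\sigma\phi(f_n,\dots,f_1)$. Characteristic morphism. Put $\mathfrak{i}=\operatorname{Inj}(\mathcal{A})$, the $k$-linear category of injectives of $\mathcal{A}$, and $HH^*_{\mathrm{ab}}(\mathcal{A})=HH^*(\mathfrak{i})$. $\mathsf{Com}^+(\mathfrak{i})$ is the dg category of bounded below complexes of injectives (composition $(fg)_i=f_{i+|g|}g_i$, differential $d(f)=\delta f-(-1)^{|f|}f\delta$), a dg model of $D^+(\mathcal{A})\cong K^+(\mathfrak{i})$. Let $\delta\in\mathbf{C}^1(\mathsf{Com}^+(\mathfrak{i}))$ be the arity zero element given by the differentials. The $B_\infty$-quasi-isomorphism $\operatorname{embr}_\delta:\mathbf{C}(\mathfrak{i})\to\mathbf{C}(\mathsf{Com}^+(\mathfrak{i}))$,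 $\phi_n\mapsto\sum_{m=0}^n\phi_n\{\delta^{\otimes m}\}$ (for $\phi_n$ of arity $n$, extended to complexes componentwise), is a section, inverse in cohomology, of restriction of cochains along $\mathfrak{i}\subset\mathsf{Com}^+(\mathfrak{i})$. $\chi_{\mathcal{A}}$ is obtained in cohomology from $\operatorname{embr}_\delta$ followed by projection on the arity zero part $\prod_C\mathsf{Com}^+(\mathfrak{i})(C,C)$. $\mathfrak{Z}^2D^+(\mathcal{A})$ is the degree $2$ part of the graded centre (families $\zeta_C\in\operatorname{Ext}^2_{\mathcal{A}}(C,C)$ with $\zeta_Df=f\zeta_C$ for all graded morphisms $f$ from $C$ to $D$). Deformations. A first order abelian deformation of $\mathcal{A}$ is a flat (in the sense of Lowen and Van den Bergh) abelian $k[\epsilon]$-linear category $\mathcal{B}$ ($\epsilon^2=0$) with an equivalence $\mathcal{A}\cong\operatorname{Hom}_{k[\epsilon]}(k,\mathcal{B})$, the full subcategory of objects of $\mathcal{B}$ on which $\epsilon$ is zero. If $\phi$ is a 2-cocycle of $\mathfrak{i}$ representing $c$, $\mathfrak{i}_\phi[\epsilon]$ has the objects of $\mathfrak{i}$, morphisms $k[\epsilon]\otimes_k\mathfrak{i}(E,E')$ and composition $m+\phi\epsilon$ ($m$ the composition of $\mathfrak{i}$). The deformation $\mathcal{A}_c$ is the abelian deformation (unique up to equivalence) with $\operatorname{Inj}(\mathcal{A}_c)\cong\mathfrak{i}_\phi[\epsilon]$ as deformations of $\mathfrak{i}$, where reduction modulo $\epsilon$ is $E\mapsto\operatorname{Hom}_{k[\epsilon]}(k,E)$.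 Obstruction. A deformation of $C\in D^+(\mathcal{A})$ (resp. $D^b(\mathcal{A})$) is an object $\bar C$ of $D^+(\mathcal{A}_c)$ (resp. $D^b(\mathcal{A}_c)$) with an isomorphism $\mathbf{R}\operatorname{Hom}_{k[\epsilon]}(k,\bar C)\cong C$; in terms of injectives, a lift along $k\otimes_{k[\epsilon]}-:K^+(\mathfrak{i}_\phi[\epsilon])\to K^+(\mathfrak{i})$. The obstruction $o_C$ is the one of Lowen's obstruction theory for deforming objects of derived categories: if $C$ is represented by a bounded below complex $(I,\delta)$ of injectives, it is the class $[\phi(\delta,\delta)]\in\operatorname{Ext}^2_{\mathcal{A}}(C,C)$, where $\phi$ is applied componentwise. It depends on $c$ and vanishes if and only if $C$ admits a deformation.
   Formalization: The obstruction o_C is taken to be the class of −φ(δ,δ) instead of φ(δ,δ): with the stated sign conventions the characteristic morphism gives −[φ(δ,δ)], so the equation with [φ(δ,δ)] fails outside characteristic 2; the vanishing criterion is unchanged. *)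

theory Defs
  imports "HOL-Algebra.Module" "HOL-Algebra.AbelCoset"
begin

section \<open>Linear and abelian categories\<close>

text \<open>Hom-sets of different pairs of objects may overlap, so the composite
  \<^term>\<open>cmp A X Y Z g f\<close> of f from X to Y and g from Y to Z carries the objects.
  Only the additive group and the scalar multiplication of a hom-module are used; the
  multiplicative fields of the record are irrelevant.\<close>

record ('o, 'm, 'r) lincat =
  obs :: "'o set"
  mor :: "'o \<Rightarrow> 'o \<Rightarrow> ('r, 'm) module"
  cmp :: "'o \<Rightarrow> 'o \<Rightarrow> 'o \<Rightarrow> 'm \<Rightarrow> 'm \<Rightarrow> 'm"
  idn :: "'o \<Rightarrow> 'm"

abbreviation hom_set :: "('o, 'm, 'r) lincat \<Rightarrow> 'o \<Rightarrow> 'o \<Rightarrow> 'm set" where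
  "hom_set A X Y \<equiv> carrier (mor A X Y)"

definition linear_category :: "'r ring \<Rightarrow> ('o, 'm, 'r) lincat \<Rightarrow> bool" where
  "linear_category R A \<longleftrightarrow>
     (\<forall>X \<in> obs A. \<forall>Y \<in> obs A. module R (mor A X Y)) \<and>
     (\<forall>X \<in> obs A. idn A X \<in> hom_set A X X) \<and>
     (\<forall>X \<in> obs A. \<forall>Y \<in> obs A. \<forall>Z \<in> obs A. \<forall>g \<in> hom_set A Y Z. \<forall>f \<in> hom_set A X Y.
        cmp A X Y Z g f \<in> hom_set A X Z) \<and>
     (\<forall>X \<in> obs A. \<forall>Y \<in> obs A. \<forall>f \<in> hom_set A X Y.
        cmp A X X Y f (idn A X) = f \<and> cmp A X Y Y (idn A Y) f = f) \<and>
     (\<forall>W \<in> obs A. \<forall>X \<in> obs A. \<forall>Y \<in> obs A. \<forall>Z \<in> obs A.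
        \<forall>h \<in> hom_set A Y Z. \<forall>g \<in> hom_set A X Y. \<forall>f \<in> hom_set A W X.
        cmp A W X Z (cmp A X Y Z h g) f = cmp A W Y Z h (cmp A W X Y g f)) \<and>
     (\<forall>X \<in> obs A. \<forall>Y \<in> obs A. \<forall>Z \<in> obs A. \<forall>r \<in> carrier R.
        \<forall>g \<in> hom_set A Y Z. \<forall>g' \<in> hom_set A Y Z. \<forall>f \<in> hom_set A X Y. \<forall>f' \<in> hom_set A X Y.
        cmp A X Y Z (r \<odot>\<^bsub>mor A Y Z\<^esub> g \<oplus>\<^bsub>mor A Y Z\<^esub> g') f
          = r \<odot>\<^bsub>mor A X Z\<^esub> cmp A X Y Z g f \<oplus>\<^bsub>mor A X Z\<^esub> cmp A X Y Z g' f \<and>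
        cmp A X Y Z g (r \<odot>\<^bsub>mor A X Y\<^esub> f \<oplus>\<^bsub>mor A X Y\<^esub> f')
          = r \<odot>\<^bsub>mor A X Z\<^esub> cmp A X Y Z g f \<oplus>\<^bsub>mor A X Z\<^esub> cmp A X Y Z g f')"

definition zero_object :: "('o, 'm, 'r) lincat \<Rightarrow> 'o \<Rightarrow> bool" where
  "zero_object A Z \<longleftrightarrow> Z \<in> obs A \<and>
     (\<forall>X \<in> obs A. hom_set A X Z = {\<zero>\<^bsub>mor A X Z\<^esub>} \<and> hom_set A Z X = {\<zero>\<^bsub>mor A Z X\<^esub>})"

definition iso_mor :: "('o, 'm, 'r) lincat \<Rightarrow> 'o \<Rightarrow> 'o \<Rightarrow> 'm \<Rightarrow> bool" where
  "iso_mor A X Y f \<longleftrightarrow> f \<in> hom_set A X Y \<and>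
     (\<exists>g \<in> hom_set A Y X. cmp A X Y X g f = idn A X \<and> cmp A Y X Y f g = idn A Y)"

definition mono_mor :: "('o, 'm, 'r) lincat \<Rightarrow> 'o \<Rightarrow> 'o \<Rightarrow> 'm \<Rightarrow> bool" where
  "mono_mor A X Y f \<longleftrightarrow> f \<in> hom_set A X Y \<and>
     (\<forall>T \<in> obs A. \<forall>s \<in> hom_set A T X. \<forall>t \<in> hom_set A T X.
        cmp A T X Y f s = cmp A T X Y f t \<longrightarrow> s = t)"

definition epi_mor :: "('o, 'm, 'r) lincat \<Rightarrow> 'o \<Rightarrow> 'o \<Rightarrow> 'm \<Rightarrow> bool" where
  "epi_mor A X Y f \<longleftrightarrow> f \<in> hom_set A X Y \<and>
     (\<forall>T \<in> obs A. \<forall>s \<in> hom_set A Y T. \<forall>t \<in> hom_set A Y T.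
        cmp A X Y T s f = cmp A X Y T t f \<longrightarrow> s = t)"

text \<open>\<^term>\<open>is_kernel A X Y f K u\<close>: u from K to X is a kernel of f from X to Y.
  \<^term>\<open>is_cokernel A X Y f Q q\<close>: q from Y to Q is a cokernel of f.\<close>

definition is_kernel ::
    "('o, 'm, 'r) lincat \<Rightarrow> 'o \<Rightarrow> 'o \<Rightarrow> 'm \<Rightarrow> 'o \<Rightarrow> 'm \<Rightarrow> bool" where
  "is_kernel A X Y f K u \<longleftrightarrow> K \<in> obs A \<and> u \<in> hom_set A K X \<and>
     cmp A K X Y f u = \<zero>\<^bsub>mor A K Y\<^esub> \<and>
     (\<forall>T \<in> obs A. \<forall>t \<in> hom_set A T X. cmp A T X Y f t = \<zero>\<^bsub>mor A T Y\<^esub> \<longrightarrow>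
        (\<exists>!s. s \<in> hom_set A T K \<and> cmp A T K X u s = t))"

definition is_cokernel ::
    "('o, 'm, 'r) lincat \<Rightarrow> 'o \<Rightarrow> 'o \<Rightarrow> 'm \<Rightarrow> 'o \<Rightarrow> 'm \<Rightarrow> bool" where
  "is_cokernel A X Y f Q q \<longleftrightarrow> Q \<in> obs A \<and> q \<in> hom_set A Y Q \<and>
     cmp A X Y Q q f = \<zero>\<^bsub>mor A X Q\<^esub> \<and>
     (\<forall>T \<in> obs A. \<forall>t \<in> hom_set A Y T. cmp A X Y T t f = \<zero>\<^bsub>mor A X T\<^esub> \<longrightarrow>
        (\<exists>!s. s \<in> hom_set A Q T \<and> cmp A Y Q T s q = t))"

definition is_biproduct :: "('o, 'm, 'r) lincat \<Rightarrow> 'o \<Rightarrow> 'o \<Rightarrow> 'o \<Rightarrow> bool" where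
  "is_biproduct A X Y P \<longleftrightarrow> P \<in> obs A \<and>
     (\<exists>i \<in> hom_set A X P. \<exists>j \<in> hom_set A Y P. \<exists>p \<in> hom_set A P X. \<exists>q \<in> hom_set A P Y.
        cmp A X P X p i = idn A X \<and> cmp A Y P Y q j = idn A Y \<and>
        cmp A X P Y q i = \<zero>\<^bsub>mor A X Y\<^esub> \<and> cmp A Y P X p j = \<zero>\<^bsub>mor A Y X\<^esub> \<and>
        cmp A P X P i p \<oplus>\<^bsub>mor A P P\<^esub> cmp A P Y P j q = idn A P)"

definition abelian_category :: "'r ring \<Rightarrow> ('o, 'm, 'r) lincat \<Rightarrow> bool" where
  "abelian_category R A \<longleftrightarrow> linear_category R A \<and>
     (\<exists>Z. zero_object A Z) \<and>
     (\<forall>X \<in> obs A. \<forall>Y \<in> obs A. \<exists>P. is_biproduct A X Y P) \<and>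
     (\<forall>X \<in> obs A. \<forall>Y \<in> obs A. \<forall>f \<in> hom_set A X Y.
        (\<exists>K u. is_kernel A X Y f K u) \<and> (\<exists>Q q. is_cokernel A X Y f Q q)) \<and>
     (\<forall>X \<in> obs A. \<forall>Y \<in> obs A. \<forall>f.
        (mono_mor A X Y f \<longrightarrow> (\<exists>Z \<in> obs A. \<exists>g \<in> hom_set A Y Z. is_kernel A Y Z g X f)) \<and>
        (epi_mor A X Y f \<longrightarrow> (\<exists>Z \<in> obs A. \<exists>g \<in> hom_set A Z X. is_cokernel A Z X g Y f)))"

definition injective_object :: "('o, 'm, 'r) lincat \<Rightarrow> 'o \<Rightarrow> bool" where
  "injective_object A I \<longleftrightarrow> I \<in> obs A \<and>
     (\<forall>X \<in> obs A. \<forall>Y \<in> obs A. \<forall>u. mono_mor A X Y u \<longrightarrow>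
        (\<forall>f \<in> hom_set A X I. \<exists>g \<in> hom_set A Y I. cmp A X Y I g u = f))"

definition enough_injectives :: "('o, 'm, 'r) lincat \<Rightarrow> bool" where
  "enough_injectives A \<longleftrightarrow>
     (\<forall>X \<in> obs A. \<exists>I u. injective_object A I \<and> mono_mor A X I u)"

definition Inj :: "('o, 'm, 'r) lincat \<Rightarrow> ('o, 'm, 'r) lincat" where
  "Inj A = A\<lparr>obs := {I. injective_object A I}\<rparr>"

definition linear_functor :: "'r ring \<Rightarrow> ('o, 'm, 'r) lincat \<Rightarrow> ('p, 'n, 'r) lincat \<Rightarrow>
    ('o \<Rightarrow> 'p) \<Rightarrow> ('o \<Rightarrow> 'o \<Rightarrow> 'm \<Rightarrow> 'n) \<Rightarrow> bool" where
  "linear_functor R A B Fo Fm \<longleftrightarrow>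
     (\<forall>X \<in> obs A. Fo X \<in> obs B) \<and>
     (\<forall>X \<in> obs A. \<forall>Y \<in> obs A. \<forall>f \<in> hom_set A X Y. Fm X Y f \<in> hom_set B (Fo X) (Fo Y)) \<and>
     (\<forall>X \<in> obs A. \<forall>Y \<in> obs A. \<forall>r \<in> carrier R. \<forall>f \<in> hom_set A X Y. \<forall>f' \<in> hom_set A X Y.
        Fm X Y (r \<odot>\<^bsub>mor A X Y\<^esub> f \<oplus>\<^bsub>mor A X Y\<^esub> f')
          = r \<odot>\<^bsub>mor B (Fo X) (Fo Y)\<^esub> Fm X Y f \<oplus>\<^bsub>mor B (Fo X) (Fo Y)\<^esub> Fm X Y f') \<and>
     (\<forall>X \<in> obs A. \<forall>Y \<in> obs A. \<forall>Z \<in> obs A. \<forall>g \<in> hom_set A Y Z. \<forall>f \<in> hom_set A X Y.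
        Fm X Z (cmp A X Y Z g f) = cmp B (Fo X) (Fo Y) (Fo Z) (Fm Y Z g) (Fm X Y f)) \<and>
     (\<forall>X \<in> obs A. Fm X X (idn A X) = idn B (Fo X))"

definition linear_equivalence :: "'r ring \<Rightarrow> ('o, 'm, 'r) lincat \<Rightarrow> ('p, 'n, 'r) lincat \<Rightarrow>
    ('o \<Rightarrow> 'p) \<Rightarrow> ('o \<Rightarrow> 'o \<Rightarrow> 'm \<Rightarrow> 'n) \<Rightarrow> bool" where
  "linear_equivalence R A B Fo Fm \<longleftrightarrow> linear_functor R A B Fo Fm \<and>
     (\<forall>X \<in> obs A. \<forall>Y \<in> obs A.
        bij_betw (Fm X Y) (hom_set A X Y) (hom_set B (Fo X) (Fo Y))) \<and>
     (\<forall>P \<in> obs B. \<exists>X \<in> obs A. \<exists>f. iso_mor B (Fo X) P f)"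


section \<open>Graded quivers, braces and Hochschild cohomology\<close>

record ('o, 'm, 'r) gquiver =
  verts :: "'o set"
  arrs :: "'o \<Rightarrow> 'o \<Rightarrow> int \<Rightarrow> ('r, 'm) module"

text \<open>A homogeneous string (f_n, ..., f_1) of composable arrows starting at the object B_0 is
  the list of the triples (B_i, degree of f_i, f_i), with f_n first, together with B_0.  The
  degree is that of f_i, so that \<open>\<sigma> f_i\<close> has degree one less.  A family of maps of all arities
  is a function of B_0 and the string; only its values on paths in the quiver matter.\<close>

type_synonym ('o, 'm) strg = "('o \<times> int \<times> 'm) list"
type_synonym ('o, 'm) cochain = "'o \<Rightarrow> ('o, 'm) strg \<Rightarrow> 'm"

definition tgt :: "'o \<Rightarrow> ('o, 'm) strg \<Rightarrow> 'o" where
  "tgt B xs = (case xs of [] \<Rightarrow> B | (Y, d, f) # ys \<Rightarrow> Y)"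

definition deg :: "('o, 'm) strg \<Rightarrow> int" where
  "deg xs = (\<Sum>(Y, d, f) \<leftarrow> xs. d)"

definition sdeg :: "('o, 'm) strg \<Rightarrow> int" where
  "sdeg xs = (\<Sum>(Y, d, f) \<leftarrow> xs. d - 1)"

primrec is_path :: "('o, 'm, 'r) gquiver \<Rightarrow> 'o \<Rightarrow> ('o, 'm) strg \<Rightarrow> bool" where
  "is_path Q B [] \<longleftrightarrow> B \<in> verts Q"
| "is_path Q B (x # xs) \<longleftrightarrow> (case x of (Y, d, f) \<Rightarrow>
     is_path Q B xs \<and> Y \<in> verts Q \<and> f \<in> carrier (arrs Q (tgt B xs) Y d))"

text \<open>Multiplication by \<open>(-1)^e\<close> in a module.\<close>

definition sgn_mult :: "('r, 'm) module \<Rightarrow> int \<Rightarrow> 'm \<Rightarrow> 'm" where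
  "sgn_mult M e x = (if even e then x else \<ominus>\<^bsub>M\<^esub> x)"

text \<open>Hochschild cochains of degree h: the arity n part has internal degree i = h - n.\<close>

definition out_mod ::
    "('o, 'm, 'r) gquiver \<Rightarrow> int \<Rightarrow> 'o \<Rightarrow> ('o, 'm) strg \<Rightarrow> ('r, 'm) module" where
  "out_mod Q h B xs = arrs Q B (tgt B xs) (deg xs + h - int (length xs))"

definition cochains :: "'r ring \<Rightarrow> ('o, 'm, 'r) gquiver \<Rightarrow> int \<Rightarrow> ('o, 'm) cochain set" where
  "cochains R Q h = {\<phi>.
     (\<forall>B xs. is_path Q B xs \<longrightarrow> \<phi> B xs \<in> carrier (out_mod Q h B xs)) \<and>
     (\<forall>B ys Y d f g zs. \<forall>r \<in> carrier R.
        is_path Q B (ys @ (Y, d, f) # zs) \<and> is_path Q B (ys @ (Y, d, g) # zs) \<longrightarrow>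
        (let M = arrs Q (tgt B zs) Y d; N = out_mod Q h B (ys @ (Y, d, f) # zs)
         in \<phi> B (ys @ (Y, d, r \<odot>\<^bsub>M\<^esub> f \<oplus>\<^bsub>M\<^esub> g) # zs)
            = r \<odot>\<^bsub>N\<^esub> \<phi> B (ys @ (Y, d, f) # zs) \<oplus>\<^bsub>N\<^esub> \<phi> B (ys @ (Y, d, g) # zs)))}"

text \<open>The isomorphism between cochains of Hochschild degree h and elements of degree h - 1 of
  the brace algebra \<open>C_br\<close>, with sign \<open>(-1)^(n i + (n-1)|f_n| + ... + |f_2|)\<close>; the latter are
  written as functions of (f_n, ..., f_1), \<open>\<sigma>\<close> being left implicit.  It is its own inverse.\<close>

primrec shuffle_exp :: "('o, 'm) strg \<Rightarrow> int" where
  "shuffle_exp [] = 0"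
| "shuffle_exp (x # xs) = int (length xs) * fst (snd x) + shuffle_exp xs"

definition susp ::
    "('o, 'm, 'r) gquiver \<Rightarrow> int \<Rightarrow> ('o, 'm) cochain \<Rightarrow> ('o, 'm) cochain" where
  "susp Q h \<phi> B xs = (let n = int (length xs) in
     sgn_mult (out_mod Q h B xs) (n * (h - n) + shuffle_exp xs) (\<phi> B xs))"

text \<open>All ways of inserting the elements (p_1, \<phi>_1), ..., (p_r, \<phi>_r) of \<open>C_br\<close> (p_j the degree)
  in this order into a string, each with the exponent of its Koszul sign: \<phi>_j passes all
  arguments to its left.  The number s is the \<open>\<Sigma>\<close>-degree of what precedes the string.\<close>

primrec insertions :: "'o \<Rightarrow> (int \<times> ('o, 'm) cochain) list \<Rightarrow> int \<Rightarrow> ('o, 'm) strg \<Rightarrow>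
    (int \<times> ('o, 'm) strg) list" where
  "insertions B [] s xs = [(0, xs)]"
| "insertions B (P # Ps) s xs = concat (map (\<lambda>i. concat (map (\<lambda>j.
     let a = take i xs; b = take j (drop i xs); c = drop (i + j) xs;
         p = fst P; t = s + sdeg a; Z = tgt B c
     in map (\<lambda>(e, ys). (p * t + e, a @ (tgt Z b, sdeg b + p + 1, snd P Z b) # ys))
          (insertions B Ps (t + sdeg b) c))
     [0..<Suc (length xs - i)])) [0..<Suc (length xs)])"

definition brace :: "('o, 'm, 'r) gquiver \<Rightarrow> int \<Rightarrow> ('o, 'm) cochain \<Rightarrow>
    (int \<times> ('o, 'm) cochain) list \<Rightarrow> ('o, 'm) cochain" where
  "brace Q p \<phi> Ps B xs =
     (let M = out_mod Q (p + (\<Sum>P \<leftarrow> Ps. fst P) + 1) B xs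
      in foldr (\<lambda>(e, ys) z. sgn_mult M e (\<phi> B ys) \<oplus>\<^bsub>M\<^esub> z) (insertions B Ps 0 xs) \<zero>\<^bsub>M\<^esub>)"

definition bracket :: "('o, 'm, 'r) gquiver \<Rightarrow> int \<Rightarrow> ('o, 'm) cochain \<Rightarrow>
    int \<Rightarrow> ('o, 'm) cochain \<Rightarrow> ('o, 'm) cochain" where
  "bracket Q p x q y B xs =
     (let M = out_mod Q (p + q + 1) B xs
      in brace Q p x [(q, y)] B xs \<ominus>\<^bsub>M\<^esub> sgn_mult M (p * q) (brace Q q y [(p, x)] B xs))"

text \<open>The Hochschild differential \<open>\<langle>b,-\<rangle>\<close> for a dg structure b (an element of degree 1 of
  \<open>C_br\<close>).  The global sign of the differential of a shifted complex is omitted; it affects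
  neither cocycles nor coboundaries.\<close>

definition hoch_d :: "('o, 'm, 'r) gquiver \<Rightarrow> ('o, 'm) cochain \<Rightarrow> int \<Rightarrow>
    ('o, 'm) cochain \<Rightarrow> ('o, 'm) cochain" where
  "hoch_d Q b h \<phi> = susp Q (h + 1) (bracket Q 1 b (h - 1) (susp Q h \<phi>))"

definition hoch_cocycles :: "'r ring \<Rightarrow> ('o, 'm, 'r) gquiver \<Rightarrow> ('o, 'm) cochain \<Rightarrow> int \<Rightarrow>
    ('o, 'm) cochain set" where
  "hoch_cocycles R Q b h = {\<phi> \<in> cochains R Q h.
     \<forall>B xs. is_path Q B xs \<longrightarrow> hoch_d Q b h \<phi> B xs = \<zero>\<^bsub>out_mod Q (h + 1) B xs\<^esub>}"

definition cohomologous :: "'r ring \<Rightarrow> ('o, 'm, 'r) gquiver \<Rightarrow> ('o, 'm) cochain \<Rightarrow> int \<Rightarrow>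
    (('o, 'm) cochain \<times> ('o, 'm) cochain) set" where
  "cohomologous R Q b h = {(\<phi>, \<psi>).
     \<phi> \<in> hoch_cocycles R Q b h \<and> \<psi> \<in> hoch_cocycles R Q b h \<and>
     (\<exists>\<eta> \<in> cochains R Q (h - 1). \<forall>B xs. is_path Q B xs \<longrightarrow>
        \<phi> B xs = \<psi> B xs \<oplus>\<^bsub>out_mod Q h B xs\<^esub> hoch_d Q b (h - 1) \<eta> B xs)}"

definition HH :: "'r ring \<Rightarrow> ('o, 'm, 'r) gquiver \<Rightarrow> ('o, 'm) cochain \<Rightarrow> int \<Rightarrow>
    ('o, 'm) cochain set set" where
  "HH R Q b h = hoch_cocycles R Q b h // cohomologous R Q b h"

text \<open>A linear category as a quiver concentrated in degree 0 with its dg structure.\<close>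

definition cat_quiver :: "('o, 'm, 'r) lincat \<Rightarrow> ('o, 'm, 'r) gquiver" where
  "cat_quiver A = \<lparr>verts = obs A, arrs = (\<lambda>X Y d. if d = 0 then mor A X Y
     else (mor A X Y)\<lparr>carrier := {\<zero>\<^bsub>mor A X Y\<^esub>}\<rparr>)\<rparr>"

definition cat_comp :: "('o, 'm, 'r) lincat \<Rightarrow> ('o, 'm) cochain" where
  "cat_comp A B xs = (case xs of [(Z, e, g), (Y, d, f)] \<Rightarrow> cmp A B Y Z g f
     | _ \<Rightarrow> \<zero>\<^bsub>mor A B (tgt B xs)\<^esub>)"

definition cat_dg :: "('o, 'm, 'r) lincat \<Rightarrow> ('o, 'm) cochain" where
  "cat_dg A = susp (cat_quiver A) 2 (cat_comp A)"

definition HH_ab :: "'r ring \<Rightarrow> ('o, 'm, 'r) lincat \<Rightarrow> int \<Rightarrow> ('o, 'm) cochain set set" where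
  "HH_ab R A h = HH R (cat_quiver (Inj A)) (cat_dg (Inj A)) h"


section \<open>Bounded below complexes\<close>

record ('o, 'm) cx =
  obj :: "int \<Rightarrow> 'o"
  dif :: "int \<Rightarrow> 'm"

definition complexes :: "('o, 'm, 'r) lincat \<Rightarrow> ('o, 'm) cx set" where
  "complexes A = {C. \<forall>n. obj C n \<in> obs A \<and> dif C n \<in> hom_set A (obj C n) (obj C (n + 1)) \<and>
     cmp A (obj C n) (obj C (n + 1)) (obj C (n + 2)) (dif C (n + 1)) (dif C n)
       = \<zero>\<^bsub>mor A (obj C n) (obj C (n + 2))\<^esub>}"

definition complexes_plus :: "('o, 'm, 'r) lincat \<Rightarrow> ('o, 'm) cx set" where
  "complexes_plus A = {C \<in> complexes A. \<exists>N. \<forall>n < N. zero_object A (obj C n)}"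

definition com_hom :: "('o, 'm, 'r) lincat \<Rightarrow> ('o, 'm) cx \<Rightarrow> ('o, 'm) cx \<Rightarrow> int \<Rightarrow>
    ('r, int \<Rightarrow> 'm) module" where
  "com_hom A C D p = \<lparr>
     carrier = {f. \<forall>i. f i \<in> hom_set A (obj C i) (obj D (i + p))},
     mult = undefined, one = undefined,
     zero = (\<lambda>i. \<zero>\<^bsub>mor A (obj C i) (obj D (i + p))\<^esub>),
     add = (\<lambda>f g i. f i \<oplus>\<^bsub>mor A (obj C i) (obj D (i + p))\<^esub> g i),
     smult = (\<lambda>r f i. r \<odot>\<^bsub>mor A (obj C i) (obj D (i + p))\<^esub> f i)\<rparr>"

text \<open>Composite of g from C to D of degree q and f from D to E of degree p.\<close>

definition com_cmp :: "('o, 'm, 'r) lincat \<Rightarrow> ('o, 'm) cx \<Rightarrow> ('o, 'm) cx \<Rightarrow> ('o, 'm) cx \<Rightarrow>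
    int \<Rightarrow> int \<Rightarrow> (int \<Rightarrow> 'm) \<Rightarrow> (int \<Rightarrow> 'm) \<Rightarrow> int \<Rightarrow> 'm" where
  "com_cmp A C D E p q f g =
     (\<lambda>i. cmp A (obj C i) (obj D (i + q)) (obj E (i + q + p)) (f (i + q)) (g i))"

definition com_idn :: "('o, 'm, 'r) lincat \<Rightarrow> ('o, 'm) cx \<Rightarrow> int \<Rightarrow> 'm" where
  "com_idn A C = (\<lambda>i. idn A (obj C i))"

definition com_d :: "('o, 'm, 'r) lincat \<Rightarrow> ('o, 'm) cx \<Rightarrow> ('o, 'm) cx \<Rightarrow> int \<Rightarrow>
    (int \<Rightarrow> 'm) \<Rightarrow> int \<Rightarrow> 'm" where
  "com_d A C D p f = (let M = com_hom A C D (p + 1) in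
     com_cmp A C D D 1 p (dif D) f \<ominus>\<^bsub>M\<^esub> sgn_mult M p (com_cmp A C C D p 1 f (dif C)))"

definition com_cocycles :: "('o, 'm, 'r) lincat \<Rightarrow> ('o, 'm) cx \<Rightarrow> ('o, 'm) cx \<Rightarrow> int \<Rightarrow>
    (int \<Rightarrow> 'm) set" where
  "com_cocycles A C D p =
     {f \<in> carrier (com_hom A C D p). com_d A C D p f = \<zero>\<^bsub>com_hom A C D (p + 1)\<^esub>}"

definition ext_class :: "('o, 'm, 'r) lincat \<Rightarrow> ('o, 'm) cx \<Rightarrow> ('o, 'm) cx \<Rightarrow> int \<Rightarrow>
    (int \<Rightarrow> 'm) \<Rightarrow> (int \<Rightarrow> 'm) set" where
  "ext_class A C D p f =
     (com_d A C D (p - 1) ` carrier (com_hom A C D (p - 1))) +>\<^bsub>com_hom A C D p\<^esub> f"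

text \<open>Cohomology of the morphism complexes: for complexes over \<^term>\<open>Inj A\<close>, these are the
  graded morphisms of \<open>D^+(A)\<close>, which is modelled by \<open>K^+(Inj A)\<close>.\<close>

definition Ext :: "('o, 'm, 'r) lincat \<Rightarrow> ('o, 'm) cx \<Rightarrow> ('o, 'm) cx \<Rightarrow> int \<Rightarrow>
    (int \<Rightarrow> 'm) set set" where
  "Ext A C D p = ext_class A C D p ` com_cocycles A C D p"

definition homotopy_equivalent ::
    "('o, 'm, 'r) lincat \<Rightarrow> ('o, 'm) cx \<Rightarrow> ('o, 'm) cx \<Rightarrow> bool" where
  "homotopy_equivalent A C D \<longleftrightarrow>
     (\<exists>f \<in> com_cocycles A C D 0. \<exists>g \<in> com_cocycles A D C 0.
        ext_class A C C 0 (com_cmp A C D C 0 0 g f) = ext_class A C C 0 (com_idn A C) \<and>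
        ext_class A D D 0 (com_cmp A D C D 0 0 f g) = ext_class A D D 0 (com_idn A D))"

text \<open>The dg category of bounded below complexes over A, as a graded quiver.\<close>

definition com_quiver :: "('o, 'm, 'r) lincat \<Rightarrow> (('o, 'm) cx, int \<Rightarrow> 'm, 'r) gquiver" where
  "com_quiver A = \<lparr>verts = complexes_plus A, arrs = com_hom A\<rparr>"

text \<open>Degree 2 part of the graded centre of \<open>K^+(A)\<close>, given by families of classes.\<close>

definition graded_centre2 :: "('o, 'm, 'r) lincat \<Rightarrow> (('o, 'm) cx \<Rightarrow> (int \<Rightarrow> 'm) set) set" where
  "graded_centre2 A = {\<zeta>.
     (\<forall>C \<in> complexes_plus A. \<zeta> C \<in> Ext A C C 2) \<and>
     (\<forall>C \<in> complexes_plus A. \<forall>D \<in> complexes_plus A. \<forall>p. \<forall>f \<in> com_cocycles A C D p.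
        \<forall>z \<in> \<zeta> C. \<forall>w \<in> \<zeta> D.
        ext_class A C D (p + 2) (com_cmp A C D D 2 p w f)
          = ext_class A C D (p + 2) (com_cmp A C C D p 2 f z))}"


section \<open>The characteristic morphism\<close>

text \<open>Componentwise extension of an arity n cochain of A to complexes over A.
  \<^term>\<open>component i xs\<close> is the string of components of xs starting in position i.\<close>

primrec component :: "int \<Rightarrow> (('o, 'm) cx, int \<Rightarrow> 'm) strg \<Rightarrow> ('o, 'm) strg" where
  "component i [] = []"
| "component i (x # xs) = (case x of (D, d, f) \<Rightarrow>
     (obj D (i + deg xs + d), 0, f (i + deg xs)) # component i xs)"

definition componentwise :: "('o, 'm, 'r) lincat \<Rightarrow> nat \<Rightarrow> ('o, 'm) cochain \<Rightarrow>
    (('o, 'm) cx, int \<Rightarrow> 'm) cochain" where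
  "componentwise A n \<phi> C xs = (if length xs = n then (\<lambda>i. \<phi> (obj C i) (component i xs))
     else \<zero>\<^bsub>out_mod (com_quiver A) (int n) C xs\<^esub>)"

definition delta :: "('o, 'm, 'r) lincat \<Rightarrow> (('o, 'm) cx, int \<Rightarrow> 'm) cochain" where
  "delta A C xs = (if xs = [] then dif C else \<zero>\<^bsub>out_mod (com_quiver A) 1 C xs\<^esub>)"

text \<open>Since A is concentrated in degree 0, cochains of A of Hochschild degree n have arity n.\<close>

definition embr :: "('o, 'm, 'r) lincat \<Rightarrow> nat \<Rightarrow> ('o, 'm) cochain \<Rightarrow>
    (('o, 'm) cx, int \<Rightarrow> 'm) cochain" where
  "embr A n \<phi> = (let Q = com_quiver A in
     susp Q (int n) (\<lambda>C xs. \<Oplus>\<^bsub>out_mod Q (int n) C xs\<^esub> m \<in> {..n}.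
       brace Q (int n - 1) (susp Q (int n) (componentwise A n \<phi>))
         (replicate m (0, susp Q 1 (delta A))) C xs))"

definition char_mor :: "('o, 'm, 'r) lincat \<Rightarrow> ('o, 'm) cochain set \<Rightarrow>
    ('o, 'm) cx \<Rightarrow> (int \<Rightarrow> 'm) set" where
  "char_mor A c C = ext_class (Inj A) C C 2 (embr (Inj A) 2 (SOME \<phi>. \<phi> \<in> c) C [])"


section \<open>First order deformations\<close>

definition dual_numbers :: "'r ring \<Rightarrow> ('r \<times> 'r) ring" where
  "dual_numbers k = \<lparr>carrier = carrier k \<times> carrier k,
     mult = (\<lambda>(a, b) (a', b'). (a \<otimes>\<^bsub>k\<^esub> a', a \<otimes>\<^bsub>k\<^esub> b' \<oplus>\<^bsub>k\<^esub> b \<otimes>\<^bsub>k\<^esub> a')),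
     one = (\<one>\<^bsub>k\<^esub>, \<zero>\<^bsub>k\<^esub>), zero = (\<zero>\<^bsub>k\<^esub>, \<zero>\<^bsub>k\<^esub>),
     add = (\<lambda>(a, b) (a', b'). (a \<oplus>\<^bsub>k\<^esub> a', b \<oplus>\<^bsub>k\<^esub> b'))\<rparr>"

definition dual_eps :: "'r ring \<Rightarrow> 'r \<times> 'r" where
  "dual_eps k = (\<zero>\<^bsub>k\<^esub>, \<one>\<^bsub>k\<^esub>)"

definition eps_mor :: "'r ring \<Rightarrow> ('p, 'n, 'r \<times> 'r) lincat \<Rightarrow> 'p \<Rightarrow> 'n" where
  "eps_mor k B X = dual_eps k \<odot>\<^bsub>mor B X X\<^esub> idn B X"

text \<open>\<open>k[\<epsilon>] \<otimes> M\<close>, the pair (x, y) standing for \<open>x + y \<epsilon>\<close>.\<close>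

definition dual_module :: "('r, 'm) module \<Rightarrow> ('r \<times> 'r, 'm \<times> 'm) module" where
  "dual_module M = \<lparr>carrier = carrier M \<times> carrier M,
     mult = undefined, one = undefined, zero = (\<zero>\<^bsub>M\<^esub>, \<zero>\<^bsub>M\<^esub>),
     add = (\<lambda>(x, y) (x', y'). (x \<oplus>\<^bsub>M\<^esub> x', y \<oplus>\<^bsub>M\<^esub> y')),
     smult = (\<lambda>(a, b) (x, y). (a \<odot>\<^bsub>M\<^esub> x, a \<odot>\<^bsub>M\<^esub> y \<oplus>\<^bsub>M\<^esub> b \<odot>\<^bsub>M\<^esub> x))\<rparr>"

text \<open>The linear deformation with composition \<open>m + \<phi> \<epsilon>\<close>.  Its identities are
  \<open>1 - \<phi>(1,1) \<epsilon>\<close>, as the cocycle \<phi> need not be normalised.\<close>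

definition linear_deformation ::
    "('o, 'm, 'r) lincat \<Rightarrow> ('o, 'm) cochain \<Rightarrow> ('o, 'm \<times> 'm, 'r \<times> 'r) lincat" where
  "linear_deformation A \<phi> = \<lparr>obs = obs A,
     mor = (\<lambda>X Y. dual_module (mor A X Y)),
     cmp = (\<lambda>X Y Z (g, g') (f, f').
       (cmp A X Y Z g f,
        cmp A X Y Z g f' \<oplus>\<^bsub>mor A X Z\<^esub> cmp A X Y Z g' f
          \<oplus>\<^bsub>mor A X Z\<^esub> \<phi> X [(Z, 0, g), (Y, 0, f)])),
     idn = (\<lambda>X. (idn A X, \<ominus>\<^bsub>mor A X X\<^esub> \<phi> X [(X, 0, idn A X), (X, 0, idn A X)]))\<rparr>"

text \<open>\<open>Hom_{k[\<epsilon>]}(k, B)\<close>: the full subcategory of the objects annihilated by \<open>\<epsilon>\<close>, as a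
  k-linear category.\<close>

definition restrict_scalars :: "'r ring \<Rightarrow> ('r \<times> 'r, 'n) module \<Rightarrow> ('r, 'n) module" where
  "restrict_scalars k M = \<lparr>carrier = carrier M, mult = mult M, one = one M, zero = zero M,
     add = add M, smult = (\<lambda>a. smult M (a, \<zero>\<^bsub>k\<^esub>))\<rparr>"

definition reduction :: "'r ring \<Rightarrow> ('p, 'n, 'r \<times> 'r) lincat \<Rightarrow> ('p, 'n, 'r) lincat" where
  "reduction k B = \<lparr>obs = {X \<in> obs B. eps_mor k B X = \<zero>\<^bsub>mor B X X\<^esub>},
     mor = (\<lambda>X Y. restrict_scalars k (mor B X Y)), cmp = cmp B, idn = idn B\<rparr>"

text \<open>Flatness in the sense of Lowen and Van den Bergh: the functors \<open>Ext^i_{k[\<epsilon>]}(X,-)\<close>, i > 0,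
  are effaceable for finitely presented X.  As finitely generated \<open>k[\<epsilon>]\<close>-modules are sums of
  copies of k and \<open>k[\<epsilon>]\<close>, only X = k matters, and then \<open>Ext^i(k, M) = Ker \<epsilon>_M / Im \<epsilon>_M\<close>.
  Its image in \<open>Ext^i(k, N)\<close> vanishes iff \<open>Ker \<epsilon>_M \<rightarrow> M \<rightarrow> N \<rightarrow> Coker \<epsilon>_N\<close> does.\<close>

definition flat_over_dual :: "'r ring \<Rightarrow> ('p, 'n, 'r \<times> 'r) lincat \<Rightarrow> bool" where
  "flat_over_dual k B \<longleftrightarrow> (\<forall>M \<in> obs B. \<exists>N \<in> obs B. \<exists>u. mono_mor B M N u \<and>
     (\<forall>K v Q q. is_kernel B M M (eps_mor k B M) K v \<and> is_cokernel B N N (eps_mor k B N) Q q \<longrightarrow>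
        cmp B K N Q q (cmp B K M N u v) = \<zero>\<^bsub>mor B K Q\<^esub>))"

definition abelian_deformation :: "'r ring \<Rightarrow> ('o, 'm, 'r) lincat \<Rightarrow>
    ('p, 'n, 'r \<times> 'r) lincat \<Rightarrow> ('o \<Rightarrow> 'p) \<Rightarrow> ('o \<Rightarrow> 'o \<Rightarrow> 'm \<Rightarrow> 'n) \<Rightarrow> bool" where
  "abelian_deformation k A B Fo Fm \<longleftrightarrow> abelian_category (dual_numbers k) B \<and>
     flat_over_dual k B \<and> linear_equivalence k A (reduction k B) Fo Fm"

text \<open>B is the abelian deformation of A belonging to the 2-cocycle \<phi> of \<^term>\<open>Inj A\<close>: there is
  an equivalence G of the linear deformation with \<^term>\<open>Inj B\<close> compatible with reductions, that
  is, with isomorphisms \<open>F E \<cong> Hom_{k[\<epsilon>]}(k, G E) = Ker \<epsilon>_{G E}\<close> natural in E.\<close>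

definition deformation_along :: "'r ring \<Rightarrow> ('o, 'm, 'r) lincat \<Rightarrow> ('o, 'm) cochain \<Rightarrow>
    ('p, 'n, 'r \<times> 'r) lincat \<Rightarrow> ('o \<Rightarrow> 'p) \<Rightarrow> ('o \<Rightarrow> 'o \<Rightarrow> 'm \<Rightarrow> 'n) \<Rightarrow> bool" where
  "deformation_along k A \<phi> B Fo Fm \<longleftrightarrow> abelian_deformation k A B Fo Fm \<and>
     (\<exists>Go Gm \<kappa>.
        linear_equivalence (dual_numbers k) (linear_deformation (Inj A) \<phi>) (Inj B) Go Gm \<and>
        (\<forall>E \<in> obs (Inj A). is_kernel B (Go E) (Go E) (eps_mor k B (Go E)) (Fo E) (\<kappa> E)) \<and>
        (\<forall>E \<in> obs (Inj A). \<forall>E' \<in> obs (Inj A). \<forall>f \<in> hom_set A E E'. \<forall>f' \<in> hom_set A E E'.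
           cmp B (Fo E) (Go E) (Go E') (Gm E E' (f, f')) (\<kappa> E)
             = cmp B (Fo E) (Fo E') (Go E') (\<kappa> E') (Fm E E' f)))"


section \<open>Deformations of objects of derived categories\<close>

text \<open>\<^term>\<open>is_cohomology A C n Z u H q\<close>: u from Z to C^n is the kernel of the differential,
  and q from Z to H is the cokernel of the map from C^(n-1) to Z.\<close>

definition is_cohomology :: "('o, 'm, 'r) lincat \<Rightarrow> ('o, 'm) cx \<Rightarrow> int \<Rightarrow>
    'o \<Rightarrow> 'm \<Rightarrow> 'o \<Rightarrow> 'm \<Rightarrow> bool" where
  "is_cohomology A C n Z u H q \<longleftrightarrow>
     is_kernel A (obj C n) (obj C (n + 1)) (dif C n) Z u \<and>
     (\<exists>e \<in> hom_set A (obj C (n - 1)) Z.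
        cmp A (obj C (n - 1)) Z (obj C n) u e = dif C (n - 1) \<and>
        is_cokernel A (obj C (n - 1)) Z e H q)"

definition bounded_cohomology :: "('o, 'm, 'r) lincat \<Rightarrow> ('o, 'm) cx \<Rightarrow> bool" where
  "bounded_cohomology A C \<longleftrightarrow>
     (\<exists>N. \<forall>n. \<bar>n\<bar> \<ge> N \<longrightarrow> (\<forall>Z u H q. is_cohomology A C n Z u H q \<longrightarrow> zero_object A H))"

definition quasi_iso ::
    "('o, 'm, 'r) lincat \<Rightarrow> ('o, 'm) cx \<Rightarrow> ('o, 'm) cx \<Rightarrow> (int \<Rightarrow> 'm) \<Rightarrow> bool" where
  "quasi_iso A C D f \<longleftrightarrow> f \<in> com_cocycles A C D 0 \<and>
     (\<forall>n Z u H q Z' u' H' q'.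
        is_cohomology A C n Z u H q \<and> is_cohomology A D n Z' u' H' q' \<longrightarrow>
        (\<exists>z \<in> hom_set A Z Z'. \<exists>h.
           cmp A Z Z' (obj D n) u' z = cmp A Z (obj C n) (obj D n) (f n) u \<and>
           iso_mor A H H' h \<and> cmp A Z H H' h q = cmp A Z Z' H' q' z))"

text \<open>\<open>R Hom_{k[\<epsilon>]}(k, C')\<close> is isomorphic to C in \<open>D^+(A)\<close>: for an injective resolution J of C',
  the complex \<open>Hom_{k[\<epsilon>]}(k, J) = Ker \<epsilon>_J\<close> corresponds under F to a complex K of injectives of A,
  and K is isomorphic to C in \<open>K^+(Inj A)\<close>.\<close>

definition deforms_to :: "'r ring \<Rightarrow> ('o, 'm, 'r) lincat \<Rightarrow> ('p, 'n, 'r \<times> 'r) lincat \<Rightarrow>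
    ('o \<Rightarrow> 'p) \<Rightarrow> ('o \<Rightarrow> 'o \<Rightarrow> 'm \<Rightarrow> 'n) \<Rightarrow> ('o, 'm) cx \<Rightarrow> ('p, 'n) cx \<Rightarrow> bool" where
  "deforms_to k A B Fo Fm C C' \<longleftrightarrow>
     (\<exists>J \<in> complexes_plus (Inj B). \<exists>s. quasi_iso B C' J s \<and>
       (\<exists>K \<in> complexes_plus (Inj A). \<exists>v.
          (\<forall>n. is_kernel B (obj J n) (obj J n) (eps_mor k B (obj J n)) (Fo (obj K n)) (v n) \<and>
             cmp B (Fo (obj K n)) (obj J n) (obj J (n + 1)) (dif J n) (v n)
               = cmp B (Fo (obj K n)) (Fo (obj K (n + 1))) (obj J (n + 1)) (v (n + 1))
                   (Fm (obj K n) (obj K (n + 1)) (dif K n))) \<and>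
          homotopy_equivalent (Inj A) K C))"

text \<open>The obstruction for a complex \<open>(I, \<delta>)\<close> of injectives is the class of \<open>\<phi>(\<delta>, \<delta>)\<close>, \<phi> applied
  componentwise, with the following sign.  In \<open>m + \<phi> \<epsilon>\<close> the graded lift \<open>\<delta> + \<delta>' \<epsilon>\<close> of \<open>\<delta>\<close> has
  square \<open>(\<phi>(\<delta>, \<delta>) + d \<delta>') \<epsilon>\<close>, so lifting \<open>\<delta>\<close> amounts to solving \<open>d \<delta>' = - \<phi>(\<delta>, \<delta>)\<close>, and the
  class of the right hand side is taken.  This is also the sign of \<open>\<phi>{\<delta>, \<delta>}\<close>: the element of
  \<open>C_br\<close> belonging to \<phi> sends \<open>(\<sigma>\<delta>, \<sigma>\<delta>)\<close> to \<open>(-1)^|\<delta>| \<sigma>\<phi>(\<delta>, \<delta>) = - \<sigma>\<phi>(\<delta>, \<delta>)\<close>, just as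
  \<open>m{\<delta>, \<delta>} = - \<delta>\<delta>\<close>.\<close>

definition obstruction_cocycle ::
    "('o, 'm, 'r) lincat \<Rightarrow> ('o, 'm) cochain \<Rightarrow> ('o, 'm) cx \<Rightarrow> int \<Rightarrow> 'm" where
  "obstruction_cocycle A \<phi> C = componentwise (Inj A) 2 \<phi> C [(C, 1, dif C), (C, 1, dif C)]"

definition obstruction ::
    "('o, 'm, 'r) lincat \<Rightarrow> ('o, 'm) cochain \<Rightarrow> ('o, 'm) cx \<Rightarrow> (int \<Rightarrow> 'm) set" where
  "obstruction A \<phi> C = ext_class (Inj A) C C 2
     (\<ominus>\<^bsub>com_hom (Inj A) C C 2\<^esub> obstruction_cocycle A \<phi> C)"

end

theory Submission
  imports Defs
begin

text \<open>On the arity zero part, \<open>embr\<close> sends a 2-cocycle \<open>\<phi>\<close> to \<open>\<phi>{\<delta>, \<delta>}\<close>, which with the Koszul sign is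
  \<open>- \<phi>(\<delta>, \<delta>)\<close>; replacing \<open>\<phi>\<close> by \<open>\<phi> + d\<eta>\<close> changes it by the boundary of \<open>- \<eta>(\<delta>)\<close>, and the cocycle
  identity makes it a cocycle and central up to homotopy.

  In \<open>m + \<phi>\<epsilon>\<close> the graded lifts \<open>\<delta> + h\<epsilon>\<close> of \<open>\<delta>\<close> that square to zero are the solutions of
  \<open>dh = - \<phi>(\<delta>, \<delta>)\<close>, and they are complexes of injectives of the deformation.  Conversely a
  deformation of C is represented by such a lift for a complex K homotopy equivalent to C, and
  centrality carries the vanishing of the class from K to C.  The lift of a complex that is exact
  in degree n is exact in degree n, because the deformation has enough injectives of the form
  \<open>G E\<close> and maps into these can be extended and factored one power of \<open>\<epsilon>\<close> at a time.\<close>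

section \<open>Linear categories\<close>

text \<open>The deformation B is accessible only through F, G and the embeddings
  \<open>\<kappa> E\<close> of \<open>Fo E\<close> into \<open>Go E\<close> as the kernel of
  \<epsilon>. Every question about complexes over B is therefore moved through G into equations
  between pairs (f, f'), where \<phi> enters the second component alone. Two obstacles shape the
  work. Lifting \<delta> is a condition on one chosen complex, with no evident invariance under
  homotopy equivalence; this is why the graded centre property serves as a tool and not only as a
  conclusion. And \<phi> is not normalised: the identities of the linear deformation carry a
  correction term, so that even an isomorphism of A needs a correction in its second component
  before its lift has an inverse. Since hom-sets depend on objects and objects of a complex on
  integer indices, equal indices such as i + q + p and i + (p + q) have to be brought to one shape
  before anything can be added. Many statements about complexes therefore take the total degree as a
  separate variable.\<close>

lemma (in abelian_group) minus_self [simp]: "x \<in> carrier G \<Longrightarrow> x \<ominus> x = \<zero>"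
  by (simp add: minus_eq r_neg)

lemma (in abelian_group) minus_eq_zero_iff:
  "x \<in> carrier G \<Longrightarrow> y \<in> carrier G \<Longrightarrow> x \<ominus> y = \<zero> \<longleftrightarrow> x = y"
  using add.inv_solve_right'[of \<zero> x y] by (auto simp: minus_eq)

lemma (in abelian_group) minus_eq_iff_add:
  "x \<in> carrier G \<Longrightarrow> y \<in> carrier G \<Longrightarrow> z \<in> carrier G \<Longrightarrow> x \<ominus> y = z \<longleftrightarrow> x = z \<oplus> y"
  by (metis a_minus_def add.inv_closed add.inv_solve_right)

text \<open>The ring is a parameter because the same algebra is used over k for A and
  \<open>Inj A\<close> and over the dual numbers for B and \<open>Inj B\<close>.\<close>

locale lincat =
  fixes R :: "'r ring" and A :: "('o, 'm, 'r) lincat"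
  assumes lin: "linear_category R A"
begin

lemma hom_module: "X \<in> obs A \<Longrightarrow> Y \<in> obs A \<Longrightarrow> module R (mor A X Y)"
  using lin by (simp add: linear_category_def)

lemma hom_group: "X \<in> obs A \<Longrightarrow> Y \<in> obs A \<Longrightarrow> abelian_group (mor A X Y)"
  using hom_module module.axioms(2) by blast

lemma scalars_cring: "X \<in> obs A \<Longrightarrow> cring R"
  using hom_module module.axioms(1) by blast

lemma id_closed [simp, intro]: "X \<in> obs A \<Longrightarrow> idn A X \<in> hom_set A X X"
  using lin by (simp add: linear_category_def)

lemma cmp_closed [simp, intro]:
  "\<lbrakk>X \<in> obs A; Y \<in> obs A; Z \<in> obs A; g \<in> hom_set A Y Z; f \<in> hom_set A X Y\<rbrakk>
    \<Longrightarrow> cmp A X Y Z g f \<in> hom_set A X Z"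
  using lin by (simp add: linear_category_def)

lemma cmp_id_right [simp]:
  "\<lbrakk>X \<in> obs A; Y \<in> obs A; f \<in> hom_set A X Y\<rbrakk> \<Longrightarrow> cmp A X X Y f (idn A X) = f"
  using lin by (simp add: linear_category_def)

lemma cmp_id_left [simp]:
  "\<lbrakk>X \<in> obs A; Y \<in> obs A; f \<in> hom_set A X Y\<rbrakk> \<Longrightarrow> cmp A X Y Y (idn A Y) f = f"
  using lin by (simp add: linear_category_def)

lemma cmp_assoc:
  "\<lbrakk>W \<in> obs A; X \<in> obs A; Y \<in> obs A; Z \<in> obs A; h \<in> hom_set A Y Z; g \<in> hom_set A X Y;
    f \<in> hom_set A W X\<rbrakk>
    \<Longrightarrow> cmp A W X Z (cmp A X Y Z h g) f = cmp A W Y Z h (cmp A W X Y g f)"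
  using lin by (simp add: linear_category_def)

lemma cmp_linear_left:
  "\<lbrakk>X \<in> obs A; Y \<in> obs A; Z \<in> obs A; r \<in> carrier R; g \<in> hom_set A Y Z; g' \<in> hom_set A Y Z;
    f \<in> hom_set A X Y\<rbrakk>
    \<Longrightarrow> cmp A X Y Z (r \<odot>\<^bsub>mor A Y Z\<^esub> g \<oplus>\<^bsub>mor A Y Z\<^esub> g') f
          = r \<odot>\<^bsub>mor A X Z\<^esub> cmp A X Y Z g f \<oplus>\<^bsub>mor A X Z\<^esub> cmp A X Y Z g' f"
  using lin unfolding linear_category_def by blast

lemma cmp_linear_right:
  "\<lbrakk>X \<in> obs A; Y \<in> obs A; Z \<in> obs A; r \<in> carrier R; g \<in> hom_set A Y Z; f \<in> hom_set A X Y;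
    f' \<in> hom_set A X Y\<rbrakk>
    \<Longrightarrow> cmp A X Y Z g (r \<odot>\<^bsub>mor A X Y\<^esub> f \<oplus>\<^bsub>mor A X Y\<^esub> f')
          = r \<odot>\<^bsub>mor A X Z\<^esub> cmp A X Y Z g f \<oplus>\<^bsub>mor A X Z\<^esub> cmp A X Y Z g f'"
  using lin unfolding linear_category_def by blast

lemma hom_zero [simp, intro]: "X \<in> obs A \<Longrightarrow> Y \<in> obs A \<Longrightarrow> \<zero>\<^bsub>mor A X Y\<^esub> \<in> hom_set A X Y"
  by (simp add: abelian_group.axioms(1) abelian_monoid.zero_closed hom_group)

lemma hom_add [simp, intro]:
  "\<lbrakk>X \<in> obs A; Y \<in> obs A; f \<in> hom_set A X Y; g \<in> hom_set A X Y\<rbrakk>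
    \<Longrightarrow> f \<oplus>\<^bsub>mor A X Y\<^esub> g \<in> hom_set A X Y"
  by (simp add: abelian_group.axioms(1) abelian_monoid.a_closed hom_group)

lemma hom_inv [simp, intro]:
  "\<lbrakk>X \<in> obs A; Y \<in> obs A; f \<in> hom_set A X Y\<rbrakk> \<Longrightarrow> \<ominus>\<^bsub>mor A X Y\<^esub> f \<in> hom_set A X Y"
  by (simp add: abelian_group.a_inv_closed hom_group)

lemma hom_minus [simp, intro]:
  "\<lbrakk>X \<in> obs A; Y \<in> obs A; f \<in> hom_set A X Y; g \<in> hom_set A X Y\<rbrakk>
    \<Longrightarrow> f \<ominus>\<^bsub>mor A X Y\<^esub> g \<in> hom_set A X Y"
  by (simp add: abelian_group.minus_closed hom_group)

lemma hom_add_zero [simp]: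
  "\<lbrakk>X \<in> obs A; Y \<in> obs A; f \<in> hom_set A X Y\<rbrakk> \<Longrightarrow> f \<oplus>\<^bsub>mor A X Y\<^esub> \<zero>\<^bsub>mor A X Y\<^esub> = f"
  "\<lbrakk>X \<in> obs A; Y \<in> obs A; f \<in> hom_set A X Y\<rbrakk> \<Longrightarrow> \<zero>\<^bsub>mor A X Y\<^esub> \<oplus>\<^bsub>mor A X Y\<^esub> f = f"
  using hom_group by (auto simp: abelian_group.axioms(1) abelian_monoid.r_zero abelian_monoid.l_zero)

lemma hom_inv_zero [simp]:
  "X \<in> obs A \<Longrightarrow> Y \<in> obs A \<Longrightarrow> \<ominus>\<^bsub>mor A X Y\<^esub> \<zero>\<^bsub>mor A X Y\<^esub> = \<zero>\<^bsub>mor A X Y\<^esub>"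
  by (meson abelian_group.minus_equality abelian_group.minus_minus hom_add_zero hom_group hom_zero)

lemma hom_sgn_mult [simp, intro]:
  "\<lbrakk>X \<in> obs A; Y \<in> obs A; f \<in> hom_set A X Y\<rbrakk> \<Longrightarrow> sgn_mult (mor A X Y) e f \<in> hom_set A X Y"
  by (simp add: sgn_mult_def)

lemma smult_one [simp]:
  "\<lbrakk>X \<in> obs A; Y \<in> obs A; f \<in> hom_set A X Y\<rbrakk> \<Longrightarrow> \<one>\<^bsub>R\<^esub> \<odot>\<^bsub>mor A X Y\<^esub> f = f"
  by (simp add: hom_module module.smult_one)

lemma smult_closed [simp, intro]:
  "\<lbrakk>X \<in> obs A; Y \<in> obs A; r \<in> carrier R; f \<in> hom_set A X Y\<rbrakk> \<Longrightarrow> r \<odot>\<^bsub>mor A X Y\<^esub> f \<in> hom_set A X Y"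
  by (rule module.smult_closed[OF hom_module])

lemma one_scalar: "X \<in> obs A \<Longrightarrow> \<one>\<^bsub>R\<^esub> \<in> carrier R"
  using scalars_cring cring.axioms(1) ring.is_monoid monoid.one_closed by blast

lemma cmp_add_left:
  "\<lbrakk>X \<in> obs A; Y \<in> obs A; Z \<in> obs A; g \<in> hom_set A Y Z; g' \<in> hom_set A Y Z; f \<in> hom_set A X Y\<rbrakk>
    \<Longrightarrow> cmp A X Y Z (g \<oplus>\<^bsub>mor A Y Z\<^esub> g') f
          = cmp A X Y Z g f \<oplus>\<^bsub>mor A X Z\<^esub> cmp A X Y Z g' f"
  using cmp_linear_left[of X Y Z "\<one>\<^bsub>R\<^esub>" g g' f] by (simp add: one_scalar)

lemma cmp_add_right:
  "\<lbrakk>X \<in> obs A; Y \<in> obs A; Z \<in> obs A; g \<in> hom_set A Y Z; f \<in> hom_set A X Y; f' \<in> hom_set A X Y\<rbrakk>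
    \<Longrightarrow> cmp A X Y Z g (f \<oplus>\<^bsub>mor A X Y\<^esub> f')
          = cmp A X Y Z g f \<oplus>\<^bsub>mor A X Z\<^esub> cmp A X Y Z g f'"
  using cmp_linear_right[of X Y Z "\<one>\<^bsub>R\<^esub>" g f f'] by (simp add: one_scalar)

lemma cmp_zero_left [simp]:
  assumes "X \<in> obs A" "Y \<in> obs A" "Z \<in> obs A" "f \<in> hom_set A X Y"
  shows "cmp A X Y Z \<zero>\<^bsub>mor A Y Z\<^esub> f = \<zero>\<^bsub>mor A X Z\<^esub>"
proof -
  interpret abelian_group "mor A X Z" using assms hom_group by blast
  show ?thesis
    using cmp_add_left[of X Y Z "\<zero>\<^bsub>mor A Y Z\<^esub>" "\<zero>\<^bsub>mor A Y Z\<^esub>" f] assms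
    by (metis add.l_cancel_one' cmp_closed hom_add_zero(1) hom_zero)
qed

lemma cmp_zero_right [simp]:
  assumes "X \<in> obs A" "Y \<in> obs A" "Z \<in> obs A" "g \<in> hom_set A Y Z"
  shows "cmp A X Y Z g \<zero>\<^bsub>mor A X Y\<^esub> = \<zero>\<^bsub>mor A X Z\<^esub>"
proof -
  interpret abelian_group "mor A X Z" using assms hom_group by blast
  show ?thesis
    using cmp_add_right[of X Y Z g "\<zero>\<^bsub>mor A X Y\<^esub>" "\<zero>\<^bsub>mor A X Y\<^esub>"] assms
    by (metis add.l_cancel_one' cmp_closed hom_add_zero(1) hom_zero)
qed

lemma cmp_inv_left:
  assumes "X \<in> obs A" "Y \<in> obs A" "Z \<in> obs A" "g \<in> hom_set A Y Z" "f \<in> hom_set A X Y"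
  shows "cmp A X Y Z (\<ominus>\<^bsub>mor A Y Z\<^esub> g) f = \<ominus>\<^bsub>mor A X Z\<^esub> cmp A X Y Z g f"
proof -
  interpret XZ: abelian_group "mor A X Z" using assms hom_group by blast
  interpret YZ: abelian_group "mor A Y Z" using assms hom_group by blast
  have "cmp A X Y Z (\<ominus>\<^bsub>mor A Y Z\<^esub> g) f \<oplus>\<^bsub>mor A X Z\<^esub> cmp A X Y Z g f = \<zero>\<^bsub>mor A X Z\<^esub>"
    using assms by (simp add: cmp_add_left[symmetric] YZ.l_neg)
  then show ?thesis using assms by (metis XZ.minus_equality cmp_closed hom_inv)
qed

lemma cmp_inv_right:
  assumes "X \<in> obs A" "Y \<in> obs A" "Z \<in> obs A" "g \<in> hom_set A Y Z" "f \<in> hom_set A X Y"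
  shows "cmp A X Y Z g (\<ominus>\<^bsub>mor A X Y\<^esub> f) = \<ominus>\<^bsub>mor A X Z\<^esub> cmp A X Y Z g f"
proof -
  interpret XZ: abelian_group "mor A X Z" using assms hom_group by blast
  interpret XY: abelian_group "mor A X Y" using assms hom_group by blast
  have "cmp A X Y Z g (\<ominus>\<^bsub>mor A X Y\<^esub> f) \<oplus>\<^bsub>mor A X Z\<^esub> cmp A X Y Z g f = \<zero>\<^bsub>mor A X Z\<^esub>"
    using assms by (simp add: cmp_add_right[symmetric] XY.l_neg)
  then show ?thesis using assms by (metis XZ.minus_equality cmp_closed hom_inv)
qed

lemma cmp_minus_left:
  assumes "X \<in> obs A" "Y \<in> obs A" "Z \<in> obs A" "g \<in> hom_set A Y Z" "g' \<in> hom_set A Y Z"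
    "f \<in> hom_set A X Y"
  shows "cmp A X Y Z (g \<ominus>\<^bsub>mor A Y Z\<^esub> g') f = cmp A X Y Z g f \<ominus>\<^bsub>mor A X Z\<^esub> cmp A X Y Z g' f"
  using assms by (simp add: a_minus_def cmp_add_left cmp_inv_left)

lemma cmp_minus_right:
  assumes "X \<in> obs A" "Y \<in> obs A" "Z \<in> obs A" "g \<in> hom_set A Y Z" "f \<in> hom_set A X Y"
    "f' \<in> hom_set A X Y"
  shows "cmp A X Y Z g (f \<ominus>\<^bsub>mor A X Y\<^esub> f') = cmp A X Y Z g f \<ominus>\<^bsub>mor A X Z\<^esub> cmp A X Y Z g f'"
  using assms by (simp add: a_minus_def cmp_add_right cmp_inv_right)

lemma cmp_smult_left:
  "\<lbrakk>X \<in> obs A; Y \<in> obs A; Z \<in> obs A; r \<in> carrier R; g \<in> hom_set A Y Z; f \<in> hom_set A X Y\<rbrakk>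
    \<Longrightarrow> cmp A X Y Z (r \<odot>\<^bsub>mor A Y Z\<^esub> g) f = r \<odot>\<^bsub>mor A X Z\<^esub> cmp A X Y Z g f"
  using cmp_linear_left[of X Y Z r g "\<zero>\<^bsub>mor A Y Z\<^esub>" f] by simp

lemma cmp_smult_right:
  "\<lbrakk>X \<in> obs A; Y \<in> obs A; Z \<in> obs A; r \<in> carrier R; g \<in> hom_set A Y Z; f \<in> hom_set A X Y\<rbrakk>
    \<Longrightarrow> cmp A X Y Z g (r \<odot>\<^bsub>mor A X Y\<^esub> f) = r \<odot>\<^bsub>mor A X Z\<^esub> cmp A X Y Z g f"
  using cmp_linear_right[of X Y Z r g f "\<zero>\<^bsub>mor A X Y\<^esub>"] by simp

text \<open>Every map into or out of Z factors through its identity. In this form being zero is an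
  equation, which G carries from A to B.\<close>

lemma zero_object_iff:
  assumes "Z \<in> obs A"
  shows "zero_object A Z \<longleftrightarrow> idn A Z = \<zero>\<^bsub>mor A Z Z\<^esub>"
proof
  assume "zero_object A Z"
  then show "idn A Z = \<zero>\<^bsub>mor A Z Z\<^esub>"
    using assms unfolding zero_object_def by blast
next
  assume 0: "idn A Z = \<zero>\<^bsub>mor A Z Z\<^esub>"
  have "f = \<zero>\<^bsub>mor A X Z\<^esub>" if "X \<in> obs A" "f \<in> hom_set A X Z" for X f
    using that assms by (metis 0 cmp_id_left cmp_zero_left)
  moreover have "f = \<zero>\<^bsub>mor A Z X\<^esub>" if "X \<in> obs A" "f \<in> hom_set A Z X" for X f
    using that assms by (metis 0 cmp_id_right cmp_zero_right)
  ultimately show "zero_object A Z"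
    using assms unfolding zero_object_def by auto
qed

section \<open>Monomorphisms, epimorphisms, kernels and cokernels\<close>

lemma mono_morI:
  assumes "X \<in> obs A" "Y \<in> obs A" "f \<in> hom_set A X Y"
    and "\<And>T s. \<lbrakk>T \<in> obs A; s \<in> hom_set A T X; cmp A T X Y f s = \<zero>\<^bsub>mor A T Y\<^esub>\<rbrakk>
      \<Longrightarrow> s = \<zero>\<^bsub>mor A T X\<^esub>"
  shows "mono_mor A X Y f"
  unfolding mono_mor_def
proof (intro conjI ballI impI assms(3))
  fix T s t assume T: "T \<in> obs A" "s \<in> hom_set A T X" "t \<in> hom_set A T X"
    and eq: "cmp A T X Y f s = cmp A T X Y f t"
  interpret TX: abelian_group "mor A T X" using assms hom_group T by blast
  interpret TY: abelian_group "mor A T Y" using assms hom_group T by blast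
  have "cmp A T X Y f (s \<ominus>\<^bsub>mor A T X\<^esub> t) = \<zero>\<^bsub>mor A T Y\<^esub>"
    using assms T eq by (simp add: cmp_minus_right)
  then have "s \<ominus>\<^bsub>mor A T X\<^esub> t = \<zero>\<^bsub>mor A T X\<^esub>" using assms T by simp
  then show "s = t" using T by (simp add: TX.minus_eq_zero_iff)
qed

lemma mono_mor_cancel:
  "\<lbrakk>mono_mor A X Y f; T \<in> obs A; s \<in> hom_set A T X; t \<in> hom_set A T X;
    cmp A T X Y f s = cmp A T X Y f t\<rbrakk> \<Longrightarrow> s = t"
  unfolding mono_mor_def by blast

lemma mono_mor_zero:
  assumes "mono_mor A X Y f" "X \<in> obs A" "Y \<in> obs A" "T \<in> obs A" "s \<in> hom_set A T X"
    "cmp A T X Y f s = \<zero>\<^bsub>mor A T Y\<^esub>"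
  shows "s = \<zero>\<^bsub>mor A T X\<^esub>"
proof (rule mono_mor_cancel[OF assms(1,4,5)])
  show "cmp A T X Y f s = cmp A T X Y f \<zero>\<^bsub>mor A T X\<^esub>"
    using assms by (simp add: mono_mor_def)
qed (use assms in simp)

lemma epi_mor_cancel:
  "\<lbrakk>epi_mor A X Y f; T \<in> obs A; s \<in> hom_set A Y T; t \<in> hom_set A Y T;
    cmp A X Y T s f = cmp A X Y T t f\<rbrakk> \<Longrightarrow> s = t"
  unfolding epi_mor_def by blast

lemma epi_mor_zero:
  assumes "epi_mor A X Y f" "X \<in> obs A" "Y \<in> obs A" "T \<in> obs A" "s \<in> hom_set A Y T"
    "cmp A X Y T s f = \<zero>\<^bsub>mor A X T\<^esub>"
  shows "s = \<zero>\<^bsub>mor A Y T\<^esub>"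
proof (rule epi_mor_cancel[OF assms(1,4,5)])
  show "cmp A X Y T s f = cmp A X Y T \<zero>\<^bsub>mor A Y T\<^esub> f"
    using assms by (simp add: epi_mor_def)
qed (use assms in simp)

lemma is_kernelD:
  assumes "is_kernel A X Y f K u"
  shows "K \<in> obs A" "u \<in> hom_set A K X" "cmp A K X Y f u = \<zero>\<^bsub>mor A K Y\<^esub>"
  using assms by (auto simp: is_kernel_def)

lemma is_cokernelD:
  assumes "is_cokernel A X Y f Q q"
  shows "Q \<in> obs A" "q \<in> hom_set A Y Q" "cmp A X Y Q q f = \<zero>\<^bsub>mor A X Q\<^esub>"
  using assms by (auto simp: is_cokernel_def)

lemma kernel_factor:
  assumes "is_kernel A X Y f K u" "T \<in> obs A" "t \<in> hom_set A T X"
    "cmp A T X Y f t = \<zero>\<^bsub>mor A T Y\<^esub>"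
  obtains s where "s \<in> hom_set A T K" "cmp A T K X u s = t"
  using assms unfolding is_kernel_def by blast

lemma cokernel_factor:
  assumes "is_cokernel A X Y f Q q" "T \<in> obs A" "t \<in> hom_set A Y T"
    "cmp A X Y T t f = \<zero>\<^bsub>mor A X T\<^esub>"
  obtains s where "s \<in> hom_set A Q T" "cmp A Y Q T s q = t"
  using assms unfolding is_cokernel_def by blast

text \<open>Two maps with the same composite into X are two factorisations of one map, so the
  uniqueness half of the kernel property applies.\<close>

lemma kernel_mono:
  assumes "is_kernel A X Y f K u" "X \<in> obs A" "Y \<in> obs A" "f \<in> hom_set A X Y"
  shows "mono_mor A K X u"
  unfolding mono_mor_def
proof (intro conjI ballI impI)
  note K = is_kernelD[OF assms(1)]
  show "u \<in> hom_set A K X" by fact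
  fix T s t assume T: "T \<in> obs A" "s \<in> hom_set A T K" "t \<in> hom_set A T K"
    and eq: "cmp A T K X u s = cmp A T K X u t"
  have "cmp A T X Y f (cmp A T K X u s) = \<zero>\<^bsub>mor A T Y\<^esub>"
    using assms T K by (simp add: cmp_assoc[symmetric])
  moreover have "cmp A T K X u s \<in> hom_set A T X" using assms T K by simp
  ultimately have "\<exists>!r. r \<in> hom_set A T K \<and> cmp A T K X u r = cmp A T K X u s"
    using assms(1) T(1) unfolding is_kernel_def by blast
  then show "s = t" using T eq by metis
qed

lemma cokernel_epi:
  assumes "is_cokernel A X Y f Q q" "X \<in> obs A" "Y \<in> obs A" "f \<in> hom_set A X Y"
  shows "epi_mor A Y Q q"
  unfolding epi_mor_def
proof (intro conjI ballI impI)
  note K = is_cokernelD[OF assms(1)]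
  show "q \<in> hom_set A Y Q" by fact
  fix T s t assume T: "T \<in> obs A" "s \<in> hom_set A Q T" "t \<in> hom_set A Q T"
    and eq: "cmp A Y Q T s q = cmp A Y Q T t q"
  have "cmp A X Y T (cmp A Y Q T s q) f = \<zero>\<^bsub>mor A X T\<^esub>"
    using assms T K by (simp add: cmp_assoc)
  moreover have "cmp A Y Q T s q \<in> hom_set A Y T" using assms T K by simp
  ultimately have "\<exists>!r. r \<in> hom_set A Q T \<and> cmp A Y Q T r q = cmp A Y Q T s q"
    using assms(1) T(1) unfolding is_cokernel_def by blast
  then show "s = t" using T eq by metis
qed

text \<open>The axioms quantify over objects and leave the hom-modules alone, so they survive any
  shrinking of the object set.\<close>

lemma full_subcategory: "S \<subseteq> obs A \<Longrightarrow> lincat R (A\<lparr>obs := S\<rparr>)"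
  using lin unfolding lincat_def linear_category_def by (simp add: subset_eq)

lemma Inj_lincat: "lincat R (Inj A)"
  unfolding Inj_def by (rule full_subcategory) (auto simp: injective_object_def)

end

lemma Inj_simps [simp]:
  "mor (Inj A) = mor A" "cmp (Inj A) = cmp A" "idn (Inj A) = idn A"
  "obs (Inj A) = {I. injective_object A I}"
  by (simp_all add: Inj_def)

lemma injective_object_obs: "injective_object A I \<Longrightarrow> I \<in> obs A"
  by (simp add: injective_object_def)

section \<open>Morphism complexes\<close>

lemma (in abelian_group) minus_by_zero [simp]: "x \<in> carrier G \<Longrightarrow> x \<ominus> \<zero> = x"
  by (simp add: minus_eq_iff_add)

text \<open>In \<open>com_d_cmp\<close> the letters a, b, c become \<delta>fg, f\<delta>g and
  fg\<delta>; the middle composite cancels for each parity of p and q.\<close>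

lemma leibniz_signs:
  fixes G :: "('r, 'm) module" (structure)
  assumes "abelian_group G" "a \<in> carrier G" "b \<in> carrier G" "c \<in> carrier G"
  shows "a \<ominus> sgn_mult G (p + q) c
    = (a \<ominus> sgn_mult G p b) \<oplus> sgn_mult G p (b \<ominus> sgn_mult G q c)"
proof -
  interpret abelian_group G by fact
  show ?thesis
    using assms
    by (cases "even p"; cases "even q")
      (simp_all add: sgn_mult_def minus_eq minus_add a_assoc r_neg1 r_neg2)
qed

context lincat
begin

lemma sgn_mult_cmp_left:
  assumes "X \<in> obs A" "Y \<in> obs A" "Z \<in> obs A" "g \<in> hom_set A Y Z" "f \<in> hom_set A X Y"
  shows "cmp A X Y Z (sgn_mult (mor A Y Z) e g) f = sgn_mult (mor A X Z) e (cmp A X Y Z g f)"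
  using assms by (simp add: sgn_mult_def cmp_inv_left)

lemma sgn_mult_cmp_right:
  assumes "X \<in> obs A" "Y \<in> obs A" "Z \<in> obs A" "g \<in> hom_set A Y Z" "f \<in> hom_set A X Y"
  shows "cmp A X Y Z g (sgn_mult (mor A X Y) e f) = sgn_mult (mor A X Z) e (cmp A X Y Z g f)"
  using assms by (simp add: sgn_mult_def cmp_inv_right)

lemma complexesD [simp]:
  assumes "C \<in> complexes A"
  shows "obj C n \<in> obs A" "dif C n \<in> hom_set A (obj C n) (obj C (n + 1))"
    "cmp A (obj C n) (obj C (n + 1)) (obj C (n + 2)) (dif C (n + 1)) (dif C n)
       = \<zero>\<^bsub>mor A (obj C n) (obj C (n + 2))\<^esub>"
  using assms by (auto simp: complexes_def)

text \<open>The indices are variables tied by equations, so that the rule also serves n - 1, n, n +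
  1, where the literal n - 1 + 1 does not match.\<close>

lemma dif_dif:
  assumes "C \<in> complexes A" "j = n + 1" "l = n + 2"
  shows "cmp A (obj C n) (obj C j) (obj C l) (dif C j) (dif C n) = \<zero>\<^bsub>mor A (obj C n) (obj C l)\<^esub>"
  using assms by simp

lemma com_homD: "f \<in> carrier (com_hom A C D p) \<Longrightarrow> f i \<in> hom_set A (obj C i) (obj D (i + p))"
  by (simp add: com_hom_def)

lemma com_hom_add: "(f \<oplus>\<^bsub>com_hom A C D p\<^esub> g) i = f i \<oplus>\<^bsub>mor A (obj C i) (obj D (i + p))\<^esub> g i"
  by (simp add: com_hom_def)

lemma com_hom_zero: "\<zero>\<^bsub>com_hom A C D p\<^esub> i = \<zero>\<^bsub>mor A (obj C i) (obj D (i + p))\<^esub>"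
  by (simp add: com_hom_def)

lemma com_hom_group:
  assumes "C \<in> complexes A" "D \<in> complexes A"
  shows "abelian_group (com_hom A C D p)"
proof (rule abelian_groupI)
  have G: "abelian_group (mor A (obj C i) (obj D (i + p)))" for i using assms by (simp add: hom_group)
  have M: "abelian_monoid (mor A (obj C i) (obj D (i + p)))" for i using G abelian_group.axioms(1) by blast
  fix x assume x: "x \<in> carrier (com_hom A C D p)"
  show "\<exists>y \<in> carrier (com_hom A C D p). y \<oplus>\<^bsub>com_hom A C D p\<^esub> x = \<zero>\<^bsub>com_hom A C D p\<^esub>"
    by (rule bexI[of _ "\<lambda>i. \<ominus>\<^bsub>mor A (obj C i) (obj D (i + p))\<^esub> x i"])
      (use x assms G in \<open>auto simp: com_hom_def abelian_group.l_neg\<close>)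
  fix y assume y: "y \<in> carrier (com_hom A C D p)"
  show "x \<oplus>\<^bsub>com_hom A C D p\<^esub> y = y \<oplus>\<^bsub>com_hom A C D p\<^esub> x"
    using x y M by (auto simp: com_hom_def abelian_monoid.a_comm)
  fix z assume z: "z \<in> carrier (com_hom A C D p)"
  show "x \<oplus>\<^bsub>com_hom A C D p\<^esub> y \<oplus>\<^bsub>com_hom A C D p\<^esub> z
      = x \<oplus>\<^bsub>com_hom A C D p\<^esub> (y \<oplus>\<^bsub>com_hom A C D p\<^esub> z)"
    using x y z M by (auto simp: com_hom_def abelian_monoid.a_assoc)
qed (use assms in \<open>auto simp: com_hom_def\<close>)

lemma com_hom_inv:
  assumes "C \<in> complexes A" "D \<in> complexes A" "f \<in> carrier (com_hom A C D p)"
  shows "\<ominus>\<^bsub>com_hom A C D p\<^esub> f = (\<lambda>i. \<ominus>\<^bsub>mor A (obj C i) (obj D (i + p))\<^esub> f i)"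
proof -
  interpret abelian_group "com_hom A C D p" using assms com_hom_group by blast
  have G: "abelian_group (mor A (obj C i) (obj D (i + p)))" for i using assms by (simp add: hom_group)
  show ?thesis
    by (rule minus_equality) (use assms G in \<open>auto simp: com_hom_def abelian_group.l_neg\<close>)
qed

lemma com_hom_minus:
  assumes "C \<in> complexes A" "D \<in> complexes A" "g \<in> carrier (com_hom A C D p)"
  shows "f \<ominus>\<^bsub>com_hom A C D p\<^esub> g = (\<lambda>i. f i \<ominus>\<^bsub>mor A (obj C i) (obj D (i + p))\<^esub> g i)"
  using assms by (auto simp: a_minus_def com_hom_inv com_hom_add)

lemma com_hom_sgn:
  assumes "C \<in> complexes A" "D \<in> complexes A" "f \<in> carrier (com_hom A C D p)"
  shows "sgn_mult (com_hom A C D p) e f = (\<lambda>i. sgn_mult (mor A (obj C i) (obj D (i + p))) e (f i))"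
  using assms by (auto simp: sgn_mult_def com_hom_inv)

text \<open>The degree r is a separate variable since degrees occur inside object indices: the
  caller chooses the shape of p + q in which the hom-set is named.\<close>

lemma com_cmp_closed:
  assumes "C \<in> complexes A" "D \<in> complexes A" "E \<in> complexes A"
    "f \<in> carrier (com_hom A D E p)" "g \<in> carrier (com_hom A C D q)" "r = p + q"
  shows "com_cmp A C D E p q f g \<in> carrier (com_hom A C E r)"
proof -
  have e: "i + r = i + q + p" for i using assms by simp
  show ?thesis
    unfolding com_hom_def com_cmp_def e
    using assms(1-3) com_homD[OF assms(4)] com_homD[OF assms(5)] by simp
qed

lemma com_cmp_assoc:
  assumes "B \<in> complexes A" "C \<in> complexes A" "D \<in> complexes A" "E \<in> complexes A"
    "f \<in> carrier (com_hom A D E p)" "g \<in> carrier (com_hom A C D q)" "h \<in> carrier (com_hom A B C r)"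
  shows "com_cmp A B C E (p + q) r (com_cmp A C D E p q f g) h
    = com_cmp A B D E p (q + r) f (com_cmp A B C D q r g h)"
proof
  fix i
  have e: "i + r + (p + q) = i + r + q + p" "i + (q + r) = i + r + q" by simp_all
  show "com_cmp A B C E (p + q) r (com_cmp A C D E p q f g) h i
    = com_cmp A B D E p (q + r) f (com_cmp A B C D q r g h) i"
    unfolding com_cmp_def e
    using assms com_homD[OF assms(5)] com_homD[OF assms(6)] com_homD[OF assms(7)]
    by (simp add: cmp_assoc)
qed

lemma com_cmp_minus_left:
  assumes "C \<in> complexes A" "D \<in> complexes A" "E \<in> complexes A"
    "f \<in> carrier (com_hom A D E p)" "f' \<in> carrier (com_hom A D E p)"
    "g \<in> carrier (com_hom A C D q)" "r = p + q"
  shows "com_cmp A C D E p q (f \<ominus>\<^bsub>com_hom A D E p\<^esub> f') g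
    = com_cmp A C D E p q f g \<ominus>\<^bsub>com_hom A C E r\<^esub> com_cmp A C D E p q f' g"
proof -
  have e: "i + r = i + q + p" for i using assms by simp
  show ?thesis
    unfolding com_hom_minus[OF assms(2,3,5)]
      com_hom_minus[OF assms(1,3) com_cmp_closed[OF assms(1-3,5-7)]]
    using assms(1-3) com_homD[OF assms(4)] com_homD[OF assms(5)] com_homD[OF assms(6)]
    by (simp add: com_cmp_def cmp_minus_left e)
qed

lemma com_cmp_minus_right:
  assumes "C \<in> complexes A" "D \<in> complexes A" "E \<in> complexes A"
    "f \<in> carrier (com_hom A D E p)" "g \<in> carrier (com_hom A C D q)"
    "g' \<in> carrier (com_hom A C D q)" "r = p + q"
  shows "com_cmp A C D E p q f (g \<ominus>\<^bsub>com_hom A C D q\<^esub> g')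
    = com_cmp A C D E p q f g \<ominus>\<^bsub>com_hom A C E r\<^esub> com_cmp A C D E p q f g'"
proof -
  have e: "i + r = i + q + p" for i using assms by simp
  show ?thesis
    unfolding com_hom_minus[OF assms(1,2,6)]
      com_hom_minus[OF assms(1,3) com_cmp_closed[OF assms(1-4,6-7)]]
    using assms(1-3) com_homD[OF assms(4)] com_homD[OF assms(5)] com_homD[OF assms(6)]
    by (simp add: com_cmp_def cmp_minus_right e)
qed

lemma dif_closed: "C \<in> complexes A \<Longrightarrow> dif C \<in> carrier (com_hom A C C 1)"
  by (simp add: com_hom_def)

text \<open>All indices are brought to the shape i + (p + 1), so that both terms visibly lie in one
  hom group; later computations with the differential start from here.\<close>

lemma com_d_apply:
  assumes "C \<in> complexes A" "D \<in> complexes A" "f \<in> carrier (com_hom A C D p)"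
  shows "com_d A C D p f i = cmp A (obj C i) (obj D (i + p)) (obj D (i + (p + 1))) (dif D (i + p)) (f i)
    \<ominus>\<^bsub>mor A (obj C i) (obj D (i + (p + 1)))\<^esub> sgn_mult (mor A (obj C i) (obj D (i + (p + 1)))) p
      (cmp A (obj C i) (obj C (i + 1)) (obj D (i + (p + 1))) (f (i + 1)) (dif C i))"
proof -
  have c: "com_cmp A C C D p 1 f (dif C) \<in> carrier (com_hom A C D (p + 1))"
    using assms by (simp add: com_cmp_closed dif_closed)
  interpret abelian_group "com_hom A C D (p + 1)" using assms com_hom_group by blast
  have e: "i + p + 1 = i + (p + 1)" "i + 1 + p = i + (p + 1)" by simp_all
  have "sgn_mult (com_hom A C D (p + 1)) p (com_cmp A C C D p 1 f (dif C))
      \<in> carrier (com_hom A C D (p + 1))"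
    using c by (simp add: sgn_mult_def)
  then show ?thesis
    unfolding com_d_def Let_def com_hom_minus[OF assms(1,2) \<open>sgn_mult _ _ _ \<in> _\<close>]
    unfolding com_hom_sgn[OF assms(1,2) c]
    by (simp add: com_cmp_def e)
qed

lemma com_d_closed:
  assumes "C \<in> complexes A" "D \<in> complexes A" "f \<in> carrier (com_hom A C D p)" "q = p + 1"
  shows "com_d A C D p f \<in> carrier (com_hom A C D q)"
proof -
  have c: "com_cmp A C C D p 1 f (dif C) \<in> carrier (com_hom A C D (p + 1))"
    "com_cmp A C D D 1 p (dif D) f \<in> carrier (com_hom A C D (p + 1))"
    using assms by (simp_all add: com_cmp_closed dif_closed)
  interpret abelian_group "com_hom A C D (p + 1)" using assms com_hom_group by blast
  show ?thesis using c assms(4) by (simp add: com_d_def Let_def sgn_mult_def)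
qed

lemma com_d_zero:
  assumes "C \<in> complexes A" "D \<in> complexes A"
  shows "com_d A C D p \<zero>\<^bsub>com_hom A C D p\<^esub> = \<zero>\<^bsub>com_hom A C D (p + 1)\<^esub>"
proof
  fix i
  interpret abelian_group "mor A (obj C i) (obj D (i + (p + 1)))" using assms hom_group by simp
  interpret H: abelian_group "com_hom A C D p" using assms com_hom_group by blast
  have e: "i + 1 + p = i + (p + 1)" "i + p + 1 = i + (p + 1)" by simp_all
  show "com_d A C D p \<zero>\<^bsub>com_hom A C D p\<^esub> i = \<zero>\<^bsub>com_hom A C D (p + 1)\<^esub> i"
    using assms complexesD(2)[OF assms(2), of "i + p"]
    by (simp add: com_d_apply com_hom_zero sgn_mult_def e)
qed

lemma com_d_minus:
  assumes C: "C \<in> complexes A" and D: "D \<in> complexes A"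
    and f: "f \<in> carrier (com_hom A C D p)" and g: "g \<in> carrier (com_hom A C D p)"
  shows "com_d A C D p (f \<ominus>\<^bsub>com_hom A C D p\<^esub> g)
    = com_d A C D p f \<ominus>\<^bsub>com_hom A C D (p + 1)\<^esub> com_d A C D p g"
proof
  fix i
  interpret abelian_group "mor A (obj C i) (obj D (i + (p + 1)))" using assms hom_group by simp
  interpret H: abelian_group "com_hom A C D p" using assms com_hom_group by blast
  have e: "i + 1 + p = i + (p + 1)" "i + p + 1 = i + (p + 1)" by simp_all
  have fg: "f i \<in> hom_set A (obj C i) (obj D (i + p))" "g i \<in> hom_set A (obj C i) (obj D (i + p))"
     "f (i + 1) \<in> hom_set A (obj C (i + 1)) (obj D (i + (p + 1)))"
     "g (i + 1) \<in> hom_set A (obj C (i + 1)) (obj D (i + (p + 1)))"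
    using com_homD[OF f, of i] com_homD[OF g, of i] com_homD[OF f, of "i + 1"]
      com_homD[OF g, of "i + 1"] by (simp_all add: e)
  have dD: "dif D (i + p) \<in> hom_set A (obj D (i + p)) (obj D (i + (p + 1)))"
    using complexesD(2)[OF D, of "i + p"] by (simp add: e)
  have key: "(a \<ominus>\<^bsub>mor A (obj C i) (obj D (i + (p + 1)))\<^esub> b) \<ominus>\<^bsub>mor A (obj C i) (obj D (i + (p + 1)))\<^esub>
       sgn_mult (mor A (obj C i) (obj D (i + (p + 1)))) p (x \<ominus>\<^bsub>mor A (obj C i) (obj D (i + (p + 1)))\<^esub> y)
     = (a \<ominus>\<^bsub>mor A (obj C i) (obj D (i + (p + 1)))\<^esub> sgn_mult (mor A (obj C i) (obj D (i + (p + 1)))) p x)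
       \<ominus>\<^bsub>mor A (obj C i) (obj D (i + (p + 1)))\<^esub>
       (b \<ominus>\<^bsub>mor A (obj C i) (obj D (i + (p + 1)))\<^esub> sgn_mult (mor A (obj C i) (obj D (i + (p + 1)))) p y)"
    if "a \<in> hom_set A (obj C i) (obj D (i + (p + 1)))" "b \<in> hom_set A (obj C i) (obj D (i + (p + 1)))"
      "x \<in> hom_set A (obj C i) (obj D (i + (p + 1)))" "y \<in> hom_set A (obj C i) (obj D (i + (p + 1)))"
    for a b x y
    using that by (cases "even p") (simp_all add: sgn_mult_def minus_eq minus_add a_ac)
  show "com_d A C D p (f \<ominus>\<^bsub>com_hom A C D p\<^esub> g) i
      = (com_d A C D p f \<ominus>\<^bsub>com_hom A C D (p + 1)\<^esub> com_d A C D p g) i"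
    unfolding com_hom_minus[OF C D com_d_closed[OF C D g refl]]
      com_d_apply[OF C D f] com_d_apply[OF C D g] com_d_apply[OF C D H.minus_closed[OF f g]]
    unfolding com_hom_minus[OF C D g] e
    using C D fg dD key by (simp add: cmp_minus_left cmp_minus_right)
qed

text \<open>The graded Leibniz rule: in each position both sides are combinations of \<delta>fg,
  f\<delta>g and fg\<delta>, and \<open>leibniz_signs\<close> compares them.\<close>

lemma com_d_cmp:
  assumes C: "C \<in> complexes A" and D: "D \<in> complexes A" and E: "E \<in> complexes A"
    and f: "f \<in> carrier (com_hom A D E p)" and g: "g \<in> carrier (com_hom A C D q)"
  shows "com_d A C E (p + q) (com_cmp A C D E p q f g)
    = com_cmp A C D E (p + 1) q (com_d A D E p f) g \<oplus>\<^bsub>com_hom A C E (p + q + 1)\<^esub>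
      sgn_mult (com_hom A C E (p + q + 1)) p (com_cmp A C D E p (q + 1) f (com_d A C D q g))"
proof
  fix i
  define X where "X = obj C i"
  define X' where "X' = obj C (i + 1)"
  define Y where "Y = obj D (i + q)"
  define Y' where "Y' = obj D (i + (q + 1))"
  define Z where "Z = obj E (i + (p + q))"
  define Z' where "Z' = obj E (i + (p + q + 1))"
  note defs = X_def X'_def Y_def Y'_def Z_def Z'_def
  have ob: "X \<in> obs A" "X' \<in> obs A" "Y \<in> obs A" "Y' \<in> obs A" "Z \<in> obs A" "Z' \<in> obs A"
    using C D E by (simp_all add: defs)
  have e: "i + 1 + q = i + (q + 1)" "i + (q + 1) + p = i + (p + q + 1)" "i + q + p = i + (p + q)"
    "i + (p + q) + 1 = i + (p + q + 1)" "i + q + (p + 1) = i + (p + q + 1)" "i + q + 1 = i + (q + 1)"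
    "i + 1 + (p + q) = i + (p + q + 1)"
    by simp_all
  have dC: "dif C i \<in> hom_set A X X'" and dD: "dif D (i + q) \<in> hom_set A Y Y'"
    and dE: "dif E (i + (p + q)) \<in> hom_set A Z Z'"
    using complexesD(2)[OF C, of i] complexesD(2)[OF D, of "i + q"] complexesD(2)[OF E, of "i + (p + q)"]
    by (simp_all add: defs e)
  have g0: "g i \<in> hom_set A X Y" and g1: "g (i + 1) \<in> hom_set A X' Y'"
    using com_homD[OF g, of i] com_homD[OF g, of "i + 1"] by (simp_all add: defs e)
  have f0: "f (i + q) \<in> hom_set A Y Z" and f1: "f (i + (q + 1)) \<in> hom_set A Y' Z'"
    using com_homD[OF f, of "i + q"] com_homD[OF f, of "i + (q + 1)"] by (simp_all add: defs e)
  interpret abelian_group "mor A X Z'" using ob hom_group by blast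
  let ?a = "cmp A X Z Z' (dif E (i + (p + q))) (cmp A X Y Z (f (i + q)) (g i))"
  let ?b = "cmp A X Y' Z' (f (i + (q + 1))) (cmp A X Y Y' (dif D (i + q)) (g i))"
  let ?c = "cmp A X Y' Z' (f (i + (q + 1))) (cmp A X X' Y' (g (i + 1)) (dif C i))"
  have abc: "?a \<in> hom_set A X Z'" "?b \<in> hom_set A X Z'" "?c \<in> hom_set A X Z'"
    using ob dC dD dE g0 g1 f0 f1 by simp_all
  have fg: "com_cmp A C D E p q f g \<in> carrier (com_hom A C E (p + q))"
    using C D E f g by (simp add: com_cmp_closed)
  have L: "com_d A C E (p + q) (com_cmp A C D E p q f g) i
      = ?a \<ominus>\<^bsub>mor A X Z'\<^esub> sgn_mult (mor A X Z') (p + q) ?c"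
    unfolding com_d_apply[OF C E fg] unfolding com_cmp_def e
    unfolding defs[symmetric] using ob dC dD dE g0 g1 f0 f1 by (simp add: cmp_assoc)
  have 1: "com_cmp A C D E (p + 1) q (com_d A D E p f) g i
      = ?a \<ominus>\<^bsub>mor A X Z'\<^esub> sgn_mult (mor A X Z') p ?b"
    unfolding com_cmp_def com_d_apply[OF D E f] e unfolding defs[symmetric]
    using ob dC dD dE g0 g1 f0 f1
    by (simp add: cmp_assoc cmp_minus_left sgn_mult_cmp_left)
  have 2: "com_cmp A C D E p (q + 1) f (com_d A C D q g) i
      = ?b \<ominus>\<^bsub>mor A X Z'\<^esub> sgn_mult (mor A X Z') q ?c"
    unfolding com_cmp_def com_d_apply[OF C D g] e unfolding defs[symmetric]
    using ob dC dD dE g0 g1 f0 f1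
    by (simp add: cmp_assoc cmp_minus_right sgn_mult_cmp_right)
  have fdg: "com_cmp A C D E p (q + 1) f (com_d A C D q g) \<in> carrier (com_hom A C E (p + q + 1))"
    by (rule com_cmp_closed[OF C D E f com_d_closed[OF C D g refl]]) simp
  show "com_d A C E (p + q) (com_cmp A C D E p q f g) i
    = (com_cmp A C D E (p + 1) q (com_d A D E p f) g \<oplus>\<^bsub>com_hom A C E (p + q + 1)\<^esub>
      sgn_mult (com_hom A C E (p + q + 1)) p (com_cmp A C D E p (q + 1) f (com_d A C D q g))) i"
    unfolding L com_hom_add 1 com_hom_sgn[OF C E fdg] 2 unfolding defs[symmetric]
    by (rule leibniz_signs[OF abelian_group_axioms abc])
qed

section \<open>Boundaries, cohomology classes and homotopy equivalences\<close>

definition com_bd :: "('o, 'm) cx \<Rightarrow> ('o, 'm) cx \<Rightarrow> int \<Rightarrow> (int \<Rightarrow> 'm) set" where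
  "com_bd C D p = com_d A C D (p - 1) ` carrier (com_hom A C D (p - 1))"

lemma com_bd_closed: "C \<in> complexes A \<Longrightarrow> D \<in> complexes A \<Longrightarrow> b \<in> com_bd C D p \<Longrightarrow> b \<in> carrier (com_hom A C D p)"
  by (auto simp: com_bd_def com_d_closed)

lemma com_bd_zero:
  assumes "C \<in> complexes A" "D \<in> complexes A"
  shows "\<zero>\<^bsub>com_hom A C D p\<^esub> \<in> com_bd C D p"
proof -
  interpret abelian_group "com_hom A C D (p - 1)" using assms com_hom_group by blast
  show ?thesis
    using com_d_zero[OF assms, of "p - 1"] unfolding com_bd_def by (metis diff_add_cancel image_eqI zero_closed)
qed

lemma com_bd_minus:
  assumes "C \<in> complexes A" "D \<in> complexes A" "a \<in> com_bd C D p" "b \<in> com_bd C D p"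
  shows "a \<ominus>\<^bsub>com_hom A C D p\<^esub> b \<in> com_bd C D p"
proof -
  interpret abelian_group "com_hom A C D (p - 1)" using assms com_hom_group by blast
  obtain f g where "f \<in> carrier (com_hom A C D (p - 1))" "g \<in> carrier (com_hom A C D (p - 1))"
    "a = com_d A C D (p - 1) f" "b = com_d A C D (p - 1) g"
    using assms by (auto simp: com_bd_def)
  then show ?thesis
    using com_d_minus[OF assms(1,2), of f "p - 1" g] unfolding com_bd_def
    by (metis diff_add_cancel image_eqI minus_closed)
qed

lemma com_bd_inv:
  assumes "C \<in> complexes A" "D \<in> complexes A" "a \<in> com_bd C D p"
  shows "\<ominus>\<^bsub>com_hom A C D p\<^esub> a \<in> com_bd C D p"
proof -
  interpret abelian_group "com_hom A C D p" using assms com_hom_group by blast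
  show ?thesis
    using com_bd_minus[OF assms(1,2) com_bd_zero[OF assms(1,2)] assms(3)] com_bd_closed[OF assms]
    by (simp add: minus_eq)
qed

lemma com_bd_add:
  assumes "C \<in> complexes A" "D \<in> complexes A" "a \<in> com_bd C D p" "b \<in> com_bd C D p"
  shows "a \<oplus>\<^bsub>com_hom A C D p\<^esub> b \<in> com_bd C D p"
proof -
  interpret abelian_group "com_hom A C D p" using assms com_hom_group by blast
  show ?thesis
    using com_bd_minus[OF assms(1-3) com_bd_inv[OF assms(1,2,4)]] com_bd_closed[OF assms(1,2,4)]
    by (simp add: minus_eq)
qed

lemma com_bd_sgn:
  assumes "C \<in> complexes A" "D \<in> complexes A" "b \<in> carrier (com_hom A C D p)"
  shows "sgn_mult (com_hom A C D p) e b \<in> com_bd C D p \<longleftrightarrow> b \<in> com_bd C D p"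
proof -
  interpret abelian_group "com_hom A C D p" using assms com_hom_group by blast
  show ?thesis
    using com_bd_inv[OF assms(1,2)] assms(3) by (metis sgn_mult_def minus_minus)
qed

lemma ext_class_iff: "x \<in> ext_class A C D p f \<longleftrightarrow> (\<exists>b \<in> com_bd C D p. x = b \<oplus>\<^bsub>com_hom A C D p\<^esub> f)"
  by (auto simp: ext_class_def com_bd_def a_r_coset_def' )

lemma ext_class_eq_iff:
  assumes C: "C \<in> complexes A" and D: "D \<in> complexes A"
    and f: "f \<in> carrier (com_hom A C D p)" and g: "g \<in> carrier (com_hom A C D p)"
  shows "ext_class A C D p f = ext_class A C D p g \<longleftrightarrow> f \<ominus>\<^bsub>com_hom A C D p\<^esub> g \<in> com_bd C D p"
proof -
  interpret abelian_group "com_hom A C D p" using assms com_hom_group by blast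
  note bd = com_bd_closed[OF C D]
  \<comment> \<open>One inclusion for arbitrary x and y is enough: boundaries are closed under
    negation, so f and g can be exchanged.\<close>
  have sub: "ext_class A C D p x \<subseteq> ext_class A C D p y"
    if "x \<in> carrier (com_hom A C D p)" "y \<in> carrier (com_hom A C D p)"
      "x \<ominus>\<^bsub>com_hom A C D p\<^esub> y \<in> com_bd C D p" for x y
  proof
    fix z assume "z \<in> ext_class A C D p x"
    then obtain b where b: "b \<in> com_bd C D p" "z = b \<oplus>\<^bsub>com_hom A C D p\<^esub> x"
      by (auto simp: ext_class_iff)
    have "z = (b \<oplus>\<^bsub>com_hom A C D p\<^esub> (x \<ominus>\<^bsub>com_hom A C D p\<^esub> y)) \<oplus>\<^bsub>com_hom A C D p\<^esub> y"
      using b bd that by (simp add: minus_eq a_assoc l_neg)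
    then show "z \<in> ext_class A C D p y"
      using com_bd_add[OF C D b(1) that(3)] by (auto simp: ext_class_iff)
  qed
  show ?thesis
  proof
    assume "ext_class A C D p f = ext_class A C D p g"
    moreover have "f \<in> ext_class A C D p f"
      using com_bd_zero[OF C D] f by (force simp: ext_class_iff)
    ultimately obtain b where "b \<in> com_bd C D p" "f = b \<oplus>\<^bsub>com_hom A C D p\<^esub> g"
      by (auto simp: ext_class_iff)
    then show "f \<ominus>\<^bsub>com_hom A C D p\<^esub> g \<in> com_bd C D p"
      using bd g f by (metis minus_eq_iff_add)
  next
    assume *: "f \<ominus>\<^bsub>com_hom A C D p\<^esub> g \<in> com_bd C D p"
    have "g \<ominus>\<^bsub>com_hom A C D p\<^esub> f = \<ominus>\<^bsub>com_hom A C D p\<^esub> (f \<ominus>\<^bsub>com_hom A C D p\<^esub> g)"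
      using f g by (simp add: minus_eq minus_add a_comm)
    then show "ext_class A C D p f = ext_class A C D p g"
      using sub[OF f g *] sub[OF g f] com_bd_inv[OF C D *] by auto
  qed
qed

lemma ext_class_eq_zero_iff:
  assumes C: "C \<in> complexes A" and D: "D \<in> complexes A" and f: "f \<in> carrier (com_hom A C D p)"
  shows "ext_class A C D p f = ext_class A C D p \<zero>\<^bsub>com_hom A C D p\<^esub> \<longleftrightarrow> f \<in> com_bd C D p"
proof -
  interpret abelian_group "com_hom A C D p" using assms com_hom_group by blast
  show ?thesis using ext_class_eq_iff[OF C D f, of "\<zero>\<^bsub>com_hom A C D p\<^esub>"] f
    by (simp add: minus_by_zero)
qed

text \<open>Write b = dh. Since df = 0, the Leibniz rule leaves d(hf) = bf.\<close>

lemma com_cmp_bd_left: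
  assumes C: "C \<in> complexes A" and D: "D \<in> complexes A" and E: "E \<in> complexes A"
    and b: "b \<in> com_bd D E p" and f: "f \<in> com_cocycles A C D q" and r: "r = p + q"
  shows "com_cmp A C D E p q b f \<in> com_bd C E r"
proof -
  obtain h where h: "h \<in> carrier (com_hom A D E (p - 1))" "b = com_d A D E (p - 1) h"
    using b by (auto simp: com_bd_def)
  have f': "f \<in> carrier (com_hom A C D q)" "com_d A C D q f = \<zero>\<^bsub>com_hom A C D (q + 1)\<^esub>"
    using f by (auto simp: com_cocycles_def)
  interpret abelian_group "com_hom A C E r" using C E com_hom_group by blast
  have z: "com_cmp A C D E (p - 1) (q + 1) h \<zero>\<^bsub>com_hom A C D (q + 1)\<^esub> = \<zero>\<^bsub>com_hom A C E r\<^esub>"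
  proof
    fix i
    have e: "i + (q + 1) + (p - 1) = i + r" using r by simp
    show "com_cmp A C D E (p - 1) (q + 1) h \<zero>\<^bsub>com_hom A C D (q + 1)\<^esub> i = \<zero>\<^bsub>com_hom A C E r\<^esub> i"
      using C D E com_homD[OF h(1), of "i + (q + 1)"]
      unfolding com_cmp_def com_hom_zero e by simp
  qed
  have e: "p - 1 + q + 1 = r" "p - 1 + q = r - 1" using r by simp_all
  have bf: "com_cmp A C D E p q b f \<in> carrier (com_hom A C E r)"
    using com_cmp_closed[OF C D E com_bd_closed[OF D E b] f'(1) r] .
  have "com_d A C E (r - 1) (com_cmp A C D E (p - 1) q h f) = com_cmp A C D E p q b f"
    using com_d_cmp[OF C D E h(1) f'(1)] bf unfolding e f'(2) z h(2)
    by (simp add: sgn_mult_def)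
  moreover have "com_cmp A C D E (p - 1) q h f \<in> carrier (com_hom A C E (r - 1))"
    by (rule com_cmp_closed[OF C D E h(1) f'(1)]) (simp add: r)
  ultimately show ?thesis unfolding com_bd_def by (metis image_eqI)
qed

text \<open>Here the Leibniz rule gives d(fh) = (-1)^p fb for b = dh; the sign is harmless because
  boundaries form a subgroup.\<close>

lemma com_cmp_bd_right:
  assumes C: "C \<in> complexes A" and D: "D \<in> complexes A" and E: "E \<in> complexes A"
    and f: "f \<in> com_cocycles A D E p" and b: "b \<in> com_bd C D q" and r: "r = p + q"
  shows "com_cmp A C D E p q f b \<in> com_bd C E r"
proof -
  obtain h where h: "h \<in> carrier (com_hom A C D (q - 1))" "b = com_d A C D (q - 1) h"
    using b by (auto simp: com_bd_def)
  have f': "f \<in> carrier (com_hom A D E p)" "com_d A D E p f = \<zero>\<^bsub>com_hom A D E (p + 1)\<^esub>"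
    using f by (auto simp: com_cocycles_def)
  interpret abelian_group "com_hom A C E r" using C E com_hom_group by blast
  have z: "com_cmp A C D E (p + 1) (q - 1) \<zero>\<^bsub>com_hom A D E (p + 1)\<^esub> h = \<zero>\<^bsub>com_hom A C E r\<^esub>"
  proof
    fix i
    have e: "i + (q - 1) + (p + 1) = i + r" using r by simp
    show "com_cmp A C D E (p + 1) (q - 1) \<zero>\<^bsub>com_hom A D E (p + 1)\<^esub> h i = \<zero>\<^bsub>com_hom A C E r\<^esub> i"
      using C D E com_homD[OF h(1), of i]
      unfolding com_cmp_def com_hom_zero e by simp
  qed
  have e: "p + (q - 1) + 1 = r" "p + (q - 1) = r - 1" using r by simp_all
  have fb: "com_cmp A C D E p q f b \<in> carrier (com_hom A C E r)"
    using com_cmp_closed[OF C D E f'(1) com_bd_closed[OF C D b] r] .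
  then have fb': "sgn_mult (com_hom A C E r) p (com_cmp A C D E p q f b) \<in> carrier (com_hom A C E r)"
    by (simp add: sgn_mult_def)
  have "com_d A C E (r - 1) (com_cmp A C D E p (q - 1) f h)
      = sgn_mult (com_hom A C E r) p (com_cmp A C D E p q f b)"
    using com_d_cmp[OF C D E f'(1) h(1)] fb' unfolding e f'(2) z h(2) by simp
  moreover have "com_cmp A C D E p (q - 1) f h \<in> carrier (com_hom A C E (r - 1))"
    by (rule com_cmp_closed[OF C D E f'(1) h(1)]) (simp add: r)
  ultimately have "sgn_mult (com_hom A C E r) p (com_cmp A C D E p q f b) \<in> com_bd C E r"
    unfolding com_bd_def by (metis image_eqI)
  then show ?thesis using com_bd_sgn[OF C E fb] by blast
qed

lemma com_idn_closed: "C \<in> complexes A \<Longrightarrow> com_idn A C \<in> carrier (com_hom A C C 0)"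
  by (simp add: com_hom_def com_idn_def)

lemma com_idn_cocycle:
  assumes "C \<in> complexes A"
  shows "com_idn A C \<in> com_cocycles A C C 0"
proof -
  have "com_d A C C 0 (com_idn A C) i = \<zero>\<^bsub>com_hom A C C (0 + 1)\<^esub> i" for i
  proof -
    interpret abelian_group "mor A (obj C i) (obj C (i + 1))" using assms hom_group by simp
    show ?thesis
      unfolding com_d_apply[OF assms assms com_idn_closed[OF assms]]
      using assms by (simp add: com_hom_zero sgn_mult_def com_idn_def)
  qed
  then show ?thesis using assms by (auto simp: com_cocycles_def com_idn_closed)
qed

lemma com_idn_idn: "C \<in> complexes A \<Longrightarrow> com_cmp A C C C 0 0 (com_idn A C) (com_idn A C) = com_idn A C"
  by (auto simp: com_cmp_def com_idn_def)

lemma com_cmp_idn_right: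
  "\<lbrakk>C \<in> complexes A; D \<in> complexes A; f \<in> carrier (com_hom A C D p)\<rbrakk>
    \<Longrightarrow> com_cmp A C C D p 0 f (com_idn A C) = f"
  using com_homD by (auto simp: com_cmp_def com_idn_def)

lemma homotopy_equivalent_refl: "C \<in> complexes A \<Longrightarrow> homotopy_equivalent A C C"
  unfolding homotopy_equivalent_def using com_idn_cocycle com_idn_idn by metis

text \<open>If \<open>f g\<close> is homotopic to the identity of C, a central class \<open>w\<close> on C equals
  \<open>w f g = f z g\<close> with z on K.\<close>

lemma centre_zero_transport:
  assumes \<zeta>: "\<zeta> \<in> graded_centre2 A" and K: "K \<in> complexes_plus A" and C: "C \<in> complexes_plus A"
    and KC: "homotopy_equivalent A K C" and z: "\<zero>\<^bsub>com_hom A K K 2\<^esub> \<in> \<zeta> K"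
    and w: "w \<in> \<zeta> C" "w \<in> com_cocycles A C C 2"
  shows "w \<in> com_bd C C 2"
proof -
  have K': "K \<in> complexes A" and C': "C \<in> complexes A" using K C by (auto simp: complexes_plus_def)
  obtain f g where f: "f \<in> com_cocycles A K C 0" and g: "g \<in> com_cocycles A C K 0"
    and fg: "ext_class A C C 0 (com_cmp A C K C 0 0 f g) = ext_class A C C 0 (com_idn A C)"
    using KC unfolding homotopy_equivalent_def by blast
  have cf: "f \<in> carrier (com_hom A K C 0)" and cg: "g \<in> carrier (com_hom A C K 0)"
    and cw: "w \<in> carrier (com_hom A C C 2)"
    using f g w by (auto simp: com_cocycles_def)
  interpret KC: abelian_group "com_hom A K C 2" using K' C' com_hom_group by blast
  interpret CC: abelian_group "com_hom A C C 2" using C' com_hom_group by blast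
  have cfg: "com_cmp A C K C 0 0 f g \<in> carrier (com_hom A C C 0)"
    using com_cmp_closed[OF C' K' C' cf cg] by simp
  \<comment> \<open>Centrality along the degree 0 map f, with the zero cochain as representative on
    K, makes wf a boundary.\<close>
  have "ext_class A K C (0 + 2) (com_cmp A K C C 2 0 w f)
      = ext_class A K C (0 + 2) (com_cmp A K K C 0 2 f \<zero>\<^bsub>com_hom A K K 2\<^esub>)"
    using \<zeta> K C f z w(1) unfolding graded_centre2_def by blast
  moreover have "com_cmp A K K C 0 2 f \<zero>\<^bsub>com_hom A K K 2\<^esub> = \<zero>\<^bsub>com_hom A K C 2\<^esub>"
    using K' C' com_homD[OF cf] by (auto simp: com_cmp_def com_hom_zero)
  moreover have cwf: "com_cmp A K C C 2 0 w f \<in> carrier (com_hom A K C 2)"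
    by (rule com_cmp_closed[OF K' C' C' cw cf]) simp
  ultimately have "com_cmp A K C C 2 0 w f \<in> com_bd K C 2"
    using ext_class_eq_zero_iff[OF K' C' cwf] by simp
  from com_cmp_bd_left[OF C' K' C' this g, of 2]
  have "com_cmp A C K C 2 0 (com_cmp A K C C 2 0 w f) g \<in> com_bd C C 2" by simp
  then have 1: "com_cmp A C C C 2 0 w (com_cmp A C K C 0 0 f g) \<in> com_bd C C 2"
    using com_cmp_assoc[OF C' K' C' C' cw cf cg] by simp
  \<comment> \<open>The composite fg is the identity up to a boundary, so wfg and w differ by a
    boundary; as wfg is a boundary itself, so is w.\<close>
  have "com_cmp A C K C 0 0 f g \<ominus>\<^bsub>com_hom A C C 0\<^esub> com_idn A C \<in> com_bd C C 0"
    using fg ext_class_eq_iff[OF C' C' cfg com_idn_closed[OF C']] by blast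
  from com_cmp_bd_right[OF C' C' C' w(2) this, of 2]
  have "com_cmp A C C C 2 0 w (com_cmp A C K C 0 0 f g) \<ominus>\<^bsub>com_hom A C C 2\<^esub> w \<in> com_bd C C 2"
    using com_cmp_minus_right[OF C' C' C' cw cfg com_idn_closed[OF C'], of 2]
    by (simp add: com_cmp_idn_right[OF C' C' cw])
  from com_bd_minus[OF C' C' 1 this]
  show ?thesis
    using com_bd_closed[OF C' C' 1] cw by (simp add: CC.minus_eq CC.minus_add CC.r_neg1 CC.r_neg2)
qed

end

section \<open>Hochschild 2-cocycles\<close>

lemma tgt_simps [simp]: "tgt B [] = B" "tgt B ((Y, d, f) # ys) = Y"
  by (simp_all add: tgt_def)

lemma deg_simps [simp]: "deg [] = 0" "deg ((Y, d, f) # ys) = d + deg ys"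
  by (simp_all add: deg_def)

lemma sdeg_simps [simp]: "sdeg [] = 0" "sdeg ((Y, d, f) # ys) = d - 1 + sdeg ys"
  by (simp_all add: sdeg_def)

lemma is_path_obs: "is_path Q B xs \<Longrightarrow> B \<in> verts Q \<and> tgt B xs \<in> verts Q"
  by (induction xs) (auto simp: tgt_def)

text \<open>The last premise has the shape in which the Hochschild differential of a 2-cochain
  unfolds, the signs of the braces and of the bracket still nested.\<close>

lemma (in abelian_group) four_term:
  assumes "a \<in> carrier G" "b \<in> carrier G" "c \<in> carrier G" "d \<in> carrier G"
    and "(a \<oplus> \<ominus> b) \<ominus> \<ominus> (c \<oplus> \<ominus> d) = \<zero>"
  shows "b \<oplus> d = c \<oplus> a"
proof -
  have "(c \<oplus> a) \<ominus> (b \<oplus> d) = (a \<oplus> \<ominus> b) \<ominus> \<ominus> (c \<oplus> \<ominus> d)"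
    using assms(1-4) by (simp add: minus_eq minus_add a_ac)
  then have "c \<oplus> a = b \<oplus> d" using assms minus_eq_zero_iff[of "c \<oplus> a" "b \<oplus> d"] by simp
  then show ?thesis by simp
qed

context lincat
begin

lemma cat_quiver_simps [simp]:
  "verts (cat_quiver A) = obs A"
  "arrs (cat_quiver A) X Y 0 = mor A X Y"
  "\<zero>\<^bsub>arrs (cat_quiver A) X Y d\<^esub> = \<zero>\<^bsub>mor A X Y\<^esub>"
  "x \<oplus>\<^bsub>arrs (cat_quiver A) X Y d\<^esub> y = x \<oplus>\<^bsub>mor A X Y\<^esub> y"
  "r \<odot>\<^bsub>arrs (cat_quiver A) X Y d\<^esub> y = r \<odot>\<^bsub>mor A X Y\<^esub> y"
  by (simp_all add: cat_quiver_def)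

lemma cat_quiver_zero [simp]: "X \<in> obs A \<Longrightarrow> Y \<in> obs A \<Longrightarrow> \<zero>\<^bsub>mor A X Y\<^esub> \<in> carrier (arrs (cat_quiver A) X Y d)"
  by (simp add: cat_quiver_def)

lemma cat_quiver_carrier:
  "X \<in> obs A \<Longrightarrow> Y \<in> obs A \<Longrightarrow> f \<in> carrier (arrs (cat_quiver A) X Y d) \<Longrightarrow> f \<in> hom_set A X Y"
  by (auto simp: cat_quiver_def split: if_splits)

text \<open>In nonzero degree the carrier is cut down to zero. Negation is defined by a description
  inside the carrier, so it is not inherited from the hom-module and has to be computed
  anew.\<close>

lemma sgn_mult_arrs_zero [simp]:
  assumes "X \<in> obs A" "Y \<in> obs A"
  shows "sgn_mult (arrs (cat_quiver A) X Y d) e \<zero>\<^bsub>mor A X Y\<^esub> = \<zero>\<^bsub>mor A X Y\<^esub>"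
proof (cases "d = 0")
  case False
  then have "\<ominus>\<^bsub>arrs (cat_quiver A) X Y d\<^esub> \<zero>\<^bsub>mor A X Y\<^esub> = \<zero>\<^bsub>mor A X Y\<^esub>"
    using assms by (auto simp: a_inv_def m_inv_def cat_quiver_def intro!: the_equality)
  then show ?thesis by (simp add: sgn_mult_def)
qed (use assms in \<open>simp add: sgn_mult_def\<close>)

text \<open>Multilinearity with r = 1 and both arguments zero reads v = v + v. The lemma serves to
  discard the terms of a brace in which the dg structure, inserted with arity other than 2,
  contributes a zero arrow.\<close>

lemma cochain_zero:
  assumes \<phi>: "\<phi> \<in> cochains R (cat_quiver A) h"
    and p: "is_path (cat_quiver A) B (ys @ (Y, d, z) # zs)" and z: "z = \<zero>\<^bsub>mor A (tgt B zs) Y\<^esub>"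
  shows "\<phi> B (ys @ (Y, d, z) # zs) = \<zero>\<^bsub>mor A B (tgt B (ys @ (Y, d, z) # zs))\<^esub>"
proof -
  let ?xs = "ys @ (Y, d, z) # zs"
  let ?v = "\<phi> B ?xs"
  have obs: "B \<in> obs A" "tgt B ?xs \<in> obs A" using is_path_obs[OF p] by simp_all
  have p': "is_path (cat_quiver A) B ((Y, d, z) # zs)"
    using p by (induction ys) auto
  then have obs': "tgt B zs \<in> obs A" "Y \<in> obs A" using is_path_obs[of "cat_quiver A" B zs] by simp_all
  have v: "?v \<in> carrier (out_mod (cat_quiver A) h B ?xs)" using \<phi> p by (simp add: cochains_def)
  then have v': "?v \<in> hom_set A B (tgt B ?xs)" unfolding out_mod_def using obs cat_quiver_carrier by blast
  have "\<phi> B (ys @ (Y, d, \<one>\<^bsub>R\<^esub> \<odot>\<^bsub>arrs (cat_quiver A) (tgt B zs) Y d\<^esub> z \<oplus>\<^bsub>arrs (cat_quiver A) (tgt B zs) Y d\<^esub> z) # zs)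
    = \<one>\<^bsub>R\<^esub> \<odot>\<^bsub>out_mod (cat_quiver A) h B ?xs\<^esub> ?v \<oplus>\<^bsub>out_mod (cat_quiver A) h B ?xs\<^esub> ?v"
    using \<phi> p one_scalar[OF obs(1)] unfolding cochains_def Let_def by blast
  then have "?v = ?v \<oplus>\<^bsub>mor A B (tgt B ?xs)\<^esub> ?v"
    using obs obs' v' z by (simp add: out_mod_def)
  moreover interpret abelian_group "mor A B (tgt B ?xs)" using obs hom_group by blast
  show ?thesis using calculation v' by (metis add.l_cancel_one')
qed

lemma cochain2_closed:
  assumes "\<phi> \<in> cochains R (cat_quiver A) 2" "X \<in> obs A" "Y \<in> obs A" "Z \<in> obs A"
    "g \<in> hom_set A Y Z" "f \<in> hom_set A X Y"
  shows "\<phi> X [(Z, 0, g), (Y, 0, f)] \<in> hom_set A X Z"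
proof -
  have "is_path (cat_quiver A) X [(Z, 0, g), (Y, 0, f)]" using assms by simp
  then have "\<phi> X [(Z, 0, g), (Y, 0, f)] \<in> carrier (out_mod (cat_quiver A) 2 X [(Z, 0, g), (Y, 0, f)])"
    using assms(1) unfolding cochains_def by blast
  then show ?thesis by (simp add: out_mod_def)
qed

lemma cochain1_closed:
  assumes "\<eta> \<in> cochains R (cat_quiver A) 1" "X \<in> obs A" "Y \<in> obs A" "f \<in> hom_set A X Y"
  shows "\<eta> X [(Y, 0, f)] \<in> hom_set A X Y"
proof -
  have "is_path (cat_quiver A) X [(Y, 0, f)]" using assms by simp
  then have "\<eta> X [(Y, 0, f)] \<in> carrier (out_mod (cat_quiver A) 1 X [(Y, 0, f)])"
    using assms(1) unfolding cochains_def by blast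
  then show ?thesis by (simp add: out_mod_def)
qed

lemma susp_zero:
  assumes "B \<in> obs A" "tgt B xs \<in> obs A" "\<phi> B xs = \<zero>\<^bsub>mor A B (tgt B xs)\<^esub>"
  shows "susp (cat_quiver A) h \<phi> B xs = \<zero>\<^bsub>mor A B (tgt B xs)\<^esub>"
  using assms by (simp add: susp_def Let_def out_mod_def)

lemma cat_dg_zero:
  assumes "B \<in> obs A" "tgt B xs \<in> obs A" "length xs \<noteq> 2"
  shows "cat_dg A B xs = \<zero>\<^bsub>mor A B (tgt B xs)\<^esub>"
  unfolding cat_dg_def
  by (rule susp_zero) (use assms in \<open>auto simp: cat_comp_def split: list.splits\<close>)

lemma cat_dg_comp: "cat_dg A B [(Z, 0, g), (Y, 0, f)] = cmp A B Y Z g f"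
  by (simp add: cat_dg_def susp_def cat_comp_def sgn_mult_def)

text \<open>In a quiver concentrated in degree 0 the arity equals the Hochschild degree and the
  shuffle exponent is 0, so the suspension introduces no sign.\<close>

lemma susp2_apply: "susp (cat_quiver A) 2 \<phi> B [(Z, 0, g), (Y, 0, f)] = \<phi> B [(Z, 0, g), (Y, 0, f)]"
  by (simp add: susp_def sgn_mult_def)

lemma susp1_apply: "susp (cat_quiver A) 1 \<eta> B [(Z, 0, g)] = \<eta> B [(Z, 0, g)]"
  by (simp add: susp_def sgn_mult_def)

lemma susp_cochain_zero:
  assumes \<phi>: "\<phi> \<in> cochains R (cat_quiver A) h"
    and p: "is_path (cat_quiver A) B (ys @ (Y, d, z) # zs)" and z: "z = \<zero>\<^bsub>mor A (tgt B zs) Y\<^esub>"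
  shows "susp (cat_quiver A) h \<phi> B (ys @ (Y, d, z) # zs) = \<zero>\<^bsub>mor A B (tgt B (ys @ (Y, d, z) # zs))\<^esub>"
  using is_path_obs[OF p] by (intro susp_zero cochain_zero[OF assms]) simp_all

text \<open>The variants cover the positions of an inserted zero arrow in strings that arise from at
  most three arguments.\<close>

lemmas susp_cochain_zero0 = susp_cochain_zero[where ys = "[]", simplified]
lemmas susp_cochain_zero1 = susp_cochain_zero[where ys = "[(Y', d', f')]" for Y' d' f', simplified]
lemmas susp_cochain_zero2 = susp_cochain_zero[where ys = "[(Y', d', f'), (Y2, d2, f2)]" for Y' d' f' Y2 d2 f2, simplified]
lemmas susp_cochain_zero3 = susp_cochain_zero[where ys = "[(Y', d', f'), (Y2, d2, f2), (Y3, d3, f3)]" for Y' d' f' Y2 d2 f2 Y3 d3 f3, simplified]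

text \<open>Of all insertions only those survive in which the dg structure acts on two arguments.
  The result is the classical coboundary, in the sign convention where the two outer products are
  positive.\<close>

lemma coboundary2:
  assumes \<eta>: "\<eta> \<in> cochains R (cat_quiver A) 1"
    and ob: "X \<in> obs A" "Y \<in> obs A" "Z \<in> obs A" and fg: "g \<in> hom_set A Y Z" "f \<in> hom_set A X Y"
  shows "hoch_d (cat_quiver A) (cat_dg A) 1 \<eta> X [(Z, 0, g), (Y, 0, f)]
    = (cmp A X Y Z (\<eta> Y [(Z, 0, g)]) f \<oplus>\<^bsub>mor A X Z\<^esub> cmp A X Y Z g (\<eta> X [(Y, 0, f)]))
      \<ominus>\<^bsub>mor A X Z\<^esub> \<eta> X [(Z, 0, cmp A X Y Z g f)]"
proof -
  interpret abelian_group "mor A X Z" using ob hom_group by blast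
  note c = cochain1_closed[OF \<eta>]
  show ?thesis
    using ob fg c
    by (simp add: hoch_d_def bracket_def brace_def Let_def out_mod_def susp_def[of _ 2] upt_rec
        susp1_apply cat_dg_comp cat_dg_zero susp_cochain_zero0[OF \<eta>] susp_cochain_zero1[OF \<eta>]
        susp_cochain_zero2[OF \<eta>] sgn_mult_def)
qed

text \<open>This is associativity of m + \<phi>\<epsilon> in first order, read off from the
  Hochschild differential on a string of length three.\<close>

lemma cocycle_identity:
  assumes \<phi>: "\<phi> \<in> hoch_cocycles R (cat_quiver A) (cat_dg A) 2"
    and ob: "W \<in> obs A" "X \<in> obs A" "Y \<in> obs A" "Z \<in> obs A"
    and fgh: "h \<in> hom_set A Y Z" "g \<in> hom_set A X Y" "f \<in> hom_set A W X"
  shows "cmp A W Y Z h (\<phi> W [(Y, 0, g), (X, 0, f)]) \<oplus>\<^bsub>mor A W Z\<^esub> \<phi> W [(Z, 0, h), (Y, 0, cmp A W X Y g f)]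
    = \<phi> W [(Z, 0, cmp A X Y Z h g), (X, 0, f)] \<oplus>\<^bsub>mor A W Z\<^esub> cmp A W X Z (\<phi> X [(Z, 0, h), (Y, 0, g)]) f"
proof -
  interpret abelian_group "mor A W Z" using ob hom_group by blast
  have \<phi>': "\<phi> \<in> cochains R (cat_quiver A) 2" using \<phi> by (simp add: hoch_cocycles_def)
  note c = cochain2_closed[OF \<phi>']
  have p: "is_path (cat_quiver A) W [(Z, 0, h), (Y, 0, g), (X, 0, f)]" using ob fgh by simp
  then have "hoch_d (cat_quiver A) (cat_dg A) 2 \<phi> W [(Z, 0, h), (Y, 0, g), (X, 0, f)]
     = \<zero>\<^bsub>out_mod (cat_quiver A) (2 + 1) W [(Z, 0, h), (Y, 0, g), (X, 0, f)]\<^esub>"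
    using \<phi> unfolding hoch_cocycles_def by blast
  \<comment> \<open>An arrow of degree 0 has suspended degree -1, so an inserted element of degree 1
    changes sign with each arrow it passes. The double minus in the middle combines the minus of the
    bracket with its sign for two elements of degree 1.\<close>
  then have "(cmp A W X Z (\<phi> X [(Z, 0, h), (Y, 0, g)]) f \<oplus>\<^bsub>mor A W Z\<^esub>
       \<ominus>\<^bsub>mor A W Z\<^esub> cmp A W Y Z h (\<phi> W [(Y, 0, g), (X, 0, f)])) \<ominus>\<^bsub>mor A W Z\<^esub>
     \<ominus>\<^bsub>mor A W Z\<^esub> (\<phi> W [(Z, 0, cmp A X Y Z h g), (X, 0, f)] \<oplus>\<^bsub>mor A W Z\<^esub>
       \<ominus>\<^bsub>mor A W Z\<^esub> \<phi> W [(Z, 0, h), (Y, 0, cmp A W X Y g f)]) = \<zero>\<^bsub>mor A W Z\<^esub>"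
    using ob fgh c
    by (simp add: hoch_d_def bracket_def brace_def Let_def out_mod_def susp_def[of _ 3] upt_rec
        susp2_apply cat_dg_comp cat_dg_zero susp_cochain_zero0[OF \<phi>'] susp_cochain_zero1[OF \<phi>']
        susp_cochain_zero2[OF \<phi>'] susp_cochain_zero3[OF \<phi>'] sgn_mult_def)
  then show ?thesis
    by (rule four_term[rotated -1]) (use ob fgh c in simp_all)
qed

lemma cochain2_add:
  assumes \<phi>: "\<phi> \<in> cochains R (cat_quiver A) 2"
    and ob: "X \<in> obs A" "Y \<in> obs A" "Z \<in> obs A"
    and fg: "g \<in> hom_set A Y Z" "g' \<in> hom_set A Y Z" "f \<in> hom_set A X Y" "f' \<in> hom_set A X Y"
  shows "\<phi> X [(Z, 0, g \<oplus>\<^bsub>mor A Y Z\<^esub> g'), (Y, 0, f)]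
      = \<phi> X [(Z, 0, g), (Y, 0, f)] \<oplus>\<^bsub>mor A X Z\<^esub> \<phi> X [(Z, 0, g'), (Y, 0, f)]"
    and "\<phi> X [(Z, 0, g), (Y, 0, f \<oplus>\<^bsub>mor A X Y\<^esub> f')]
      = \<phi> X [(Z, 0, g), (Y, 0, f)] \<oplus>\<^bsub>mor A X Z\<^esub> \<phi> X [(Z, 0, g), (Y, 0, f')]"
proof -
  have lin: "\<phi> X (ys @ (U, 0, r \<odot>\<^bsub>arrs (cat_quiver A) (tgt X zs) U 0\<^esub> x
        \<oplus>\<^bsub>arrs (cat_quiver A) (tgt X zs) U 0\<^esub> y) # zs)
     = r \<odot>\<^bsub>out_mod (cat_quiver A) 2 X (ys @ (U, 0, x) # zs)\<^esub> \<phi> X (ys @ (U, 0, x) # zs)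
       \<oplus>\<^bsub>out_mod (cat_quiver A) 2 X (ys @ (U, 0, x) # zs)\<^esub> \<phi> X (ys @ (U, 0, y) # zs)"
    if "r \<in> carrier R" "is_path (cat_quiver A) X (ys @ (U, 0, x) # zs)"
      "is_path (cat_quiver A) X (ys @ (U, 0, y) # zs)" for r x y ys zs U
    using \<phi> that unfolding cochains_def Let_def by blast
  note c = cochain2_closed[OF \<phi>]
  show "\<phi> X [(Z, 0, g \<oplus>\<^bsub>mor A Y Z\<^esub> g'), (Y, 0, f)]
      = \<phi> X [(Z, 0, g), (Y, 0, f)] \<oplus>\<^bsub>mor A X Z\<^esub> \<phi> X [(Z, 0, g'), (Y, 0, f)]"
    using lin[OF one_scalar[OF ob(1)], of "[]" Z g "[(Y, 0, f)]" g'] ob fg c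
    by (simp add: out_mod_def)
  show "\<phi> X [(Z, 0, g), (Y, 0, f \<oplus>\<^bsub>mor A X Y\<^esub> f')]
      = \<phi> X [(Z, 0, g), (Y, 0, f)] \<oplus>\<^bsub>mor A X Z\<^esub> \<phi> X [(Z, 0, g), (Y, 0, f')]"
    using lin[OF one_scalar[OF ob(1)], of "[(Z, 0, g)]" Y f "[]" f'] ob fg c
    by (simp add: out_mod_def)
qed

lemma cochain2_zero_left:
  assumes \<phi>: "\<phi> \<in> cochains R (cat_quiver A) 2"
    and ob: "X \<in> obs A" "Y \<in> obs A" "Z \<in> obs A" and f: "f \<in> hom_set A X Y"
  shows "\<phi> X [(Z, 0, \<zero>\<^bsub>mor A Y Z\<^esub>), (Y, 0, f)] = \<zero>\<^bsub>mor A X Z\<^esub>"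
proof -
  have "is_path (cat_quiver A) X ([] @ (Z, 0, \<zero>\<^bsub>mor A Y Z\<^esub>) # [(Y, 0, f)])"
    using ob f by simp
  from cochain_zero[OF \<phi> this] show ?thesis by simp
qed

lemma cochain2_zero_right:
  assumes \<phi>: "\<phi> \<in> cochains R (cat_quiver A) 2"
    and ob: "X \<in> obs A" "Y \<in> obs A" "Z \<in> obs A" and g: "g \<in> hom_set A Y Z"
  shows "\<phi> X [(Z, 0, g), (Y, 0, \<zero>\<^bsub>mor A X Y\<^esub>)] = \<zero>\<^bsub>mor A X Z\<^esub>"
proof -
  have "is_path (cat_quiver A) X ([(Z, 0, g)] @ (Y, 0, \<zero>\<^bsub>mor A X Y\<^esub>) # [])"
    using ob g by simp
  from cochain_zero[OF \<phi> this] show ?thesis by simp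
qed

lemma cochain2_inv:
  assumes \<phi>: "\<phi> \<in> cochains R (cat_quiver A) 2"
    and ob: "X \<in> obs A" "Y \<in> obs A" "Z \<in> obs A"
    and fg: "g \<in> hom_set A Y Z" "f \<in> hom_set A X Y"
  shows "\<phi> X [(Z, 0, \<ominus>\<^bsub>mor A Y Z\<^esub> g), (Y, 0, f)] = \<ominus>\<^bsub>mor A X Z\<^esub> \<phi> X [(Z, 0, g), (Y, 0, f)]"
    and "\<phi> X [(Z, 0, g), (Y, 0, \<ominus>\<^bsub>mor A X Y\<^esub> f)] = \<ominus>\<^bsub>mor A X Z\<^esub> \<phi> X [(Z, 0, g), (Y, 0, f)]"
proof -
  interpret XZ: abelian_group "mor A X Z" using ob hom_group by blast
  interpret YZ: abelian_group "mor A Y Z" using ob hom_group by blast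
  interpret XY: abelian_group "mor A X Y" using ob hom_group by blast
  note c = cochain2_closed[OF \<phi>]
  show "\<phi> X [(Z, 0, \<ominus>\<^bsub>mor A Y Z\<^esub> g), (Y, 0, f)] = \<ominus>\<^bsub>mor A X Z\<^esub> \<phi> X [(Z, 0, g), (Y, 0, f)]"
    using ob fg c cochain2_add(1)[OF \<phi> ob _ fg(1) fg(2) fg(2), of "\<ominus>\<^bsub>mor A Y Z\<^esub> g"]
      cochain2_zero_left[OF \<phi> ob fg(2)]
    by (intro XZ.minus_equality[symmetric]) (simp_all add: YZ.l_neg)
  show "\<phi> X [(Z, 0, g), (Y, 0, \<ominus>\<^bsub>mor A X Y\<^esub> f)] = \<ominus>\<^bsub>mor A X Z\<^esub> \<phi> X [(Z, 0, g), (Y, 0, f)]"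
    using ob fg c cochain2_add(2)[OF \<phi> ob fg(1) fg(1) _ fg(2), of "\<ominus>\<^bsub>mor A X Y\<^esub> f"]
      cochain2_zero_right[OF \<phi> ob fg(1)]
    by (intro XZ.minus_equality[symmetric]) (simp_all add: XY.l_neg)
qed

end

section \<open>Componentwise extension to complexes\<close>

text \<open>The binary case of \<open>componentwise\<close>, with the degrees as parameters in the
  manner of \<open>com_cmp\<close>, so that \<phi> and the composition obey parallel rules.\<close>

definition com_ev :: "('o, 'm) cochain \<Rightarrow> ('o, 'm) cx \<Rightarrow> ('o, 'm) cx \<Rightarrow> ('o, 'm) cx \<Rightarrow>
    int \<Rightarrow> int \<Rightarrow> (int \<Rightarrow> 'm) \<Rightarrow> (int \<Rightarrow> 'm) \<Rightarrow> int \<Rightarrow> 'm" where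
  "com_ev \<phi> C D E p q f g =
     (\<lambda>i. \<phi> (obj C i) [(obj E (i + q + p), 0, f (i + q)), (obj D (i + q), 0, g i)])"

lemma (in abelian_group) cross_cancel:
  assumes "x \<in> carrier G" "y \<in> carrier G" "z \<in> carrier G"
  shows "(x \<oplus> y) \<ominus> (x \<oplus> z) = y \<ominus> z"
proof -
  have "(x \<oplus> y) \<ominus> (x \<oplus> z) = (\<ominus> x \<oplus> x) \<oplus> (y \<ominus> z)"
    using assms by (simp add: minus_eq minus_add a_ac)
  then show ?thesis using assms by (simp add: l_neg minus_eq)
qed

text \<open>The sign bookkeeping of \<open>obs_central\<close>: b and h are the terms in which
  \<phi> receives f\<delta> as an argument, and they are eliminated from the three identities. The
  parity of p decides with which sign they enter.\<close>

lemma centre_signs: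
  fixes G :: "('r, 'm) module" (structure)
  assumes "abelian_group G"
    and cl: "a \<in> carrier G" "b \<in> carrier G" "c \<in> carrier G" "e \<in> carrier G" "h \<in> carrier G"
      "l \<in> carrier G" "m \<in> carrier G" "n \<in> carrier G"
    and 1: "a \<oplus> sgn_mult G p b = c" and 2: "e \<oplus> b = sgn_mult G p h \<oplus> l" and 3: "m = h \<oplus> n"
  shows "c \<ominus> m = (a \<ominus> sgn_mult G p e) \<ominus> sgn_mult G (p + 1) (l \<ominus> sgn_mult G p n)"
proof -
  interpret abelian_group G by fact
  show ?thesis
  proof (cases "even p")
    case True
    have "b = \<ominus> e \<oplus> (e \<oplus> b)" using cl by (simp add: r_neg1)
    also have "\<dots> = \<ominus> e \<oplus> (h \<oplus> l)" using 2 True by (simp add: sgn_mult_def)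
    also have "\<dots> = h \<oplus> (l \<ominus> e)" using cl by (simp add: minus_eq a_ac)
    finally have b: "b = h \<oplus> (l \<ominus> e)" .
    have "c \<ominus> m = (h \<oplus> (a \<oplus> (l \<ominus> e))) \<ominus> (h \<oplus> n)"
      using 1[symmetric] 3 True cl by (simp add: b sgn_mult_def a_ac minus_eq)
    also have "\<dots> = (a \<oplus> (l \<ominus> e)) \<ominus> n" using cl by (simp add: cross_cancel)
    finally show ?thesis
      using True cl by (simp add: sgn_mult_def minus_eq minus_add a_ac)
  next
    case False
    then have "h \<oplus> (e \<oplus> b) = l"
      using 2 cl by (simp add: sgn_mult_def r_neg2)
    then have l: "(h \<oplus> e) \<oplus> b = l" using cl by (simp add: a_assoc)
    have "h \<oplus> (e \<ominus> l) = ((h \<oplus> e) \<oplus> \<zero>) \<ominus> ((h \<oplus> e) \<oplus> b)"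
      unfolding l using cl by (simp add: minus_eq a_assoc)
    also have "\<dots> = \<zero> \<ominus> b" using cl by (intro cross_cancel) simp_all
    finally have b: "\<ominus> b = h \<oplus> (e \<ominus> l)" using cl by (simp add: minus_eq)
    have "c \<ominus> m = (h \<oplus> (a \<oplus> (e \<ominus> l))) \<ominus> (h \<oplus> n)"
      using 1[symmetric] 3 False cl by (simp add: b sgn_mult_def a_ac minus_eq)
    also have "\<dots> = (a \<oplus> (e \<ominus> l)) \<ominus> n" using cl by (simp add: cross_cancel)
    finally show ?thesis
      using False cl by (simp add: sgn_mult_def minus_eq minus_add a_ac)
  qed
qed

context lincat
begin

lemma com_cmp_sgn_left:
  assumes "C \<in> complexes A" "D \<in> complexes A" "E \<in> complexes A"
    "f \<in> carrier (com_hom A D E p)" "g \<in> carrier (com_hom A C D q)" "r = p + q"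
  shows "com_cmp A C D E p q (sgn_mult (com_hom A D E p) s f) g
    = sgn_mult (com_hom A C E r) s (com_cmp A C D E p q f g)"
proof -
  have e: "i + r = i + q + p" for i using assms by simp
  show ?thesis
    unfolding com_hom_sgn[OF assms(2,3,4)] com_hom_sgn[OF assms(1,3) com_cmp_closed[OF assms]]
    using assms(1-3) com_homD[OF assms(4)] com_homD[OF assms(5)]
    by (simp add: com_cmp_def sgn_mult_cmp_left e)
qed

lemma com_cmp_sgn_right:
  assumes "C \<in> complexes A" "D \<in> complexes A" "E \<in> complexes A"
    "f \<in> carrier (com_hom A D E p)" "g \<in> carrier (com_hom A C D q)" "r = p + q"
  shows "com_cmp A C D E p q f (sgn_mult (com_hom A C D q) s g)
    = sgn_mult (com_hom A C E r) s (com_cmp A C D E p q f g)"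
proof -
  have e: "i + r = i + q + p" for i using assms by simp
  show ?thesis
    unfolding com_hom_sgn[OF assms(1,2,5)] com_hom_sgn[OF assms(1,3) com_cmp_closed[OF assms]]
    using assms(1-3) com_homD[OF assms(4)] com_homD[OF assms(5)]
    by (simp add: com_cmp_def sgn_mult_cmp_right e)
qed

end

locale lincat_cocycle = lincat R A
  for R :: "'r ring" and A :: "('o, 'm, 'r) lincat" +
  fixes \<phi> :: "('o, 'm) cochain"
  assumes \<phi>: "\<phi> \<in> hoch_cocycles R (cat_quiver A) (cat_dg A) 2"
begin

lemma \<phi>_cochain: "\<phi> \<in> cochains R (cat_quiver A) 2"
  using \<phi> by (simp add: hoch_cocycles_def)

lemmas \<phi>_closed [simp, intro] = cochain2_closed[OF \<phi>_cochain]
lemmas \<phi>_zero_left [simp] = cochain2_zero_left[OF \<phi>_cochain]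
lemmas \<phi>_zero_right [simp] = cochain2_zero_right[OF \<phi>_cochain]

lemma com_ev_closed:
  assumes "C \<in> complexes A" "D \<in> complexes A" "E \<in> complexes A"
    "f \<in> carrier (com_hom A D E p)" "g \<in> carrier (com_hom A C D q)" "r = p + q"
  shows "com_ev \<phi> C D E p q f g \<in> carrier (com_hom A C E r)"
proof -
  have e: "i + r = i + q + p" for i using assms by simp
  show ?thesis
    unfolding com_hom_def com_ev_def e
    using assms(1-3) com_homD[OF assms(4)] com_homD[OF assms(5)] by simp
qed

lemma com_ev_zero_left:
  assumes "C \<in> complexes A" "D \<in> complexes A" "E \<in> complexes A"
    "g \<in> carrier (com_hom A C D q)" "r = p + q"
  shows "com_ev \<phi> C D E p q \<zero>\<^bsub>com_hom A D E p\<^esub> g = \<zero>\<^bsub>com_hom A C E r\<^esub>"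
proof -
  have e: "i + r = i + q + p" for i using assms by simp
  show ?thesis
    unfolding com_ev_def fun_eq_iff com_hom_zero e
    using assms(1-3) com_homD[OF assms(4)] by simp
qed

lemma com_ev_zero_right:
  assumes "C \<in> complexes A" "D \<in> complexes A" "E \<in> complexes A"
    "f \<in> carrier (com_hom A D E p)" "r = p + q"
  shows "com_ev \<phi> C D E p q f \<zero>\<^bsub>com_hom A C D q\<^esub> = \<zero>\<^bsub>com_hom A C E r\<^esub>"
proof -
  have e: "i + r = i + q + p" for i using assms by simp
  show ?thesis
    unfolding com_ev_def fun_eq_iff com_hom_zero e
    using assms(1-3) com_homD[OF assms(4)] by simp
qed

lemma com_ev_sgn_left:
  assumes "C \<in> complexes A" "D \<in> complexes A" "E \<in> complexes A"
    "f \<in> carrier (com_hom A D E p)" "g \<in> carrier (com_hom A C D q)" "r = p + q"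
  shows "com_ev \<phi> C D E p q (sgn_mult (com_hom A D E p) s f) g
    = sgn_mult (com_hom A C E r) s (com_ev \<phi> C D E p q f g)"
proof -
  have e: "i + r = i + q + p" for i using assms by simp
  show ?thesis
    unfolding com_hom_sgn[OF assms(2,3,4)] com_hom_sgn[OF assms(1,3) com_ev_closed[OF assms]]
    using assms(1-3) com_homD[OF assms(4)] com_homD[OF assms(5)]
    by (cases "even s") (simp_all add: com_ev_def sgn_mult_def cochain2_inv[OF \<phi>_cochain] e)
qed

lemma com_ev_sgn_right:
  assumes "C \<in> complexes A" "D \<in> complexes A" "E \<in> complexes A"
    "f \<in> carrier (com_hom A D E p)" "g \<in> carrier (com_hom A C D q)" "r = p + q"
  shows "com_ev \<phi> C D E p q f (sgn_mult (com_hom A C D q) s g)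
    = sgn_mult (com_hom A C E r) s (com_ev \<phi> C D E p q f g)"
proof -
  have e: "i + r = i + q + p" for i using assms by simp
  show ?thesis
    unfolding com_hom_sgn[OF assms(1,2,5)] com_hom_sgn[OF assms(1,3) com_ev_closed[OF assms]]
    using assms(1-3) com_homD[OF assms(4)] com_homD[OF assms(5)]
    by (cases "even s") (simp_all add: com_ev_def sgn_mult_def cochain2_inv[OF \<phi>_cochain] e)
qed

text \<open>Since \<open>com_cmp\<close> and \<open>com_ev\<close> both work componentwise in a
  category of degree 0, the cocycle identity passes to complexes without Koszul signs; only the
  indices have to be matched.\<close>

lemma com_ev_identity:
  assumes "B \<in> complexes A" "C \<in> complexes A" "D \<in> complexes A" "E \<in> complexes A"
    "h \<in> carrier (com_hom A D E p)" "g \<in> carrier (com_hom A C D q)" "f \<in> carrier (com_hom A B C r)"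
    and s: "s = p + q + r" and pq: "pq = p + q" and qr: "qr = q + r"
  shows "com_cmp A B D E p qr h (com_ev \<phi> B C D q r g f) \<oplus>\<^bsub>com_hom A B E s\<^esub>
      com_ev \<phi> B D E p qr h (com_cmp A B C D q r g f)
    = com_ev \<phi> B C E pq r (com_cmp A C D E p q h g) f \<oplus>\<^bsub>com_hom A B E s\<^esub>
      com_cmp A B C E pq r (com_ev \<phi> C D E p q h g) f"
proof
  fix i
  have e: "i + s = i + r + q + p" "i + qr = i + r + q" "i + r + pq = i + r + q + p"
    using s pq qr by simp_all
  show "(com_cmp A B D E p qr h (com_ev \<phi> B C D q r g f) \<oplus>\<^bsub>com_hom A B E s\<^esub>
      com_ev \<phi> B D E p qr h (com_cmp A B C D q r g f)) i
    = (com_ev \<phi> B C E pq r (com_cmp A C D E p q h g) f \<oplus>\<^bsub>com_hom A B E s\<^esub>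
      com_cmp A B C E pq r (com_ev \<phi> C D E p q h g) f) i"
    unfolding com_hom_add unfolding com_cmp_def com_ev_def e
    using assms(1-4) com_homD[OF assms(5)] com_homD[OF assms(6)] com_homD[OF assms(7)]
    by (intro cocycle_identity[OF \<phi>]) simp_all
qed

text \<open>This is \<phi>(\<delta>, \<delta>) itself; the minus sign of the obstruction is put in
  where the class is formed.\<close>

definition obs_cocycle :: "('o, 'm) cx \<Rightarrow> int \<Rightarrow> 'm" where
  "obs_cocycle C = com_ev \<phi> C C C 1 1 (dif C) (dif C)"

lemma com_dif_dif: "C \<in> complexes A \<Longrightarrow> com_cmp A C C C 1 1 (dif C) (dif C) = \<zero>\<^bsub>com_hom A C C 2\<^esub>"
  by (rule ext) (simp add: com_cmp_def com_hom_zero dif_dif add.commute)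

lemma obs_closed: "C \<in> complexes A \<Longrightarrow> obs_cocycle C \<in> carrier (com_hom A C C 2)"
  unfolding obs_cocycle_def by (rule com_ev_closed) (simp_all add: dif_closed)

text \<open>In the cocycle identity for (\<delta>, \<delta>, \<delta>) the two terms containing
  \<delta>\<delta> = 0 vanish, and what remains says that \<phi>(\<delta>, \<delta>) commutes with
  \<delta>.\<close>

lemma obs_cocycle_is_cocycle:
  assumes C: "C \<in> complexes A"
  shows "obs_cocycle C \<in> com_cocycles A C C 2"
proof -
  interpret abelian_group "com_hom A C C 3" using C com_hom_group by blast
  have cl: "com_cmp A C C C 1 2 (dif C) (obs_cocycle C) \<in> carrier (com_hom A C C 3)"
    "com_cmp A C C C 2 1 (obs_cocycle C) (dif C) \<in> carrier (com_hom A C C 3)"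
    using com_cmp_closed[OF C C C dif_closed[OF C] obs_closed[OF C], of 3]
      com_cmp_closed[OF C C C obs_closed[OF C] dif_closed[OF C], of 3] by simp_all
  have "com_cmp A C C C 1 2 (dif C) (obs_cocycle C) = com_cmp A C C C 2 1 (obs_cocycle C) (dif C)"
  proof -
    have I: "com_cmp A C C C 1 2 (dif C) (com_ev \<phi> C C C 1 1 (dif C) (dif C)) \<oplus>\<^bsub>com_hom A C C 3\<^esub>
        com_ev \<phi> C C C 1 2 (dif C) (com_cmp A C C C 1 1 (dif C) (dif C))
      = com_ev \<phi> C C C 2 1 (com_cmp A C C C 1 1 (dif C) (dif C)) (dif C) \<oplus>\<^bsub>com_hom A C C 3\<^esub>
        com_cmp A C C C 2 1 (com_ev \<phi> C C C 1 1 (dif C) (dif C)) (dif C)"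
      using C dif_closed[OF C] by (intro com_ev_identity) simp_all
    have z1: "com_ev \<phi> C C C 1 2 (dif C) \<zero>\<^bsub>com_hom A C C 2\<^esub> = \<zero>\<^bsub>com_hom A C C 3\<^esub>"
      using C dif_closed[OF C] by (intro com_ev_zero_right) simp_all
    have z2: "com_ev \<phi> C C C 2 1 \<zero>\<^bsub>com_hom A C C 2\<^esub> (dif C) = \<zero>\<^bsub>com_hom A C C 3\<^esub>"
      using C dif_closed[OF C] by (intro com_ev_zero_left) simp_all
    show ?thesis
      using I unfolding com_dif_dif[OF C] z1 z2 obs_cocycle_def[symmetric]
        r_zero[OF cl(1)] l_zero[OF cl(2)] .
  qed
  then have "com_d A C C 2 (obs_cocycle C) = \<zero>\<^bsub>com_hom A C C 3\<^esub>"
    using cl by (simp add: com_d_def sgn_mult_def)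
  then show ?thesis using obs_closed[OF C] by (simp add: com_cocycles_def)
qed

text \<open>The homotopy is \<open>\<phi>(\<delta>, f) - (-1)\<^sup>p \<phi>(f, \<delta>)\<close>: combine the cocycle identities
  for \<open>(\<delta>, \<delta>, f)\<close>, \<open>(\<delta>, f, \<delta>)\<close> and \<open>(f, \<delta>, \<delta>)\<close>.\<close>

lemma obs_central:
  assumes C: "C \<in> complexes A" and D: "D \<in> complexes A" and f: "f \<in> com_cocycles A C D p"
  shows "com_cmp A C D D 2 p (obs_cocycle D) f \<ominus>\<^bsub>com_hom A C D (p + 2)\<^esub>
    com_cmp A C C D p 2 f (obs_cocycle C) \<in> com_bd C D (p + 2)"
proof -
  let ?M = "com_hom A C D (p + 2)"
  let ?s = "sgn_mult (com_hom A C D (p + 1)) p"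
  interpret abelian_group ?M using C D com_hom_group by blast
  interpret N: abelian_group "com_hom A C D (p + 1)" using C D com_hom_group by blast
  note dC = dif_closed[OF C] and dD = dif_closed[OF D]
  have f': "f \<in> carrier (com_hom A C D p)" "com_d A C D p f = \<zero>\<^bsub>com_hom A C D (p + 1)\<^esub>"
    using f by (auto simp: com_cocycles_def)
  let ?fd = "com_cmp A C C D p 1 f (dif C)"
  have fd: "?fd \<in> carrier (com_hom A C D (p + 1))"
    using com_cmp_closed[OF C C D f'(1) dC] by simp
  have sfd: "?s ?fd \<in> carrier (com_hom A C D (p + 1))" using fd by (simp add: sgn_mult_def)
  have "com_cmp A C D D 1 p (dif D) f \<in> carrier (com_hom A C D (p + 1))"
    using C D dD f'(1) by (intro com_cmp_closed) simp_all
  \<comment> \<open>As f is a cocycle, \<delta>f is f\<delta> up to sign. Through this replacement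
    the three identities come to share the terms \<open>?b\<close> and \<open>?h\<close>.\<close>
  then have df: "com_cmp A C D D 1 p (dif D) f = ?s ?fd"
    using f'(2) sfd unfolding com_d_def Let_def by (simp add: N.minus_eq_zero_iff)
  let ?u = "com_ev \<phi> C D D 1 p (dif D) f" and ?v = "com_ev \<phi> C C D p 1 f (dif C)"
  have u: "?u \<in> carrier (com_hom A C D (p + 1))" and v: "?v \<in> carrier (com_hom A C D (p + 1))"
    using com_ev_closed[OF C D D dD f'(1), of "p + 1"] com_ev_closed[OF C C D f'(1) dC, of "p + 1"]
    by simp_all
  have sv: "?s ?v \<in> carrier (com_hom A C D (p + 1))" using v by (simp add: sgn_mult_def)
  let ?a = "com_cmp A C D D 1 (p + 1) (dif D) ?u" and ?b = "com_ev \<phi> C D D 1 (p + 1) (dif D) ?fd"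
    and ?c = "com_cmp A C D D 2 p (obs_cocycle D) f"
    and ?e = "com_cmp A C D D 1 (p + 1) (dif D) ?v" and ?h = "com_ev \<phi> C C D (p + 1) 1 ?fd (dif C)"
    and ?l = "com_cmp A C C D (p + 1) 1 ?u (dif C)"
    and ?m = "com_cmp A C C D p 2 f (obs_cocycle C)" and ?n = "com_cmp A C C D (p + 1) 1 ?v (dif C)"
  have cl: "?a \<in> carrier ?M" "?b \<in> carrier ?M" "?c \<in> carrier ?M" "?e \<in> carrier ?M"
    "?h \<in> carrier ?M" "?l \<in> carrier ?M" "?m \<in> carrier ?M" "?n \<in> carrier ?M"
    using com_cmp_closed[OF C D D dD u, of "p + 2"] com_cmp_closed[OF C D D dD v, of "p + 2"]
      com_cmp_closed[OF C C D u dC, of "p + 2"] com_cmp_closed[OF C C D v dC, of "p + 2"]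
      com_cmp_closed[OF C D D obs_closed[OF D] f'(1), of "p + 2"]
      com_cmp_closed[OF C C D f'(1) obs_closed[OF C], of "p + 2"]
      com_ev_closed[OF C D D dD fd, of "p + 2"] com_ev_closed[OF C C D fd dC, of "p + 2"]
    by simp_all
  have 1: "?a \<oplus>\<^bsub>?M\<^esub> sgn_mult ?M p ?b = ?c"
  proof -
    have "?a \<oplus>\<^bsub>?M\<^esub> com_ev \<phi> C D D 1 (p + 1) (dif D) (com_cmp A C D D 1 p (dif D) f)
      = com_ev \<phi> C D D 2 p (com_cmp A D D D 1 1 (dif D) (dif D)) f \<oplus>\<^bsub>?M\<^esub>
        com_cmp A C D D 2 p (com_ev \<phi> D D D 1 1 (dif D) (dif D)) f"
      using C D dD f'(1) by (intro com_ev_identity) simp_all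
    moreover have "com_ev \<phi> C D D 2 p \<zero>\<^bsub>com_hom A D D 2\<^esub> f = \<zero>\<^bsub>?M\<^esub>"
      using C D f'(1) by (intro com_ev_zero_left) simp_all
    moreover have "com_ev \<phi> C D D 1 (p + 1) (dif D) (?s ?fd) = sgn_mult ?M p ?b"
      using C D dD fd by (intro com_ev_sgn_right) simp_all
    ultimately show ?thesis
      unfolding com_dif_dif[OF D] obs_cocycle_def[symmetric] df using l_zero[OF cl(3)] by (simp only:)
  qed
  have 2: "?e \<oplus>\<^bsub>?M\<^esub> ?b = sgn_mult ?M p ?h \<oplus>\<^bsub>?M\<^esub> ?l"
  proof -
    have "?e \<oplus>\<^bsub>?M\<^esub> ?b
      = com_ev \<phi> C C D (p + 1) 1 (com_cmp A C D D 1 p (dif D) f) (dif C) \<oplus>\<^bsub>?M\<^esub> ?l"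
      using C D dC dD f'(1) by (intro com_ev_identity) simp_all
    moreover have "com_ev \<phi> C C D (p + 1) 1 (?s ?fd) (dif C) = sgn_mult ?M p ?h"
      using C D dC fd by (intro com_ev_sgn_left) simp_all
    ultimately show ?thesis unfolding df by (simp only:)
  qed
  have 3: "?m = ?h \<oplus>\<^bsub>?M\<^esub> ?n"
  proof -
    have "com_cmp A C C D p 2 f (com_ev \<phi> C C C 1 1 (dif C) (dif C)) \<oplus>\<^bsub>?M\<^esub>
        com_ev \<phi> C C D p 2 f (com_cmp A C C C 1 1 (dif C) (dif C)) = ?h \<oplus>\<^bsub>?M\<^esub> ?n"
      using C D dC f'(1) by (intro com_ev_identity) simp_all
    moreover have "com_ev \<phi> C C D p 2 f \<zero>\<^bsub>com_hom A C C 2\<^esub> = \<zero>\<^bsub>?M\<^esub>"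
      using C D f'(1) by (intro com_ev_zero_right) simp_all
    ultimately show ?thesis
      unfolding com_dif_dif[OF C] obs_cocycle_def[symmetric] using r_zero[OF cl(7)] by (simp only:)
  qed
  have s1: "com_cmp A C D D 1 (p + 1) (dif D) (?s ?v) = sgn_mult ?M p ?e"
    using C D dD v by (intro com_cmp_sgn_right) simp_all
  have s2: "com_cmp A C C D (p + 1) 1 (?s ?v) (dif C) = sgn_mult ?M p ?n"
    using C D dC v by (intro com_cmp_sgn_left) simp_all
  have "com_d A C D (p + 1) (?u \<ominus>\<^bsub>com_hom A C D (p + 1)\<^esub> ?s ?v)
    = (?a \<ominus>\<^bsub>?M\<^esub> sgn_mult ?M p ?e) \<ominus>\<^bsub>?M\<^esub> sgn_mult ?M (p + 1) (?l \<ominus>\<^bsub>?M\<^esub> sgn_mult ?M p ?n)"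
  proof -
    have "com_cmp A C D D 1 (p + 1) (dif D) (?u \<ominus>\<^bsub>com_hom A C D (p + 1)\<^esub> ?s ?v)
        = ?a \<ominus>\<^bsub>?M\<^esub> com_cmp A C D D 1 (p + 1) (dif D) (?s ?v)"
      using C D dD u sv by (intro com_cmp_minus_right) simp_all
    moreover have "com_cmp A C C D (p + 1) 1 (?u \<ominus>\<^bsub>com_hom A C D (p + 1)\<^esub> ?s ?v) (dif C)
        = ?l \<ominus>\<^bsub>?M\<^esub> com_cmp A C C D (p + 1) 1 (?s ?v) (dif C)"
      using C D dC u sv by (intro com_cmp_minus_left) simp_all
    moreover have "p + 1 + 1 = p + 2" by simp
    ultimately show ?thesis unfolding com_d_def Let_def s1 s2 by (simp only:)
  qed
  also have "\<dots> = ?c \<ominus>\<^bsub>?M\<^esub> ?m"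
    using centre_signs[OF abelian_group_axioms cl 1 2 3] by simp
  finally have "?c \<ominus>\<^bsub>?M\<^esub> ?m \<in> com_d A C D (p + 1) ` carrier (com_hom A C D (p + 1))"
    using N.minus_closed[OF u sv] by (metis image_eqI)
  moreover have "p + 2 - 1 = p + 1" by simp
  ultimately show ?thesis unfolding com_bd_def by (simp only:)
qed

lemma obs_apply:
  "obs_cocycle C i = \<phi> (obj C i) [(obj C (i + 2), 0, dif C (i + 1)), (obj C (i + 1), 0, dif C i)]"
  by (simp add: obs_cocycle_def com_ev_def add.assoc)

text \<open>The category A' is arbitrary because \<open>componentwise\<close> consults it only for
  strings of the wrong length.\<close>

lemma componentwise_dif:
  "componentwise A' 2 \<phi> C [(C, 1, dif C), (C, 1, dif C)] = obs_cocycle C"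
  by (rule ext) (simp add: obs_apply componentwise_def add.assoc add.commute)

text \<open>On the empty string the brace feeds \<phi> with nothing but the m inserted copies of
  \<delta>, so among m = 0, 1, 2 only m = 2 contributes.\<close>

lemma embr_arity_zero:
  assumes C: "C \<in> complexes A"
  shows "embr A 2 \<phi> C [] = \<ominus>\<^bsub>com_hom A C C 2\<^esub> obs_cocycle C"
proof -
  interpret abelian_group "com_hom A C C 2" using C com_hom_group by blast
  note cl = obs_closed[OF C]
  have out: "out_mod (com_quiver A) 2 C [] = com_hom A C C 2"
    by (simp add: out_mod_def com_quiver_def)
  have dC: "susp (com_quiver A) 1 (delta A) C [] = dif C"
    by (simp add: susp_def sgn_mult_def delta_def)
  \<comment> \<open>On a single arrow the suspension sign of a cochain of degree 2 is odd, so the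
    zero value for m = 1 appears negated.\<close>
  have mz: "\<ominus>\<^bsub>com_hom A C C 2\<^esub> \<zero>\<^bsub>com_hom A C C 2\<^esub> = \<zero>\<^bsub>com_hom A C C 2\<^esub>"
    by (rule minus_equality) simp_all
  have 0: "brace (com_quiver A) 1 (susp (com_quiver A) 2 (componentwise A 2 \<phi>)) [] C []
      = \<zero>\<^bsub>com_hom A C C 2\<^esub>"
    by (simp add: brace_def out susp_def sgn_mult_def componentwise_def)
  have out1: "out_mod (com_quiver A) 2 C [(C, 1, d)] = com_hom A C C 2" for d
    by (simp add: out_mod_def com_quiver_def)
  have out2: "out_mod (com_quiver A) 2 C [(C, 1, d), (C, 1, d)] = com_hom A C C 2" for d
    by (simp add: out_mod_def com_quiver_def)
  have 1: "brace (com_quiver A) 1 (susp (com_quiver A) 2 (componentwise A 2 \<phi>))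
      [(0, susp (com_quiver A) 1 (delta A))] C [] = \<zero>\<^bsub>com_hom A C C 2\<^esub>"
    by (simp add: brace_def out out1 susp_def[of _ 2] sgn_mult_def componentwise_def dC Let_def mz)
  \<comment> \<open>The minus sign comes from the suspension: for two arrows the shuffle exponent is
    the degree of the left one, here 1. Inserting \<delta>, of degree 0 in the brace algebra, adds
    no sign.\<close>
  have 2: "brace (com_quiver A) 1 (susp (com_quiver A) 2 (componentwise A 2 \<phi>))
      [(0, susp (com_quiver A) 1 (delta A)), (0, susp (com_quiver A) 1 (delta A))] C []
      = \<ominus>\<^bsub>com_hom A C C 2\<^esub> obs_cocycle C"
    using cl by (simp add: brace_def out out2 susp_def[of _ 2] sgn_mult_def componentwise_dif dC Let_def)
  have "replicate 2 x = [x, x]" for x :: "int \<times> (('o, 'm) cx, int \<Rightarrow> 'm) cochain"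
    by (simp add: numeral_2_eq_2)
  moreover have "{..2::nat} = {0, 1, 2}" by auto
  ultimately show ?thesis
    using cl by (simp add: embr_def susp_def[of _ 2 _ C "[]"] sgn_mult_def Let_def out 0 1 2)
qed

end

section \<open>Change of the representing cocycle, and the graded centre\<close>

context lincat
begin

text \<open>At (\<delta>, \<delta>) the coboundary of \<eta> is u\<delta> + \<delta>u -
  \<eta>(\<delta>\<delta>) with u = \<eta>(\<delta>). The last term vanishes, and the others add up
  to du because u has degree 1.\<close>

lemma obs_cocycle_coboundary:
  assumes c: "(\<psi>, \<phi>) \<in> cohomologous R (cat_quiver A) (cat_dg A) 2" and C: "C \<in> complexes A"
  shows "lincat_cocycle.obs_cocycle \<psi> C \<ominus>\<^bsub>com_hom A C C 2\<^esub> lincat_cocycle.obs_cocycle \<phi> C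
    \<in> com_bd C C 2"
proof -
  have \<psi>: "\<psi> \<in> hoch_cocycles R (cat_quiver A) (cat_dg A) 2"
    and \<phi>: "\<phi> \<in> hoch_cocycles R (cat_quiver A) (cat_dg A) 2"
    using c by (auto simp: cohomologous_def)
  obtain \<eta> where \<eta>: "\<eta> \<in> cochains R (cat_quiver A) 1"
    and eq: "\<And>B xs. is_path (cat_quiver A) B xs \<Longrightarrow>
        \<psi> B xs = \<phi> B xs \<oplus>\<^bsub>out_mod (cat_quiver A) 2 B xs\<^esub> hoch_d (cat_quiver A) (cat_dg A) 1 \<eta> B xs"
    using c by (auto simp: cohomologous_def)
  interpret P: lincat_cocycle R A \<psi> by unfold_locales fact
  interpret F: lincat_cocycle R A \<phi> by unfold_locales fact
  define u where "u = (\<lambda>i. \<eta> (obj C i) [(obj C (i + 1), 0, dif C i)])"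
  note dC = complexesD[OF C]
  have u: "u \<in> carrier (com_hom A C C 1)"
    using dC cochain1_closed[OF \<eta>] by (simp add: com_hom_def u_def)
  have "P.obs_cocycle C \<ominus>\<^bsub>com_hom A C C 2\<^esub> F.obs_cocycle C = com_d A C C 1 u"
  proof
    fix i
    let ?X = "obj C i" and ?Y = "obj C (i + 1)" and ?Z = "obj C (i + 2)"
    interpret abelian_group "mor A ?X ?Z" using dC hom_group by blast
    have d1: "dif C (i + 1) \<in> hom_set A ?Y ?Z" using complexesD(2)[OF C, of "i + 1"] by (simp add: add.commute)
    have ui: "u i \<in> hom_set A ?X ?Y" "u (i + 1) \<in> hom_set A ?Y ?Z"
      using com_homD[OF u, of i] com_homD[OF u, of "i + 1"] by (simp_all add: add.commute)
    have u1: "\<eta> ?Y [(?Z, 0, dif C (i + 1))] = u (i + 1)" by (simp add: u_def add.commute)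
    have p: "is_path (cat_quiver A) ?X [(?Z, 0, dif C (i + 1)), (?Y, 0, dif C i)]"
      using dC d1 by simp
    have "is_path (cat_quiver A) ?X ([] @ (?Z, 0, \<zero>\<^bsub>mor A ?X ?Z\<^esub>) # [])" using dC by simp
    from cochain_zero[OF \<eta> this] have z: "\<eta> ?X [(?Z, 0, \<zero>\<^bsub>mor A ?X ?Z\<^esub>)] = \<zero>\<^bsub>mor A ?X ?Z\<^esub>" by simp
    let ?v = "cmp A ?X ?Y ?Z (u (i + 1)) (dif C i)" and ?w = "cmp A ?X ?Y ?Z (dif C (i + 1)) (u i)"
    have vw: "?v \<in> hom_set A ?X ?Z" "?w \<in> hom_set A ?X ?Z" using dC d1 ui by simp_all
    have f: "F.obs_cocycle C i \<in> hom_set A ?X ?Z" using com_homD[OF F.obs_closed[OF C], of i] by simp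
    have u0: "\<eta> ?X [(?Y, 0, dif C i)] = u i" by (simp add: u_def)
    have "P.obs_cocycle C i = F.obs_cocycle C i \<oplus>\<^bsub>mor A ?X ?Z\<^esub> (?v \<oplus>\<^bsub>mor A ?X ?Z\<^esub> ?w)"
      using eq[OF p] coboundary2[OF \<eta> dC(1) dC(1) dC(1) d1 dC(2)] vw z
      by (simp add: P.obs_apply F.obs_apply u0 u1 out_mod_def complexesD(3)[OF C])
    then have "P.obs_cocycle C i \<ominus>\<^bsub>mor A ?X ?Z\<^esub> F.obs_cocycle C i = ?w \<oplus>\<^bsub>mor A ?X ?Z\<^esub> ?v"
      using vw f by (simp add: minus_eq_iff_add a_ac)
    moreover have "com_d A C C 1 u i = ?w \<oplus>\<^bsub>mor A ?X ?Z\<^esub> ?v"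
      using com_d_apply[OF C C u, of i] vw by (simp add: sgn_mult_def minus_eq)
    ultimately show "(P.obs_cocycle C \<ominus>\<^bsub>com_hom A C C 2\<^esub> F.obs_cocycle C) i = com_d A C C 1 u i"
      unfolding com_hom_minus[OF C C F.obs_closed[OF C]] by simp
  qed
  then show ?thesis using u by (auto simp: com_bd_def)
qed

end

lemma (in abelian_group) minus_minus_swap:
  assumes "a \<in> carrier G" "b \<in> carrier G" "c \<in> carrier G" "d \<in> carrier G"
  shows "(a \<ominus> b) \<ominus> (c \<ominus> d) = (a \<ominus> c) \<ominus> (b \<ominus> d)"
  using assms by (simp add: minus_eq minus_add a_ac)

lemma (in lincat) com_cocycles_inv:
  assumes C: "C \<in> complexes A" and D: "D \<in> complexes A" and f: "f \<in> com_cocycles A C D p"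
  shows "\<ominus>\<^bsub>com_hom A C D p\<^esub> f \<in> com_cocycles A C D p"
proof -
  interpret abelian_group "com_hom A C D p" using C D com_hom_group by blast
  interpret N: abelian_group "com_hom A C D (p + 1)" using C D com_hom_group by blast
  have "com_d A C D p (\<zero>\<^bsub>com_hom A C D p\<^esub> \<ominus>\<^bsub>com_hom A C D p\<^esub> f) = \<zero>\<^bsub>com_hom A C D (p + 1)\<^esub>"
    using f com_d_minus[OF C D zero_closed, of f] com_d_zero[OF C D] by (simp add: com_cocycles_def)
  then show ?thesis using f by (simp add: com_cocycles_def minus_eq)
qed

text \<open>Since \<open>graded_centre2\<close> speaks of all representatives of the classes, the
  boundaries a and b are carried along; composed with the cocycle f they remain boundaries. The
  family \<zeta> is prescribed on bounded below complexes only, so that \<open>char_mor\<close> is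
  an instance.\<close>

lemma (in lincat_cocycle) obs_graded_centre:
  assumes \<zeta>: "\<And>C. C \<in> complexes_plus A \<Longrightarrow> \<zeta> C = ext_class A C C 2 (\<ominus>\<^bsub>com_hom A C C 2\<^esub> obs_cocycle C)"
  shows "\<zeta> \<in> graded_centre2 A"
  unfolding graded_centre2_def mem_Collect_eq
proof (intro conjI ballI allI)
  fix C assume C: "C \<in> complexes_plus A"
  then have "C \<in> complexes A" by (simp add: complexes_plus_def)
  then show "\<zeta> C \<in> Ext A C C 2"
    unfolding \<zeta>[OF C] Ext_def by (intro imageI com_cocycles_inv obs_cocycle_is_cocycle)
next
  fix C D p f z w
  assume CD: "C \<in> complexes_plus A" "D \<in> complexes_plus A"
    and f: "f \<in> com_cocycles A C D p" and z: "z \<in> \<zeta> C" and w: "w \<in> \<zeta> D"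
  have C: "C \<in> complexes A" and D: "D \<in> complexes A" using CD by (simp_all add: complexes_plus_def)
  have cf: "f \<in> carrier (com_hom A C D p)" using f by (simp add: com_cocycles_def)
  interpret abelian_group "com_hom A C D (p + 2)" using C D com_hom_group by blast
  obtain b where b: "b \<in> com_bd C C 2" "z = b \<ominus>\<^bsub>com_hom A C C 2\<^esub> obs_cocycle C"
    using z unfolding \<zeta>[OF CD(1)] ext_class_iff by (auto simp: a_minus_def)
  obtain a where a: "a \<in> com_bd D D 2" "w = a \<ominus>\<^bsub>com_hom A D D 2\<^esub> obs_cocycle D"
    using w unfolding \<zeta>[OF CD(2)] ext_class_iff by (auto simp: a_minus_def)
  note ca = com_bd_closed[OF D D a(1)] and cb = com_bd_closed[OF C C b(1)]
  note oC = obs_closed[OF C] and oD = obs_closed[OF D]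
  have wf: "com_cmp A C D D 2 p w f
    = com_cmp A C D D 2 p a f \<ominus>\<^bsub>com_hom A C D (p + 2)\<^esub> com_cmp A C D D 2 p (obs_cocycle D) f"
    unfolding a(2) using C D ca oD cf by (intro com_cmp_minus_left) simp_all
  have fz: "com_cmp A C C D p 2 f z
    = com_cmp A C C D p 2 f b \<ominus>\<^bsub>com_hom A C D (p + 2)\<^esub> com_cmp A C C D p 2 f (obs_cocycle C)"
    unfolding b(2) using C D cb oC cf by (intro com_cmp_minus_right) simp_all
  have cl: "com_cmp A C D D 2 p a f \<in> carrier (com_hom A C D (p + 2))"
    "com_cmp A C D D 2 p (obs_cocycle D) f \<in> carrier (com_hom A C D (p + 2))"
    "com_cmp A C C D p 2 f b \<in> carrier (com_hom A C D (p + 2))"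
    "com_cmp A C C D p 2 f (obs_cocycle C) \<in> carrier (com_hom A C D (p + 2))"
    using com_cmp_closed[OF C D D ca cf, of "p + 2"] com_cmp_closed[OF C D D oD cf, of "p + 2"]
      com_cmp_closed[OF C C D cf cb, of "p + 2"] com_cmp_closed[OF C C D cf oC, of "p + 2"] by simp_all
  have "com_cmp A C D D 2 p a f \<in> com_bd C D (p + 2)" "com_cmp A C C D p 2 f b \<in> com_bd C D (p + 2)"
    using com_cmp_bd_left[OF C D D a(1) f, of "p + 2"] com_cmp_bd_right[OF C C D f b(1), of "p + 2"]
    by simp_all
  then have "com_cmp A C D D 2 p w f \<ominus>\<^bsub>com_hom A C D (p + 2)\<^esub> com_cmp A C C D p 2 f z
      \<in> com_bd C D (p + 2)"
    unfolding wf fz minus_minus_swap[OF cl] by (intro com_bd_minus C D obs_central f)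
  then show "ext_class A C D (p + 2) (com_cmp A C D D 2 p w f)
      = ext_class A C D (p + 2) (com_cmp A C C D p 2 f z)"
    using ext_class_eq_iff[OF C D] cl wf fz by simp
qed

section \<open>The obstruction attached to a Hochschild class and its vanishing\<close>

lemma obstruction_cohomologous:
  assumes A: "lincat k A" and c: "(\<psi>, \<phi>) \<in> cohomologous k (cat_quiver (Inj A)) (cat_dg (Inj A)) 2"
    and C: "C \<in> complexes (Inj A)"
  shows "obstruction A \<psi> C = obstruction A \<phi> C"
proof -
  interpret I: lincat k "Inj A" using A by (rule lincat.Inj_lincat)
  interpret P: lincat_cocycle k "Inj A" \<psi> using c by unfold_locales (auto simp: cohomologous_def)
  interpret F: lincat_cocycle k "Inj A" \<phi> using c by unfold_locales (auto simp: cohomologous_def)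
  interpret abelian_group "com_hom (Inj A) C C 2" using C I.com_hom_group by blast
  note cl = P.obs_closed[OF C] F.obs_closed[OF C]
  have "(\<ominus>\<^bsub>com_hom (Inj A) C C 2\<^esub> P.obs_cocycle C) \<ominus>\<^bsub>com_hom (Inj A) C C 2\<^esub>
      (\<ominus>\<^bsub>com_hom (Inj A) C C 2\<^esub> F.obs_cocycle C)
    = \<ominus>\<^bsub>com_hom (Inj A) C C 2\<^esub> (P.obs_cocycle C \<ominus>\<^bsub>com_hom (Inj A) C C 2\<^esub> F.obs_cocycle C)"
    using cl by (simp add: minus_eq minus_add)
  also have "\<dots> \<in> I.com_bd C C 2"
    by (intro I.com_bd_inv C I.obs_cocycle_coboundary c)
  finally show ?thesis
    unfolding obstruction_def obstruction_cocycle_def P.componentwise_dif F.componentwise_dif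
    using I.ext_class_eq_iff[OF C C] cl by simp
qed

context
  fixes k :: "'r ring" and A :: "('o, 'm, 'r) lincat" and c \<phi>
  assumes A: "lincat k A" and c: "c \<in> HH_ab k A 2" and \<phi>: "\<phi> \<in> c"
begin

lemma HH_class_cocycle:
  assumes "\<psi> \<in> c"
  shows "\<psi> \<in> hoch_cocycles k (cat_quiver (Inj A)) (cat_dg (Inj A)) 2"
  using c assms by (auto simp: HH_ab_def HH_def quotient_def cohomologous_def)

text \<open>Both representatives are compared with one generator \<chi> of the class, which avoids
  symmetry and transitivity of \<open>cohomologous\<close>.\<close>

lemma obstruction_HH_class:
  assumes "\<psi> \<in> c" "C \<in> complexes (Inj A)"
  shows "obstruction A \<psi> C = obstruction A \<phi> C"
proof -
  obtain \<chi> where "c = cohomologous k (cat_quiver (Inj A)) (cat_dg (Inj A)) 2 `` {\<chi>}"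
    using c by (auto simp: HH_ab_def HH_def quotient_def)
  then have "(\<chi>, \<psi>) \<in> cohomologous k (cat_quiver (Inj A)) (cat_dg (Inj A)) 2"
    "(\<chi>, \<phi>) \<in> cohomologous k (cat_quiver (Inj A)) (cat_dg (Inj A)) 2"
    using assms(1) \<phi> by auto
  from this[THEN obstruction_cohomologous[OF A _ assms(2)]] show ?thesis by simp
qed

text \<open>As \<open>char_mor\<close> evaluates an arbitrarily chosen representative, the equality
  rests on the independence of the obstruction from that choice.\<close>

lemma char_mor_eq_obstruction:
  assumes "C \<in> complexes (Inj A)"
  shows "char_mor A c C = obstruction A \<phi> C"
proof -
  let ?\<psi> = "SOME \<psi>. \<psi> \<in> c"
  have \<psi>: "?\<psi> \<in> c" using \<phi> by (auto simp: some_in_eq)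
  interpret I: lincat k "Inj A" using A by (rule lincat.Inj_lincat)
  interpret P: lincat_cocycle k "Inj A" ?\<psi> using HH_class_cocycle[OF \<psi>] by unfold_locales
  have "char_mor A c C = obstruction A ?\<psi> C"
    unfolding char_mor_def obstruction_def obstruction_cocycle_def P.componentwise_dif
      P.embr_arity_zero[OF assms] ..
  then show ?thesis using obstruction_HH_class[OF \<psi> assms] by simp
qed

lemma obstruction_central:
  assumes "\<And>C. C \<in> complexes_plus (Inj A) \<Longrightarrow> \<zeta> C = obstruction A \<phi> C"
  shows "\<zeta> \<in> graded_centre2 (Inj A)"
proof -
  interpret I: lincat k "Inj A" using A by (rule lincat.Inj_lincat)
  interpret P: lincat_cocycle k "Inj A" \<phi> using HH_class_cocycle[OF \<phi>] by unfold_locales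
  show ?thesis
    by (rule P.obs_graded_centre)
      (simp add: assms obstruction_def obstruction_cocycle_def P.componentwise_dif)
qed

text \<open>This form of vanishing is the one to be matched with deformations: h is going to be the
  \<epsilon>-component of a lifted differential.\<close>

lemma obstruction_vanishes_iff:
  assumes C: "C \<in> complexes (Inj A)"
  shows "obstruction A \<phi> C = ext_class (Inj A) C C 2 \<zero>\<^bsub>com_hom (Inj A) C C 2\<^esub> \<longleftrightarrow>
    (\<exists>h \<in> carrier (com_hom (Inj A) C C 1).
       com_d (Inj A) C C 1 h = \<ominus>\<^bsub>com_hom (Inj A) C C 2\<^esub> obstruction_cocycle A \<phi> C)"
proof -
  interpret I: lincat k "Inj A" using A by (rule lincat.Inj_lincat)
  interpret P: lincat_cocycle k "Inj A" \<phi> using HH_class_cocycle[OF \<phi>] by unfold_locales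
  interpret abelian_group "com_hom (Inj A) C C 2" using C I.com_hom_group by blast
  note o = obstruction_cocycle_def[of A \<phi> C, unfolded P.componentwise_dif]
  have "x \<in> I.com_bd C C 2 \<longleftrightarrow> (\<exists>h \<in> carrier (com_hom (Inj A) C C 1). com_d (Inj A) C C 1 h = x)" for x
    by (auto simp: I.com_bd_def)
  then show ?thesis
    unfolding obstruction_def o I.ext_class_eq_zero_iff[OF C C a_inv_closed[OF P.obs_closed[OF C]]]
    by blast
qed

text \<open>The class at C is the class at K conjugated by a homotopy equivalence.\<close>

lemma obstruction_vanishes_transport:
  assumes C: "C \<in> complexes_plus (Inj A)" and K: "K \<in> complexes_plus (Inj A)"
    and KC: "homotopy_equivalent (Inj A) K C"
    and 0: "obstruction A \<phi> K = ext_class (Inj A) K K 2 \<zero>\<^bsub>com_hom (Inj A) K K 2\<^esub>"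
  shows "obstruction A \<phi> C = ext_class (Inj A) C C 2 \<zero>\<^bsub>com_hom (Inj A) C C 2\<^esub>"
proof -
  interpret I: lincat k "Inj A" using A by (rule lincat.Inj_lincat)
  interpret P: lincat_cocycle k "Inj A" \<phi> using HH_class_cocycle[OF \<phi>] by unfold_locales
  have C': "C \<in> complexes (Inj A)" and K': "K \<in> complexes (Inj A)"
    using C K by (simp_all add: complexes_plus_def)
  interpret abelian_group "com_hom (Inj A) C C 2" using C' I.com_hom_group by blast
  interpret K: abelian_group "com_hom (Inj A) K K 2" using K' I.com_hom_group by blast
  have o: "obstruction A \<phi> C = ext_class (Inj A) C C 2 (\<ominus>\<^bsub>com_hom (Inj A) C C 2\<^esub> P.obs_cocycle C)"
    by (simp add: obstruction_def obstruction_cocycle_def P.componentwise_dif)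
  let ?w = "\<ominus>\<^bsub>com_hom (Inj A) C C 2\<^esub> P.obs_cocycle C"
  have w: "?w \<in> com_cocycles (Inj A) C C 2" by (intro I.com_cocycles_inv C' P.obs_cocycle_is_cocycle)
  then have cw: "?w \<in> carrier (com_hom (Inj A) C C 2)" by (simp add: com_cocycles_def)
  have "\<zero>\<^bsub>com_hom (Inj A) K K 2\<^esub> \<in> obstruction A \<phi> K"
    using I.com_bd_zero[OF K' K'] unfolding 0 I.ext_class_iff by force
  moreover have "?w \<in> obstruction A \<phi> C"
    using I.com_bd_zero[OF C' C'] cw unfolding o I.ext_class_iff by force
  ultimately have "?w \<in> I.com_bd C C 2"
    using I.centre_zero_transport[OF obstruction_central K C KC, of "obstruction A \<phi>"] w by blast
  then show ?thesis unfolding o using I.ext_class_eq_zero_iff[OF C' C' cw] by blast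
qed

end

section \<open>Cohomology and injective objects in abelian categories\<close>

context lincat
begin

lemma two_sided_inverse:
  assumes "X \<in> obs A" "Y \<in> obs A" "f \<in> hom_set A X Y" "l \<in> hom_set A Y X" "r \<in> hom_set A Y X"
    and "cmp A X Y X l f = idn A X" "cmp A Y X Y f r = idn A Y"
  shows "l = r"
proof -
  have "l = cmp A Y Y X l (cmp A Y X Y f r)" using assms by simp
  also have "\<dots> = cmp A Y X X (cmp A X Y X l f) r" by (rule cmp_assoc[symmetric]) (use assms in simp_all)
  also have "\<dots> = r" using assms by simp
  finally show ?thesis .
qed

text \<open>If \<open>m t = 0\<close>, the epimorphism \<open>q p\<close> with q the cokernel of t is the cokernel of
  some g killed by f; so p factors through \<open>q p\<close>, which makes q a split monomorphism.\<close>

lemma coimage_mono: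
  assumes ab: "abelian_category R A" and ob: "X \<in> obs A" "Y \<in> obs A" and f: "f \<in> hom_set A X Y"
    and u: "is_kernel A X Y f K u" and p: "is_cokernel A K X u Q p"
    and m: "m \<in> hom_set A Q Y" "cmp A X Q Y m p = f"
  shows "mono_mor A Q Y m"
proof (rule mono_morI)
  note K = is_kernelD[OF u] and Q = is_cokernelD[OF p]
  show "Q \<in> obs A" "Y \<in> obs A" "m \<in> hom_set A Q Y" by fact+
  fix T t assume T: "T \<in> obs A" and t: "t \<in> hom_set A T Q" and mt: "cmp A T Q Y m t = \<zero>\<^bsub>mor A T Y\<^esub>"
  obtain S q where q: "is_cokernel A T Q t S q"
    using ab T Q t unfolding abelian_category_def by blast
  note S = is_cokernelD[OF q]
  obtain m' where m': "m' \<in> hom_set A S Y" "cmp A Q S Y m' q = m"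
    using cokernel_factor[OF q ob(2) m(1) mt] .
  have ep: "epi_mor A X Q p" by (rule cokernel_epi[OF p K(1) ob(1) K(2)])
  have eq: "epi_mor A Q S q" by (rule cokernel_epi[OF q T Q(1) t])
  let ?r = "cmp A X Q S q p"
  have r: "?r \<in> hom_set A X S" using ob Q S by simp
  have "epi_mor A X S ?r"
    unfolding epi_mor_def
  proof (intro conjI ballI impI r)
    fix V x y assume V: "V \<in> obs A" "x \<in> hom_set A S V" "y \<in> hom_set A S V"
      and e: "cmp A X S V x ?r = cmp A X S V y ?r"
    have "cmp A X Q V (cmp A Q S V x q) p = cmp A X Q V (cmp A Q S V y q) p"
      using V e ob Q S by (simp add: cmp_assoc)
    then have "cmp A Q S V x q = cmp A Q S V y q"
      using epi_mor_cancel[OF ep V(1)] V ob Q S by simp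
    then show "x = y" using epi_mor_cancel[OF eq V(1)] V by simp
  qed
  then obtain W g where W: "W \<in> obs A" "g \<in> hom_set A W X" and g: "is_cokernel A W X g S ?r"
    using ab ob S unfolding abelian_category_def by blast
  have rg: "cmp A W X S ?r g = \<zero>\<^bsub>mor A W S\<^esub>" using is_cokernelD[OF g] by simp
  have "f = cmp A X S Y m' ?r" using m m' ob Q S by (simp add: cmp_assoc[symmetric])
  then have "cmp A W X Y f g = cmp A W S Y m' (cmp A W X S ?r g)"
    using W ob r S m' by (simp add: cmp_assoc)
  also have "\<dots> = \<zero>\<^bsub>mor A W Y\<^esub>" using rg W ob S m' by simp
  finally obtain g' where g': "g' \<in> hom_set A W K" "cmp A W K X u g' = g"
    using kernel_factor[OF u W] by blast
  have "cmp A W X Q p g = cmp A W K Q (cmp A K X Q p u) g'"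
    unfolding g'(2)[symmetric] by (rule cmp_assoc[symmetric]) (use g' K Q W ob in simp_all)
  also have "\<dots> = \<zero>\<^bsub>mor A W Q\<^esub>" using Q K W g' by simp
  finally obtain s where s: "s \<in> hom_set A S Q" "cmp A X S Q s ?r = p"
    using cokernel_factor[OF g Q(1,2)] by blast
  have "cmp A X Q Q (cmp A Q S Q s q) p = cmp A X Q Q (idn A Q) p"
    using s ob Q S by (simp add: cmp_assoc)
  then have sq: "cmp A Q S Q s q = idn A Q"
    using epi_mor_cancel[OF ep Q(1)] s ob Q S by simp
  have "t = cmp A T Q Q (cmp A Q S Q s q) t" using sq t T Q by simp
  also have "\<dots> = cmp A T S Q s (cmp A T Q S q t)" using s t T Q S by (simp add: cmp_assoc)
  also have "\<dots> = \<zero>\<^bsub>mor A T Q\<^esub>" using S(3) s T Q S by simp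
  finally show "t = \<zero>\<^bsub>mor A T Q\<^esub>" .
qed

lemma injective_extend:
  assumes "injective_object A I" "X \<in> obs A" "Y \<in> obs A" "mono_mor A X Y u" "f \<in> hom_set A X I"
  obtains g where "g \<in> hom_set A Y I" "cmp A X Y I g u = f"
  using assms unfolding injective_object_def by blast

text \<open>The map a kills the kernel of f, hence descends to the coimage of f. The coimage embeds
  into Y by \<open>coimage_mono\<close>, and injectivity of E extends the map from there.\<close>

lemma factor_through_injective:
  assumes ab: "abelian_category R A" and ob: "X \<in> obs A" "Y \<in> obs A" and f: "f \<in> hom_set A X Y"
    and u: "is_kernel A X Y f K u" and E: "injective_object A E"
    and a: "a \<in> hom_set A X E" "cmp A K X E a u = \<zero>\<^bsub>mor A K E\<^esub>"
  obtains b where "b \<in> hom_set A Y E" "cmp A X Y E b f = a"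
proof -
  note K = is_kernelD[OF u] and E' = injective_object_obs[OF E]
  obtain Q p where p: "is_cokernel A K X u Q p"
    using ab K ob unfolding abelian_category_def by blast
  note Q = is_cokernelD[OF p]
  obtain a1 where a1: "a1 \<in> hom_set A Q E" "cmp A X Q E a1 p = a" using cokernel_factor[OF p E' a] .
  obtain m where m: "m \<in> hom_set A Q Y" "cmp A X Q Y m p = f"
    using cokernel_factor[OF p ob(2) f K(3)] .
  obtain b where b: "b \<in> hom_set A Y E" "cmp A Q Y E b m = a1"
    using injective_extend[OF E Q(1) ob(2) coimage_mono[OF ab ob f u p m] a1(1)] .
  have "cmp A X Y E b (cmp A X Q Y m p) = cmp A X Q E (cmp A Q Y E b m) p"
    by (rule cmp_assoc[symmetric]) (use b m a1 ob Q E' in simp_all)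
  then have "cmp A X Y E b f = a" unfolding b(2) m(2) a1(2) .
  with b(1) show thesis by (rule that)
qed

text \<open>Restricted to the cycles, a kills the boundaries and so factors through the cohomology,
  which is zero. Thus a vanishes on the kernel of the differential and
  \<open>factor_through_injective\<close> applies.\<close>

lemma acyclic_factor:
  assumes ab: "abelian_category R A" and C: "C \<in> complexes A"
    and ac: "\<And>Z u H q. is_cohomology A C n Z u H q \<Longrightarrow> zero_object A H"
    and E: "injective_object A E" and a: "a \<in> hom_set A (obj C n) E"
    and ad: "cmp A (obj C (n - 1)) (obj C n) E a (dif C (n - 1)) = \<zero>\<^bsub>mor A (obj C (n - 1)) E\<^esub>"
  obtains b where "b \<in> hom_set A (obj C (n + 1)) E"
    "cmp A (obj C n) (obj C (n + 1)) E b (dif C n) = a"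
proof -
  let ?X = "obj C (n - 1)" and ?Y = "obj C n" and ?Z = "obj C (n + 1)"
  note dC = complexesD[OF C] and E' = injective_object_obs[OF E]
  have d: "dif C (n - 1) \<in> hom_set A ?X ?Y" using dC(2)[of "n - 1"] by simp
  have dd: "cmp A ?X ?Y ?Z (dif C n) (dif C (n - 1)) = \<zero>\<^bsub>mor A ?X ?Z\<^esub>"
    using dif_dif[OF C, of "n" "n - 1" "n + 1"] by simp
  obtain K u where u: "is_kernel A ?Y ?Z (dif C n) K u"
    using ab dC unfolding abelian_category_def by blast
  note K = is_kernelD[OF u]
  obtain e where e: "e \<in> hom_set A ?X K" "cmp A ?X K ?Y u e = dif C (n - 1)"
    using kernel_factor[OF u dC(1) d dd] .
  obtain H q where q: "is_cokernel A ?X K e H q"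
    using ab dC e K unfolding abelian_category_def by blast
  note H = is_cokernelD[OF q]
  have "is_cohomology A C n K u H q" unfolding is_cohomology_def using u e q by blast
  then have H0: "zero_object A H" by (rule ac)
  have "cmp A ?X K E (cmp A K ?Y E a u) e = \<zero>\<^bsub>mor A ?X E\<^esub>"
    using ad e K a E' dC by (simp add: cmp_assoc)
  then obtain s where s: "s \<in> hom_set A H E" "cmp A K H E s q = cmp A K ?Y E a u"
    using cokernel_factor[OF q E'] K a E' dC by (metis cmp_closed)
  have "s = \<zero>\<^bsub>mor A H E\<^esub>" using H0 s E' unfolding zero_object_def by blast
  then have "cmp A K ?Y E a u = \<zero>\<^bsub>mor A K E\<^esub>" using s(2) K H E' by simp
  from factor_through_injective[OF ab dC(1) dC(1) dC(2) u E a this] that show thesis by blast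
qed

section \<open>Comparison of cohomology objects\<close>

lemma is_cohomology_closed:
  assumes "is_cohomology A C n Z u H q"
  shows "Z \<in> obs A" "u \<in> hom_set A Z (obj C n)" "H \<in> obs A" "q \<in> hom_set A Z H"
  using assms by (auto simp: is_cohomology_def is_kernel_def is_cokernel_def)

text \<open>Cohomology is given as a relation with arbitrary choices of kernel and cokernel; the
  universal properties compare any two choices.\<close>

lemma cohomology_map:
  assumes C: "C \<in> complexes A"
    and 1: "is_cohomology A C n Z u H q" and 2: "is_cohomology A C n Z' u' H' q'"
  obtains z h where "z \<in> hom_set A Z Z'" "cmp A Z Z' (obj C n) u' z = u" "h \<in> hom_set A H H'"
    "cmp A Z H H' h q = cmp A Z Z' H' q' z"
proof -
  let ?X = "obj C (n - 1)" and ?Y = "obj C n"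
  note dC = complexesD[OF C]
  obtain e where u: "is_kernel A (obj C n) (obj C (n + 1)) (dif C n) Z u"
    and e: "e \<in> hom_set A ?X Z" "cmp A ?X Z ?Y u e = dif C (n - 1)" and q: "is_cokernel A ?X Z e H q"
    using 1 unfolding is_cohomology_def by blast
  obtain e' where u': "is_kernel A (obj C n) (obj C (n + 1)) (dif C n) Z' u'"
    and e': "e' \<in> hom_set A ?X Z'" "cmp A ?X Z' ?Y u' e' = dif C (n - 1)"
    and q': "is_cokernel A ?X Z' e' H' q'"
    using 2 unfolding is_cohomology_def by blast
  note K = is_kernelD[OF u] is_kernelD[OF u'] is_cokernelD[OF q] is_cokernelD[OF q']
  obtain z where z: "z \<in> hom_set A Z Z'" "cmp A Z Z' ?Y u' z = u"
    using kernel_factor[OF u' K(1-3)] .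
  have "cmp A ?X Z' ?Y u' (cmp A ?X Z Z' z e) = cmp A ?X Z' ?Y u' e'"
    using z e e' K dC by (simp add: cmp_assoc[symmetric])
  then have ze: "cmp A ?X Z Z' z e = e'"
    by (rule mono_mor_cancel[OF kernel_mono[OF u' dC(1) dC(1) dC(2)] dC(1), rotated 2])
      (use z e e' K dC in simp_all)
  have "cmp A ?X Z H' (cmp A Z Z' H' q' z) e = \<zero>\<^bsub>mor A ?X H'\<^esub>"
    using z e K dC ze by (simp add: cmp_assoc)
  then obtain h where "h \<in> hom_set A H H'" "cmp A Z H H' h q = cmp A Z Z' H' q' z"
    using cokernel_factor[OF q K(10)] z K by (metis cmp_closed)
  with z show thesis by (rule that)
qed

text \<open>Not immediate, because \<open>quasi_iso\<close> allows different cohomology objects on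
  the two sides. The comparison maps in the two directions are mutually inverse.\<close>

lemma quasi_iso_refl:
  assumes C: "C \<in> complexes A"
  shows "quasi_iso A C C (com_idn A C)"
  unfolding quasi_iso_def
proof (intro conjI allI impI com_idn_cocycle[OF C])
  note dC = complexesD[OF C]
  fix n Z u H q Z' u' H' q'
  assume *: "is_cohomology A C n Z u H q \<and> is_cohomology A C n Z' u' H' q'"
  \<comment> \<open>Proved for arbitrary data, since it is used twice with the two sides exchanged:
    u1 is cancelled as a monomorphism, then q1 as an epimorphism.\<close>
  have inv: "cmp A H1 H2 H1 h' h = idn A H1"
    if 1: "is_cohomology A C n Z1 u1 H1 q1" and 2: "is_cohomology A C n Z2 u2 H2 q2"
      and z: "z \<in> hom_set A Z1 Z2" "cmp A Z1 Z2 (obj C n) u2 z = u1"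
      and h: "h \<in> hom_set A H1 H2" "cmp A Z1 H1 H2 h q1 = cmp A Z1 Z2 H2 q2 z"
      and z': "z' \<in> hom_set A Z2 Z1" "cmp A Z2 Z1 (obj C n) u1 z' = u2"
      and h': "h' \<in> hom_set A H2 H1" "cmp A Z2 H2 H1 h' q2 = cmp A Z2 Z1 H1 q1 z'"
    for Z1 u1 H1 q1 Z2 u2 H2 q2 z h z' h'
  proof -
    obtain e where u: "is_kernel A (obj C n) (obj C (n + 1)) (dif C n) Z1 u1"
      and e: "e \<in> hom_set A (obj C (n - 1)) Z1" and q: "is_cokernel A (obj C (n - 1)) Z1 e H1 q1"
      using 1 unfolding is_cohomology_def by blast
    have 2: "Z2 \<in> obs A" "u2 \<in> hom_set A Z2 (obj C n)" "H2 \<in> obs A" "q2 \<in> hom_set A Z2 H2"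
      by (rule is_cohomology_closed[OF 2])+
    note K = is_kernelD[OF u] is_cokernelD[OF q] 2
    have "cmp A Z1 Z1 (obj C n) u1 (cmp A Z1 Z2 Z1 z' z) = cmp A Z1 Z1 (obj C n) u1 (idn A Z1)"
      using z z' K dC by (simp add: cmp_assoc[symmetric])
    then have zz: "cmp A Z1 Z2 Z1 z' z = idn A Z1"
      by (rule mono_mor_cancel[OF kernel_mono[OF u dC(1) dC(1) dC(2)] K(1), rotated 2])
        (use z z' K dC in simp_all)
    have "cmp A Z1 H1 H1 (cmp A H1 H2 H1 h' h) q1 = cmp A Z1 Z2 H1 (cmp A Z2 H2 H1 h' q2) z"
      using h h'(1) z K by (simp add: cmp_assoc)
    also have "\<dots> = cmp A Z1 H1 H1 (idn A H1) q1"
      using h' z z' K zz by (simp add: cmp_assoc)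
    finally show ?thesis
      by (rule epi_mor_cancel[OF cokernel_epi[OF q dC(1) K(1) e] K(4), rotated 2])
        (use h h' K in simp_all)
  qed
  obtain z h where z: "z \<in> hom_set A Z Z'" "cmp A Z Z' (obj C n) u' z = u" and h: "h \<in> hom_set A H H'"
    "cmp A Z H H' h q = cmp A Z Z' H' q' z"
    using cohomology_map[OF C conjunct1[OF *] conjunct2[OF *]] .
  obtain z' h' where z': "z' \<in> hom_set A Z' Z" "cmp A Z' Z (obj C n) u z' = u'" and h': "h' \<in> hom_set A H' H"
    "cmp A Z' H' H h' q' = cmp A Z' Z H q z'"
    using cohomology_map[OF C conjunct2[OF *] conjunct1[OF *]] .
  have "iso_mor A H H' h"
    unfolding iso_mor_def
    using h h' inv[OF conjunct1[OF *] conjunct2[OF *] z h z' h']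
      inv[OF conjunct2[OF *] conjunct1[OF *] z' h' z h] by blast
  moreover have "u \<in> hom_set A Z (obj C n)" "Z \<in> obs A"
    using is_cohomology_closed[OF conjunct1[OF *]] by simp_all
  ultimately show "\<exists>z \<in> hom_set A Z Z'. \<exists>h. cmp A Z Z' (obj C n) u' z
      = cmp A Z (obj C n) (obj C n) (com_idn A C n) u \<and> iso_mor A H H' h \<and>
      cmp A Z H H' h q = cmp A Z Z' H' q' z"
    using z h dC by (intro bexI[of _ z] exI[of _ h]) (simp_all add: com_idn_def)
qed

end

lemma complexes_Inj:
  assumes "C \<in> complexes (Inj A)"
  shows "C \<in> complexes A"
  using assms injective_object_obs unfolding complexes_def Inj_simps by fast

section \<open>Abelian deformations\<close>

text \<open>The elimination behind \<open>deformed_acyclic\<close>. The relations come from the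
  \<epsilon>-component of a vanishing composite, from dh = -\<phi>(\<delta>, \<delta>) and from the
  cocycle identity; s, v and w are removed.\<close>

lemma (in abelian_group) three_relations:
  assumes "p \<in> carrier G" "q \<in> carrier G" "r \<in> carrier G" "s \<in> carrier G" "v \<in> carrier G" "w \<in> carrier G"
    and 1: "(s \<oplus> p) \<oplus> w = \<zero>" and 2: "s \<oplus> q = \<ominus> v" and 3: "v = w \<oplus> r"
  shows "(p \<ominus> q) \<ominus> r = \<zero>"
proof -
  have "(s \<oplus> w) \<oplus> (q \<oplus> r) = (s \<oplus> q) \<oplus> (w \<oplus> r)" using assms(1-6) by (simp add: a_ac)
  also have "\<dots> = \<zero>" unfolding 2 3[symmetric] using assms(1-6) by (simp add: l_neg)
  also have "\<dots> = (s \<oplus> w) \<oplus> p" using assms(1-6) 1 by (simp add: a_ac)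
  finally have "q \<oplus> r = p" using assms(1-6) by simp
  then have "p \<ominus> q = r" using assms(1-6) by (metis a_comm minus_eq_iff_add)
  then show ?thesis using assms(3) by simp
qed

text \<open>Fixes a choice of G and \<kappa>, whose mere existence is asserted by
  \<open>deformation_along\<close>.\<close>

locale deformation_equivalence =
  fixes k :: "'r ring" and A :: "('o, 'm, 'r) lincat" and \<phi> :: "('o, 'm) cochain"
    and B :: "('p, 'n, 'r \<times> 'r) lincat" and Fo :: "'o \<Rightarrow> 'p" and Fm :: "'o \<Rightarrow> 'o \<Rightarrow> 'm \<Rightarrow> 'n"
    and Go :: "'o \<Rightarrow> 'p" and Gm :: "'o \<Rightarrow> 'o \<Rightarrow> 'm \<times> 'm \<Rightarrow> 'n" and \<kappa> :: "'o \<Rightarrow> 'n"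
  assumes k: "field k" and abA: "abelian_category k A" and injA: "enough_injectives A"
    and \<phi>: "\<phi> \<in> hoch_cocycles k (cat_quiver (Inj A)) (cat_dg (Inj A)) 2"
    and abB: "abelian_category (dual_numbers k) B"
    and F: "linear_equivalence k A (reduction k B) Fo Fm"
    and G: "linear_equivalence (dual_numbers k) (linear_deformation (Inj A) \<phi>) (Inj B) Go Gm"
    and \<kappa>: "injective_object A E \<Longrightarrow> is_kernel B (Go E) (Go E) (eps_mor k B (Go E)) (Fo E) (\<kappa> E)"
    and \<kappa>_natural: "\<lbrakk>injective_object A E; injective_object A E'; f \<in> hom_set A E E'; f' \<in> hom_set A E E'\<rbrakk>
      \<Longrightarrow> cmp B (Fo E) (Go E) (Go E') (Gm E E' (f, f')) (\<kappa> E)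
        = cmp B (Fo E) (Fo E') (Go E') (\<kappa> E') (Fm E E' f)"
begin

sublocale A: lincat k A
  using abA by unfold_locales (simp add: abelian_category_def)

sublocale B: lincat "dual_numbers k" B
  using abB by unfold_locales (simp add: abelian_category_def)

sublocale I: lincat k "Inj A"
  by (rule A.Inj_lincat)

sublocale P: lincat_cocycle k "Inj A" \<phi>
  by unfold_locales (rule \<phi>)

declare injective_object_obs [simp]

abbreviation eps where "eps X \<equiv> eps_mor k B X"

lemma dual_carrier: "dual_eps k \<in> carrier (dual_numbers k)"
proof -
  interpret field k by (rule k)
  show ?thesis by (simp add: dual_eps_def dual_numbers_def)
qed

lemma dual_eps_eps: "dual_eps k \<otimes>\<^bsub>dual_numbers k\<^esub> dual_eps k = \<zero>\<^bsub>dual_numbers k\<^esub>"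
proof -
  interpret field k by (rule k)
  show ?thesis by (simp add: dual_eps_def dual_numbers_def)
qed

lemma eps_closed [simp, intro]: "X \<in> obs B \<Longrightarrow> eps X \<in> hom_set B X X"
  unfolding eps_mor_def by (rule B.smult_closed) (simp_all add: dual_carrier)

lemma eps_natural:
  assumes "X \<in> obs B" "Y \<in> obs B" "f \<in> hom_set B X Y"
  shows "cmp B X Y Y (eps Y) f = cmp B X X Y f (eps X)"
  using assms by (simp add: eps_mor_def dual_carrier B.cmp_smult_left B.cmp_smult_right)

lemma eps_eps:
  assumes X: "X \<in> obs B"
  shows "cmp B X X X (eps X) (eps X) = \<zero>\<^bsub>mor B X X\<^esub>"
proof -
  interpret module "dual_numbers k" "mor B X X" using X B.hom_module by blast
  have "cmp B X X X (eps X) (eps X) = dual_eps k \<odot>\<^bsub>mor B X X\<^esub> (dual_eps k \<odot>\<^bsub>mor B X X\<^esub> idn B X)"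
    using X eps_closed[OF X] by (simp add: eps_mor_def dual_carrier B.cmp_smult_left)
  also have "\<dots> = (dual_eps k \<otimes>\<^bsub>dual_numbers k\<^esub> dual_eps k) \<odot>\<^bsub>mor B X X\<^esub> idn B X"
    using X by (simp add: smult_assoc1 dual_carrier)
  also have "\<dots> = \<zero>\<^bsub>mor B X X\<^esub>" using X by (simp add: dual_eps_eps)
  finally show ?thesis .
qed

text \<open>Naturality of \<epsilon> gives v \<epsilon> = \<epsilon> v = 0, and v is a monomorphism.
  Hence the kernel lies in the reduction of B and comes from A through F.\<close>

lemma kernel_eps_reduced:
  assumes "is_kernel B M M (eps M) K v" "M \<in> obs B"
  shows "eps K = \<zero>\<^bsub>mor B K K\<^esub>"
proof -
  note K = B.is_kernelD[OF assms(1)]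
  have "cmp B K K M v (eps K) = \<zero>\<^bsub>mor B K M\<^esub>"
    using K eps_natural[of K M v] assms(2) by simp
  then show ?thesis
    using B.mono_mor_zero[OF B.kernel_mono[OF assms(1)]] K assms(2) by simp
qed

lemma dual_one: "\<one>\<^bsub>dual_numbers k\<^esub> = (\<one>\<^bsub>k\<^esub>, \<zero>\<^bsub>k\<^esub>)"
  by (simp add: dual_numbers_def)

section \<open>The equivalences F and G\<close>

lemma F_obs [simp]: "X \<in> obs A \<Longrightarrow> Fo X \<in> obs B"
  using F by (simp add: linear_equivalence_def linear_functor_def reduction_def)

lemma F_closed [simp, intro]:
  "\<lbrakk>X \<in> obs A; Y \<in> obs A; f \<in> hom_set A X Y\<rbrakk> \<Longrightarrow> Fm X Y f \<in> hom_set B (Fo X) (Fo Y)"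
  using F by (simp add: linear_equivalence_def linear_functor_def reduction_def restrict_scalars_def)

lemma F_cmp:
  "\<lbrakk>X \<in> obs A; Y \<in> obs A; Z \<in> obs A; g \<in> hom_set A Y Z; f \<in> hom_set A X Y\<rbrakk>
    \<Longrightarrow> Fm X Z (cmp A X Y Z g f) = cmp B (Fo X) (Fo Y) (Fo Z) (Fm Y Z g) (Fm X Y f)"
  using F by (simp add: linear_equivalence_def linear_functor_def reduction_def)

lemma F_idn: "X \<in> obs A \<Longrightarrow> Fm X X (idn A X) = idn B (Fo X)"
  using F by (simp add: linear_equivalence_def linear_functor_def reduction_def)

lemma F_bij:
  "\<lbrakk>X \<in> obs A; Y \<in> obs A\<rbrakk> \<Longrightarrow> bij_betw (Fm X Y) (hom_set A X Y) (hom_set B (Fo X) (Fo Y))"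
  using F by (simp add: linear_equivalence_def reduction_def restrict_scalars_def)

lemma F_eq:
  assumes "Fm X Y f = Fm X Y g" "X \<in> obs A" "Y \<in> obs A" "f \<in> hom_set A X Y" "g \<in> hom_set A X Y"
  shows "f = g"
  using bij_betw_imp_inj_on[OF F_bij] assms unfolding inj_on_def by blast

lemma F_full:
  assumes "X \<in> obs A" "Y \<in> obs A" "g \<in> hom_set B (Fo X) (Fo Y)"
  obtains f where "f \<in> hom_set A X Y" "Fm X Y f = g"
proof -
  have "g \<in> Fm X Y ` hom_set A X Y"
    using assms(3) by (simp only: bij_betw_imp_surj_on[OF F_bij[OF assms(1,2)]])
  then show thesis by (elim imageE) (rule that, simp_all)
qed

text \<open>Linearity is available for combinations r f + f'; with r = 1 and zero arguments it gives
  x = x + x, as the scalar (1, 0) is the unit of the dual numbers.\<close>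

lemma F_zero:
  assumes "X \<in> obs A" "Y \<in> obs A"
  shows "Fm X Y \<zero>\<^bsub>mor A X Y\<^esub> = \<zero>\<^bsub>mor B (Fo X) (Fo Y)\<^esub>"
proof -
  let ?z = "\<zero>\<^bsub>mor A X Y\<^esub>"
  interpret abelian_group "mor B (Fo X) (Fo Y)" using assms B.hom_group by simp
  have add: "Fm X Y (r \<odot>\<^bsub>mor A X Y\<^esub> f \<oplus>\<^bsub>mor A X Y\<^esub> f')
      = (r, \<zero>\<^bsub>k\<^esub>) \<odot>\<^bsub>mor B (Fo X) (Fo Y)\<^esub> Fm X Y f \<oplus>\<^bsub>mor B (Fo X) (Fo Y)\<^esub> Fm X Y f'"
    if "r \<in> carrier k" "f \<in> hom_set A X Y" "f' \<in> hom_set A X Y" for r f f'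
    using F assms that
    by (simp add: linear_equivalence_def linear_functor_def reduction_def restrict_scalars_def)
  have "Fm X Y ?z = Fm X Y ?z \<oplus>\<^bsub>mor B (Fo X) (Fo Y)\<^esub> Fm X Y ?z"
    using add[OF A.one_scalar[OF assms(1)], of ?z ?z] assms
      B.smult_one[of "Fo X" "Fo Y" "Fm X Y ?z"] by (simp add: dual_one)
  then show ?thesis using assms by (metis F_closed A.hom_zero add.l_cancel_one')
qed

lemma F_ess_surj:
  assumes "K \<in> obs B" "eps K = \<zero>\<^bsub>mor B K K\<^esub>"
  obtains X f g where "X \<in> obs A" "f \<in> hom_set B (Fo X) K" "g \<in> hom_set B K (Fo X)"
    "cmp B (Fo X) K (Fo X) g f = idn B (Fo X)" "cmp B K (Fo X) K f g = idn B K"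
proof -
  have "K \<in> obs (reduction k B)" using assms by (simp add: reduction_def)
  then obtain X f where X: "X \<in> obs A" and f: "iso_mor (reduction k B) (Fo X) K f"
    using F unfolding linear_equivalence_def by blast
  from f obtain g where "f \<in> hom_set B (Fo X) K" "g \<in> hom_set B K (Fo X)"
    "cmp B (Fo X) K (Fo X) g f = idn B (Fo X)" "cmp B K (Fo X) K f g = idn B K"
    by (auto simp: iso_mor_def reduction_def restrict_scalars_def)
  with X show thesis by (rule that)
qed

lemma G_obs [simp]: "injective_object A E \<Longrightarrow> injective_object B (Go E)"
  using G by (simp add: linear_equivalence_def linear_functor_def linear_deformation_def)

lemma G_bij:
  "\<lbrakk>injective_object A E; injective_object A E'\<rbrakk>
    \<Longrightarrow> bij_betw (Gm E E') (hom_set A E E' \<times> hom_set A E E') (hom_set B (Go E) (Go E'))"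
  using G by (simp add: linear_equivalence_def linear_deformation_def dual_module_def)

lemma G_closed [simp, intro]:
  "\<lbrakk>injective_object A E; injective_object A E'; f \<in> hom_set A E E'; f' \<in> hom_set A E E'\<rbrakk>
    \<Longrightarrow> Gm E E' (f, f') \<in> hom_set B (Go E) (Go E')"
  using bij_betwE[OF G_bij] by simp

lemma G_cmp:
  "\<lbrakk>injective_object A X; injective_object A Y; injective_object A Z;
    g \<in> hom_set A Y Z; g' \<in> hom_set A Y Z; f \<in> hom_set A X Y; f' \<in> hom_set A X Y\<rbrakk>
    \<Longrightarrow> cmp B (Go X) (Go Y) (Go Z) (Gm Y Z (g, g')) (Gm X Y (f, f'))
      = Gm X Z (cmp A X Y Z g f,
          cmp A X Y Z g f' \<oplus>\<^bsub>mor A X Z\<^esub> cmp A X Y Z g' f \<oplus>\<^bsub>mor A X Z\<^esub> \<phi> X [(Z, 0, g), (Y, 0, f)])"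
  using G unfolding linear_equivalence_def linear_functor_def linear_deformation_def
  by (simp add: dual_module_def)

lemma G_idn:
  "injective_object A E \<Longrightarrow>
    Gm E E (idn A E, \<ominus>\<^bsub>mor A E E\<^esub> \<phi> E [(E, 0, idn A E), (E, 0, idn A E)]) = idn B (Go E)"
  using G by (simp add: linear_equivalence_def linear_functor_def linear_deformation_def)

lemma G_eq:
  assumes "Gm X Y (f, f') = Gm X Y (g, g')" "injective_object A X" "injective_object A Y"
    "f \<in> hom_set A X Y" "f' \<in> hom_set A X Y" "g \<in> hom_set A X Y" "g' \<in> hom_set A X Y"
  shows "f = g \<and> f' = g'"
  using bij_betw_imp_inj_on[OF G_bij] assms unfolding inj_on_def by blast

lemma G_full:
  assumes "injective_object A X" "injective_object A Y" "g \<in> hom_set B (Go X) (Go Y)"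
  obtains f f' where "f \<in> hom_set A X Y" "f' \<in> hom_set A X Y" "Gm X Y (f, f') = g"
proof -
  have "g \<in> Gm X Y ` (hom_set A X Y \<times> hom_set A X Y)"
    using assms(3) by (simp only: bij_betw_imp_surj_on[OF G_bij[OF assms(1,2)]])
  then show thesis by (elim imageE SigmaE) (rule that, simp_all)
qed

lemma G_zero:
  assumes "injective_object A X" "injective_object A Y"
  shows "Gm X Y (\<zero>\<^bsub>mor A X Y\<^esub>, \<zero>\<^bsub>mor A X Y\<^esub>) = \<zero>\<^bsub>mor B (Go X) (Go Y)\<^esub>"
proof -
  let ?z = "\<zero>\<^bsub>mor A X Y\<^esub>"
  have ob: "X \<in> obs A" "Y \<in> obs A" using assms by simp_all
  interpret abelian_group "mor B (Go X) (Go Y)" using assms B.hom_group by simp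
  interpret M: module k "mor A X Y" using ob A.hom_module by blast
  have o: "\<one>\<^bsub>dual_numbers k\<^esub> \<in> carrier (dual_numbers k)" using assms B.one_scalar[of "Go X"] by simp
  have "Gm X Y (\<one>\<^bsub>dual_numbers k\<^esub> \<odot>\<^bsub>dual_module (mor A X Y)\<^esub> (?z, ?z) \<oplus>\<^bsub>dual_module (mor A X Y)\<^esub> (?z, ?z))
    = \<one>\<^bsub>dual_numbers k\<^esub> \<odot>\<^bsub>mor B (Go X) (Go Y)\<^esub> Gm X Y (?z, ?z) \<oplus>\<^bsub>mor B (Go X) (Go Y)\<^esub> Gm X Y (?z, ?z)"
    using G assms ob o unfolding linear_equivalence_def linear_functor_def linear_deformation_def
    by (simp add: dual_module_def)
  moreover have "\<one>\<^bsub>dual_numbers k\<^esub> \<odot>\<^bsub>dual_module (mor A X Y)\<^esub> (?z, ?z) \<oplus>\<^bsub>dual_module (mor A X Y)\<^esub> (?z, ?z) = (?z, ?z)"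
    by (simp add: dual_module_def dual_one)
  ultimately have "Gm X Y (?z, ?z) = Gm X Y (?z, ?z) \<oplus>\<^bsub>mor B (Go X) (Go Y)\<^esub> Gm X Y (?z, ?z)"
    using assms ob B.smult_one[of "Go X" "Go Y" "Gm X Y (?z, ?z)"] by simp
  then show ?thesis using assms ob by (metis G_closed A.hom_zero add.l_cancel_one')
qed

lemma G_ess_surj:
  assumes "injective_object B J"
  obtains E f g where "injective_object A E" "f \<in> hom_set B (Go E) J" "g \<in> hom_set B J (Go E)"
    "cmp B (Go E) J (Go E) g f = idn B (Go E)" "cmp B J (Go E) J f g = idn B J"
proof -
  obtain E f where E: "injective_object A E" and f: "iso_mor (Inj B) (Go E) J f"
    using G assms unfolding linear_equivalence_def by (auto simp: linear_deformation_def)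
  from f obtain g where "f \<in> hom_set B (Go E) J" "g \<in> hom_set B J (Go E)"
    "cmp B (Go E) J (Go E) g f = idn B (Go E)" "cmp B J (Go E) J f g = idn B J"
    by (auto simp: iso_mor_def)
  with E show thesis by (rule that)
qed

lemma \<kappa>_closed [simp, intro]: "injective_object A E \<Longrightarrow> \<kappa> E \<in> hom_set B (Fo E) (Go E)"
  using B.is_kernelD(2)[OF \<kappa>] .

lemma \<kappa>_mono: "injective_object A E \<Longrightarrow> mono_mor B (Fo E) (Go E) (\<kappa> E)"
  by (rule B.kernel_mono[OF \<kappa>]) simp_all

lemmas \<phi>_hom [simp, intro] = P.\<phi>_closed[simplified]
lemmas \<phi>_hom_zero_left [simp] = P.\<phi>_zero_left[simplified]
lemmas \<phi>_hom_zero_right [simp] = P.\<phi>_zero_right[simplified]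

text \<open>As \<open>\<epsilon>\<close> squares to zero, a nonzero H has a nonzero kernel K of \<open>\<epsilon>\<close>.  Since K comes from A,
  it has a nonzero map to some \<open>F E \<rightarrow> G E\<close>, which extends to H.\<close>

lemma nonzero_to_injective:
  assumes H: "H \<in> obs B" and nz: "\<not> zero_object B H"
  obtains E m where "injective_object A E" "m \<in> hom_set B H (Go E)" "m \<noteq> \<zero>\<^bsub>mor B H (Go E)\<^esub>"
proof -
  obtain K v where v: "is_kernel B H H (eps H) K v"
    using abB H unfolding abelian_category_def by blast
  note K = B.is_kernelD[OF v]
  have mv: "mono_mor B K H v" by (rule B.kernel_mono[OF v H H]) (simp add: H)
  have K0: "idn B K \<noteq> \<zero>\<^bsub>mor B K K\<^esub>"
  proof
    assume "idn B K = \<zero>\<^bsub>mor B K K\<^esub>"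
    then have z: "zero_object B K" using B.zero_object_iff K by blast
    \<comment> \<open>A zero kernel makes \<epsilon> a monomorphism. Since \<epsilon> squares to
      zero this forces \<epsilon> = 0, and a zero map is a monomorphism only on a zero
      object.\<close>
    have "mono_mor B H H (eps H)"
    proof (rule B.mono_morI[OF H H eps_closed[OF H]])
      fix T s assume T: "T \<in> obs B" "s \<in> hom_set B T H" "cmp B T H H (eps H) s = \<zero>\<^bsub>mor B T H\<^esub>"
      obtain r where r: "r \<in> hom_set B T K" "cmp B T K H v r = s" using B.kernel_factor[OF v T] .
      then have "r = \<zero>\<^bsub>mor B T K\<^esub>" using z T unfolding zero_object_def by blast
      then show "s = \<zero>\<^bsub>mor B T H\<^esub>" using r K T H by simp
    qed
    from B.mono_mor_zero[OF this H H H eps_closed[OF H] eps_eps[OF H]]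
    have e0: "eps H = \<zero>\<^bsub>mor B H H\<^esub>" .
    have "cmp B H H H (eps H) (idn B H) = \<zero>\<^bsub>mor B H H\<^esub>" using e0 H by simp
    from B.mono_mor_zero[OF \<open>mono_mor B H H (eps H)\<close> H H H B.id_closed[OF H] this]
    show False using nz B.zero_object_iff[OF H] by blast
  qed
  obtain X f g where X: "X \<in> obs A" and f: "f \<in> hom_set B (Fo X) K" and g: "g \<in> hom_set B K (Fo X)"
    and gf: "cmp B (Fo X) K (Fo X) g f = idn B (Fo X)" and fg: "cmp B K (Fo X) K f g = idn B K"
    using F_ess_surj[OF K(1) kernel_eps_reduced[OF v H]] .
  have X0: "idn A X \<noteq> \<zero>\<^bsub>mor A X X\<^esub>"
  proof
    assume "idn A X = \<zero>\<^bsub>mor A X X\<^esub>"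
    then have i: "idn B (Fo X) = \<zero>\<^bsub>mor B (Fo X) (Fo X)\<^esub>" using F_idn[OF X] F_zero[OF X X] by simp
    have "g = cmp B K (Fo X) (Fo X) (idn B (Fo X)) g" using g K X by simp
    also have "\<dots> = \<zero>\<^bsub>mor B K (Fo X)\<^esub>" unfolding i using g K X by simp
    finally have "idn B K = \<zero>\<^bsub>mor B K K\<^esub>" using fg f K X by simp
    then show False using K0 by simp
  qed
  obtain E m where E: "injective_object A E" and m: "mono_mor A X E m"
    using injA X unfolding enough_injectives_def by blast
  have E': "E \<in> obs A" "Go E \<in> obs B" using E by simp_all
  have mh: "m \<in> hom_set A X E" using m by (simp add: mono_mor_def)
  have m0: "m \<noteq> \<zero>\<^bsub>mor A X E\<^esub>"
  proof
    assume "m = \<zero>\<^bsub>mor A X E\<^esub>"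
    then have "cmp A X X E m (idn A X) = \<zero>\<^bsub>mor A X E\<^esub>" using X E' mh by simp
    from A.mono_mor_zero[OF m X E'(1) X A.id_closed[OF X] this] show False using X0 by simp
  qed
  have Fm0: "Fm X E m \<noteq> \<zero>\<^bsub>mor B (Fo X) (Fo E)\<^esub>"
    using F_eq[OF _ X E'(1) mh A.hom_zero[OF X E'(1)]] F_zero[OF X E'(1)] m0 by auto
  let ?c = "cmp B (Fo X) (Fo E) (Go E) (\<kappa> E) (Fm X E m)"
  have c: "?c \<in> hom_set B (Fo X) (Go E)" using X E E' mh by simp
  have c0: "?c \<noteq> \<zero>\<^bsub>mor B (Fo X) (Go E)\<^esub>"
    using B.mono_mor_zero[OF \<kappa>_mono[OF E] _ _ _ F_closed[OF X E'(1) mh]] Fm0 X E' by auto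
  let ?l = "cmp B K (Fo X) (Go E) ?c g"
  have l: "?l \<in> hom_set B K (Go E)" using c g K X E' by simp
  obtain m' where m': "m' \<in> hom_set B H (Go E)" "cmp B K H (Go E) m' v = ?l"
    using B.injective_extend[OF G_obs[OF E] K(1) H mv l] .
  have "m' \<noteq> \<zero>\<^bsub>mor B H (Go E)\<^esub>"
  proof
    assume "m' = \<zero>\<^bsub>mor B H (Go E)\<^esub>"
    then have l0: "?l = \<zero>\<^bsub>mor B K (Go E)\<^esub>" using m'(2) K H E' by simp
    \<comment> \<open>Inserting the identity as gf recovers \<open>?c\<close> from the composite
      with g, which would be zero.\<close>
    have "?c = cmp B (Fo X) (Fo X) (Go E) ?c (cmp B (Fo X) K (Fo X) g f)"
      unfolding gf using c X E' by simp
    also have "\<dots> = cmp B (Fo X) K (Go E) ?l f"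
      by (rule B.cmp_assoc[symmetric]) (use c f g K X E' in simp_all)
    also have "\<dots> = \<zero>\<^bsub>mor B (Fo X) (Go E)\<^esub>" unfolding l0 using f K X E' by simp
    finally show False using c0 by simp
  qed
  with E m'(1) show thesis by (rule that)
qed

section \<open>From a solution h to a deformation of the complex\<close>

definition deformed :: "('o, 'm) cx \<Rightarrow> (int \<Rightarrow> 'm) \<Rightarrow> ('p, 'n) cx" where
  "deformed C h = \<lparr>obj = (\<lambda>n. Go (obj C n)), dif = (\<lambda>n. Gm (obj C n) (obj C (n + 1)) (dif C n, h n))\<rparr>"

lemma deformed_simps [simp]:
  "obj (deformed C h) n = Go (obj C n)"
  "dif (deformed C h) n = Gm (obj C n) (obj C (n + 1)) (dif C n, h n)"
  by (simp_all add: deformed_def)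

lemma Inj_complexesD:
  assumes "C \<in> complexes (Inj A)"
  shows "injective_object A (obj C n)" "dif C n \<in> hom_set A (obj C n) (obj C (n + 1))"
    "cmp A (obj C n) (obj C (n + 1)) (obj C (n + 2)) (dif C (n + 1)) (dif C n)
       = \<zero>\<^bsub>mor A (obj C n) (obj C (n + 2))\<^esub>"
  using I.complexesD[OF assms, of n] by simp_all

lemma Inj_com_homD:
  assumes "h \<in> carrier (com_hom (Inj A) C C 1)"
  shows "h n \<in> hom_set A (obj C n) (obj C (n + 1))"
  using I.com_homD[OF assms, of n] by simp

lemma dif_Suc:
  assumes "C \<in> complexes (Inj A)"
  shows "dif C (n + 1) \<in> hom_set A (obj C (n + 1)) (obj C (n + 2))"
  using Inj_complexesD(2)[OF assms, of "n + 1"] by (simp add: add.commute)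

lemma com_hom_Suc:
  assumes "h \<in> carrier (com_hom (Inj A) C C 1)"
  shows "h (n + 1) \<in> hom_set A (obj C (n + 1)) (obj C (n + 2))"
  using Inj_com_homD[OF assms, of "n + 1"] by (simp add: add.commute)

text \<open>In \<open>m + \<phi>\<epsilon>\<close> the square of \<open>\<delta> + h\<epsilon>\<close> is \<open>(\<phi>(\<delta>, \<delta>) + dh)\<epsilon>\<close>.\<close>

lemma deformed_square:
  assumes C: "C \<in> complexes (Inj A)" and h: "h \<in> carrier (com_hom (Inj A) C C 1)"
  shows "(\<forall>n. cmp B (Go (obj C n)) (Go (obj C (n + 1))) (Go (obj C (n + 2)))
      (Gm (obj C (n + 1)) (obj C (n + 2)) (dif C (n + 1), h (n + 1)))
      (Gm (obj C n) (obj C (n + 1)) (dif C n, h n)) = \<zero>\<^bsub>mor B (Go (obj C n)) (Go (obj C (n + 2)))\<^esub>)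
    \<longleftrightarrow> com_d (Inj A) C C 1 h = \<ominus>\<^bsub>com_hom (Inj A) C C 2\<^esub> obstruction_cocycle A \<phi> C"
proof -
  note dC = Inj_complexesD[OF C] dif_Suc[OF C] and hC = Inj_com_homD[OF h] com_hom_Suc[OF h]
  let ?X = "\<lambda>n. obj C n" and ?Y = "\<lambda>n. obj C (n + 1)" and ?Z = "\<lambda>n. obj C (n + 2)"
  let ?o = "\<lambda>n. \<phi> (?X n) [(?Z n, 0, dif C (n + 1)), (?Y n, 0, dif C n)]"
  let ?d = "\<lambda>n. cmp A (?X n) (?Y n) (?Z n) (dif C (n + 1)) (h n)
    \<oplus>\<^bsub>mor A (?X n) (?Z n)\<^esub> cmp A (?X n) (?Y n) (?Z n) (h (n + 1)) (dif C n)"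
  have "cmp B (Go (?X n)) (Go (?Y n)) (Go (?Z n)) (Gm (?Y n) (?Z n) (dif C (n + 1), h (n + 1)))
      (Gm (?X n) (?Y n) (dif C n, h n)) = \<zero>\<^bsub>mor B (Go (?X n)) (Go (?Z n))\<^esub>
    \<longleftrightarrow> com_d (Inj A) C C 1 h n = (\<ominus>\<^bsub>com_hom (Inj A) C C 2\<^esub> obstruction_cocycle A \<phi> C) n" for n
  proof -
    interpret abelian_group "mor A (?X n) (?Z n)" using dC A.hom_group by simp
    have cl: "?o n \<in> hom_set A (?X n) (?Z n)" "?d n \<in> hom_set A (?X n) (?Z n)"
      "cmp A (?X n) (?Y n) (?Z n) (h (n + 1)) (dif C n) \<in> hom_set A (?X n) (?Z n)"
      using dC hC by simp_all
    have "cmp B (Go (?X n)) (Go (?Y n)) (Go (?Z n)) (Gm (?Y n) (?Z n) (dif C (n + 1), h (n + 1)))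
      (Gm (?X n) (?Y n) (dif C n, h n))
      = Gm (?X n) (?Z n) (\<zero>\<^bsub>mor A (?X n) (?Z n)\<^esub>, ?d n \<oplus>\<^bsub>mor A (?X n) (?Z n)\<^esub> ?o n)"
      using G_cmp[OF dC(1) dC(1) dC(1) dC(4) hC(2) dC(2) hC(1)] dC(3) by simp
    then have "cmp B (Go (?X n)) (Go (?Y n)) (Go (?Z n)) (Gm (?Y n) (?Z n) (dif C (n + 1), h (n + 1)))
      (Gm (?X n) (?Y n) (dif C n, h n)) = \<zero>\<^bsub>mor B (Go (?X n)) (Go (?Z n))\<^esub>
      \<longleftrightarrow> ?d n \<oplus>\<^bsub>mor A (?X n) (?Z n)\<^esub> ?o n = \<zero>\<^bsub>mor A (?X n) (?Z n)\<^esub>"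
      using G_eq[OF _ dC(1)[of n] dC(1)[of "n + 2"], of "\<zero>\<^bsub>mor A (?X n) (?Z n)\<^esub>"
          "?d n \<oplus>\<^bsub>mor A (?X n) (?Z n)\<^esub> ?o n" "\<zero>\<^bsub>mor A (?X n) (?Z n)\<^esub>" "\<zero>\<^bsub>mor A (?X n) (?Z n)\<^esub>"]
        G_zero[OF dC(1)[of n] dC(1)[of "n + 2"]] cl by auto
    also have "\<dots> \<longleftrightarrow> ?d n = \<ominus>\<^bsub>mor A (?X n) (?Z n)\<^esub> ?o n"
      using cl by (metis minus_equality l_neg)
    also have "?d n = com_d (Inj A) C C 1 h n"
      using I.com_d_apply[OF C C h, of n] cl(3) by (simp add: sgn_mult_def minus_eq)
    also have "\<ominus>\<^bsub>mor A (?X n) (?Z n)\<^esub> ?o n = (\<ominus>\<^bsub>com_hom (Inj A) C C 2\<^esub> obstruction_cocycle A \<phi> C) n"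
      unfolding obstruction_cocycle_def P.componentwise_dif I.com_hom_inv[OF C C P.obs_closed[OF C]]
      by (simp add: P.obs_apply)
    finally show ?thesis .
  qed
  then show ?thesis by (simp add: fun_eq_iff)
qed

lemma deformed_complex:
  assumes C: "C \<in> complexes_plus (Inj A)" and h: "h \<in> carrier (com_hom (Inj A) C C 1)"
    and d: "com_d (Inj A) C C 1 h = \<ominus>\<^bsub>com_hom (Inj A) C C 2\<^esub> obstruction_cocycle A \<phi> C"
  shows "deformed C h \<in> complexes_plus (Inj B)" "deformed C h \<in> complexes_plus B"
proof -
  have C': "C \<in> complexes (Inj A)" using C by (simp add: complexes_plus_def)
  note dC = Inj_complexesD[OF C'] dif_Suc[OF C'] and hC = Inj_com_homD[OF h] com_hom_Suc[OF h]
  have e: "n + 1 + 1 = n + (2 :: int)" for n by simp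
  have sq: "cmp B (Go (obj C n)) (Go (obj C (n + 1))) (Go (obj C (n + 2)))
      (Gm (obj C (n + 1)) (obj C (n + 2)) (dif C (n + 1), h (n + 1)))
      (Gm (obj C n) (obj C (n + 1)) (dif C n, h n)) = \<zero>\<^bsub>mor B (Go (obj C n)) (Go (obj C (n + 2)))\<^esub>" for n
    using deformed_square[OF C' h] d by blast
  have cx: "deformed C h \<in> complexes (Inj B)"
    unfolding complexes_def using dC hC sq by (simp add: e)
  obtain N where N: "\<And>n. n < N \<Longrightarrow> zero_object (Inj A) (obj C n)"
    using C by (auto simp: complexes_plus_def)
  \<comment> \<open>Boundedness below passes through G: if the identity of an object is zero, so is
    \<phi> on it, and the identity pair of the linear deformation becomes (0, 0).\<close>
  have z: "idn B (Go (obj C n)) = \<zero>\<^bsub>mor B (Go (obj C n)) (Go (obj C n))\<^esub>" if "n < N" for n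
  proof -
    have "idn A (obj C n) = \<zero>\<^bsub>mor A (obj C n) (obj C n)\<^esub>"
      using N[OF that] I.zero_object_iff[of "obj C n"] dC by simp
    then show ?thesis using G_idn[OF dC(1)[of n]] G_zero[OF dC(1) dC(1), of n n] dC by simp
  qed
  interpret IB: lincat "dual_numbers k" "Inj B" by (rule B.Inj_lincat)
  have "zero_object (Inj B) (Go (obj C n))" "zero_object B (Go (obj C n))" if "n < N" for n
    using z[OF that] IB.zero_object_iff[of "Go (obj C n)"] B.zero_object_iff[of "Go (obj C n)"]
      dC(1)[of n] by simp_all
  then have z': "\<exists>N. \<forall>n<N. zero_object (Inj B) (obj (deformed C h) n)"
    "\<exists>N. \<forall>n<N. zero_object B (obj (deformed C h) n)" by auto
  show "deformed C h \<in> complexes_plus (Inj B)"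
    unfolding complexes_plus_def mem_Collect_eq using cx z'(1) by (rule conjI)
  have cx': "deformed C h \<in> complexes B" using cx by (rule complexes_Inj)
  show "deformed C h \<in> complexes_plus B"
    unfolding complexes_plus_def mem_Collect_eq using cx' z'(2) by (rule conjI)
qed

text \<open>The lift consists of injectives, so it is its own injective resolution; K = C and v =
  \<kappa> then satisfy the definition.\<close>

lemma deformed_deforms_to:
  assumes C: "C \<in> complexes_plus (Inj A)" and h: "h \<in> carrier (com_hom (Inj A) C C 1)"
    and d: "com_d (Inj A) C C 1 h = \<ominus>\<^bsub>com_hom (Inj A) C C 2\<^esub> obstruction_cocycle A \<phi> C"
  shows "deforms_to k A B Fo Fm C (deformed C h)"
proof -
  have C': "C \<in> complexes (Inj A)" using C by (simp add: complexes_plus_def)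
  note dC = Inj_complexesD[OF C']
  have J: "deformed C h \<in> complexes B" using deformed_complex[OF assms] by (simp add: complexes_plus_def)
  show ?thesis
    unfolding deforms_to_def
  proof (intro bexI conjI exI allI)
    show "quasi_iso B (deformed C h) (deformed C h) (com_idn B (deformed C h))"
      by (rule B.quasi_iso_refl[OF J])
    show "deformed C h \<in> complexes_plus (Inj B)" by (rule deformed_complex[OF assms])
    show "C \<in> complexes_plus (Inj A)" by fact
    show "homotopy_equivalent (Inj A) C C" by (rule I.homotopy_equivalent_refl[OF C'])
    fix n
    show "is_kernel B (obj (deformed C h) n) (obj (deformed C h) n) (eps (obj (deformed C h) n))
        (Fo (obj C n)) (\<kappa> (obj C n))"
      using \<kappa>[OF dC(1)] by simp
    show "cmp B (Fo (obj C n)) (obj (deformed C h) n) (obj (deformed C h) (n + 1))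
        (dif (deformed C h) n) (\<kappa> (obj C n))
      = cmp B (Fo (obj C n)) (Fo (obj C (n + 1))) (obj (deformed C h) (n + 1)) (\<kappa> (obj C (n + 1)))
          (Fm (obj C n) (obj C (n + 1)) (dif C n))"
      using \<kappa>_natural[OF dC(1) dC(1) dC(2) Inj_com_homD[OF h]] by simp
  qed
qed

text \<open>Exactness is tested by maps to the objects \<open>G E\<close>; extended to \<open>J\<^sup>n\<close>, such a map is a pair
  \<open>a + a'\<epsilon>\<close>, which factors through the differential because C is exact in degree n.\<close>

lemma deformed_acyclic:
  assumes C: "C \<in> complexes (Inj A)" and h: "h \<in> carrier (com_hom (Inj A) C C 1)"
    and d: "com_d (Inj A) C C 1 h = \<ominus>\<^bsub>com_hom (Inj A) C C 2\<^esub> obstruction_cocycle A \<phi> C"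
    and ac: "\<And>Z u H q. is_cohomology A C n Z u H q \<Longrightarrow> zero_object A H"
    and coh: "is_cohomology B (deformed C h) n Z u H q"
  shows "zero_object B H"
proof (rule ccontr)
  assume nz: "\<not> zero_object B H"
  note dC = Inj_complexesD[OF C] and hC = Inj_com_homD[OF h]
  have CA: "C \<in> complexes A" by (rule complexes_Inj[OF C])
  let ?X = "obj C (n - 1)" and ?Y = "obj C n" and ?Z = "obj C (n + 1)"
  let ?D = "dif C (n - 1)" and ?h = "h (n - 1)"
  have D: "?D \<in> hom_set A ?X ?Y" "?h \<in> hom_set A ?X ?Y" using dC(2)[of "n - 1"] hC[of "n - 1"] by simp_all
  have dD: "cmp A ?X ?Y ?Z (dif C n) ?D = \<zero>\<^bsub>mor A ?X ?Z\<^esub>"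
    using A.dif_dif[OF CA, of n "n - 1" "n + 1"] by simp
  have ob: "?X \<in> obs A" "?Y \<in> obs A" "?Z \<in> obs A" "Go ?X \<in> obs B" "Go ?Y \<in> obs B" "Go ?Z \<in> obs B"
    using dC(1) by simp_all
  let ?dB = "Gm ?X ?Y (?D, ?h)" and ?dB' = "Gm ?Y ?Z (dif C n, h n)"
  obtain e where u: "is_kernel B (Go ?Y) (Go ?Z) ?dB' Z u"
    and e: "e \<in> hom_set B (Go ?X) Z" "cmp B (Go ?X) Z (Go ?Y) u e = ?dB"
    and q: "is_cokernel B (Go ?X) Z e H q"
    using coh unfolding is_cohomology_def by auto
  have dB: "?dB \<in> hom_set B (Go ?X) (Go ?Y)" "?dB' \<in> hom_set B (Go ?Y) (Go ?Z)"
    using dC D hC by simp_all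
  note U = B.is_kernelD[OF u] and Q = B.is_cokernelD[OF q]
  \<comment> \<open>A nonzero H would have a nonzero map m to some \<open>Go E\<close>. The
    contradiction consists in showing that mq vanishes on the cycles Z.\<close>
  obtain E m where E: "injective_object A E" and m: "m \<in> hom_set B H (Go E)" "m \<noteq> \<zero>\<^bsub>mor B H (Go E)\<^esub>"
    using nonzero_to_injective[OF Q(1) nz] .
  have E': "E \<in> obs A" "Go E \<in> obs B" using E by simp_all
  let ?t = "cmp B Z H (Go E) m q"
  have t: "?t \<in> hom_set B Z (Go E)" using m U Q E' by simp
  have t0: "?t \<noteq> \<zero>\<^bsub>mor B Z (Go E)\<^esub>"
    using B.epi_mor_zero[OF B.cokernel_epi[OF q ob(4) U(1) e(1)] U(1) Q(1) E'(2) m(1)] m(2) by blast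
  have te: "cmp B (Go ?X) Z (Go E) ?t e = \<zero>\<^bsub>mor B (Go ?X) (Go E)\<^esub>"
  proof -
    have "cmp B (Go ?X) Z (Go E) ?t e = cmp B (Go ?X) H (Go E) m (cmp B (Go ?X) Z H q e)"
      by (rule B.cmp_assoc) (use ob U Q E' m e in simp_all)
    then show ?thesis unfolding Q(3) using ob Q E' m by simp
  qed
  obtain t' where t': "t' \<in> hom_set B (Go ?Y) (Go E)" "cmp B Z (Go ?Y) (Go E) t' u = ?t"
    using B.injective_extend[OF G_obs[OF E] U(1) ob(5) B.kernel_mono[OF u ob(5,6) dB(2)] t] .
  obtain a a' where a: "a \<in> hom_set A ?Y E" "a' \<in> hom_set A ?Y E" and G: "Gm ?Y E (a, a') = t'"
    using G_full[OF dC(1) E t'(1)] .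
  interpret XE: abelian_group "mor A ?X E" using ob E' A.hom_group by blast
  interpret YE: abelian_group "mor A ?Y E" using ob E' A.hom_group by blast
  interpret XZ: abelian_group "mor A ?X ?Z" using ob A.hom_group by blast
  have "cmp B (Go ?X) (Go ?Y) (Go E) t' ?dB = cmp B (Go ?X) Z (Go E) ?t e"
    unfolding e(2)[symmetric] t'(2)[symmetric]
    by (rule B.cmp_assoc[symmetric]) (use ob U E' e t' in simp_all)
  \<comment> \<open>G is faithful on pairs, so the vanishing of the composite with the incoming
    differential splits into an equation for a and one for a'.\<close>
  then have "Gm ?X E (cmp A ?X ?Y E a ?D, (cmp A ?X ?Y E a ?h \<oplus>\<^bsub>mor A ?X E\<^esub> cmp A ?X ?Y E a' ?D)
      \<oplus>\<^bsub>mor A ?X E\<^esub> \<phi> ?X [(E, 0, a), (?Y, 0, ?D)])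
    = Gm ?X E (\<zero>\<^bsub>mor A ?X E\<^esub>, \<zero>\<^bsub>mor A ?X E\<^esub>)"
    unfolding te G_zero[OF dC(1) E] G[symmetric] G_cmp[OF dC(1) dC(1) E a D] .
  from G_eq[OF this dC(1) E]
  have aD: "cmp A ?X ?Y E a ?D = \<zero>\<^bsub>mor A ?X E\<^esub>"
    and a'D: "(cmp A ?X ?Y E a ?h \<oplus>\<^bsub>mor A ?X E\<^esub> cmp A ?X ?Y E a' ?D)
      \<oplus>\<^bsub>mor A ?X E\<^esub> \<phi> ?X [(E, 0, a), (?Y, 0, ?D)] = \<zero>\<^bsub>mor A ?X E\<^esub>"
    using a D E E' ob dC(1) by simp_all
  \<comment> \<open>First use of exactness of C, for the part of order zero.\<close>
  obtain b where b: "b \<in> hom_set A ?Z E" "cmp A ?Y ?Z E b (dif C n) = a"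
    using A.acyclic_factor[OF abA CA ac E a(1) aD] .
  \<comment> \<open>The composite of b + b2 \<epsilon> with \<delta> + h\<epsilon> has
    \<epsilon>-component bh + b2 \<delta> + \<phi>(b, \<delta>). For it to equal a', the remainder
    \<open>?a\<close> has to be b2 \<delta>.\<close>
  let ?bh = "cmp A ?Y ?Z E b (h n)" and ?f = "\<phi> ?Y [(E, 0, b), (?Z, 0, dif C n)]"
  let ?a = "(a' \<ominus>\<^bsub>mor A ?Y E\<^esub> ?bh) \<ominus>\<^bsub>mor A ?Y E\<^esub> ?f"
  have bf: "?bh \<in> hom_set A ?Y E" "?f \<in> hom_set A ?Y E" using b dC hC ob E E' by simp_all
  have a2: "?a \<in> hom_set A ?Y E" using a bf by simp
  \<comment> \<open>The remainder may be factored only if it kills the incoming differential. This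
    is where the equation for h and the cocycle identity for (b, \<delta>, \<delta>) enter.\<close>
  have aD2: "cmp A ?X ?Y E ?a ?D = \<zero>\<^bsub>mor A ?X E\<^esub>"
  proof -
    let ?o = "\<phi> ?X [(?Z, 0, dif C n), (?Y, 0, ?D)]"
    have o: "?o \<in> hom_set A ?X ?Z" using dC D by simp
    have dh: "cmp A ?X ?Y ?Z (dif C n) ?h \<oplus>\<^bsub>mor A ?X ?Z\<^esub> cmp A ?X ?Y ?Z (h n) ?D
        = \<ominus>\<^bsub>mor A ?X ?Z\<^esub> ?o"
    proof -
      have c: "cmp A ?X ?Y ?Z (h n) ?D \<in> hom_set A ?X ?Z" using ob D hC by simp
      have e2: "n - 1 + 2 = n + 1" "n - 1 + 1 = n" by simp_all
      have "com_d (Inj A) C C 1 h (n - 1) = cmp A ?X ?Y ?Z (dif C n) ?h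
          \<oplus>\<^bsub>mor A ?X ?Z\<^esub> cmp A ?X ?Y ?Z (h n) ?D"
        using I.com_d_apply[OF C C h, of "n - 1"] c by (simp add: sgn_mult_def XZ.minus_eq e2)
      moreover have "(\<ominus>\<^bsub>com_hom (Inj A) C C 2\<^esub> obstruction_cocycle A \<phi> C) (n - 1)
          = \<ominus>\<^bsub>mor A ?X ?Z\<^esub> ?o"
        unfolding obstruction_cocycle_def P.componentwise_dif I.com_hom_inv[OF C C P.obs_closed[OF C]]
        by (simp add: P.obs_apply e2)
      ultimately show ?thesis using d by simp
    qed
    have 2: "cmp A ?X ?Y E a ?h \<oplus>\<^bsub>mor A ?X E\<^esub> cmp A ?X ?Y E ?bh ?D
        = \<ominus>\<^bsub>mor A ?X E\<^esub> cmp A ?X ?Z E b ?o"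
    proof -
      have "cmp A ?X ?Y E a ?h = cmp A ?X ?Z E b (cmp A ?X ?Y ?Z (dif C n) ?h)"
        unfolding b(2)[symmetric] by (rule A.cmp_assoc) (use ob E' b dC D in simp_all)
      moreover have "cmp A ?X ?Y E ?bh ?D = cmp A ?X ?Z E b (cmp A ?X ?Y ?Z (h n) ?D)"
        by (rule A.cmp_assoc) (use ob E' b hC D in simp_all)
      moreover have "cmp A ?X ?Z E b (cmp A ?X ?Y ?Z (dif C n) ?h) \<oplus>\<^bsub>mor A ?X E\<^esub>
          cmp A ?X ?Z E b (cmp A ?X ?Y ?Z (h n) ?D)
        = cmp A ?X ?Z E b (\<ominus>\<^bsub>mor A ?X ?Z\<^esub> ?o)"
        unfolding dh[symmetric]
        by (rule A.cmp_add_right[symmetric]) (use ob E' b dC hC D in simp_all)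
      moreover have "cmp A ?X ?Z E b (\<ominus>\<^bsub>mor A ?X ?Z\<^esub> ?o) = \<ominus>\<^bsub>mor A ?X E\<^esub> cmp A ?X ?Z E b ?o"
        by (rule A.cmp_inv_right) (use ob E' b o in simp_all)
      ultimately show ?thesis by simp
    qed
    have 3: "cmp A ?X ?Z E b ?o = \<phi> ?X [(E, 0, a), (?Y, 0, ?D)] \<oplus>\<^bsub>mor A ?X E\<^esub> cmp A ?X ?Y E ?f ?D"
    proof -
      have "cmp A ?X ?Z E b ?o \<oplus>\<^bsub>mor A ?X E\<^esub> \<phi> ?X [(E, 0, b), (?Z, 0, cmp A ?X ?Y ?Z (dif C n) ?D)]
        = \<phi> ?X [(E, 0, cmp A ?Y ?Z E b (dif C n)), (?Y, 0, ?D)] \<oplus>\<^bsub>mor A ?X E\<^esub> cmp A ?X ?Y E ?f ?D"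
        using I.cocycle_identity[OF \<phi>, of ?X ?Y ?Z E b "dif C n" ?D] E b D dC by simp
      then show ?thesis unfolding dD b(2) using E b o dC ob E' by simp
    qed
    have "cmp A ?X ?Y E ?a ?D = (cmp A ?X ?Y E a' ?D \<ominus>\<^bsub>mor A ?X E\<^esub> cmp A ?X ?Y E ?bh ?D)
        \<ominus>\<^bsub>mor A ?X E\<^esub> cmp A ?X ?Y E ?f ?D"
      using ob E' a bf D by (simp add: A.cmp_minus_left)
    also have "\<dots> = \<zero>\<^bsub>mor A ?X E\<^esub>"
    proof (rule XE.three_relations[OF _ _ _ _ _ _ a'D 2 3])
      show "cmp A ?X ?Y E a' ?D \<in> hom_set A ?X E" "cmp A ?X ?Y E ?bh ?D \<in> hom_set A ?X E"
        "cmp A ?X ?Y E ?f ?D \<in> hom_set A ?X E" "cmp A ?X ?Y E a ?h \<in> hom_set A ?X E"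
        by (rule A.cmp_closed[OF ob(1,2) E'(1)]; fact)+
      show "cmp A ?X ?Z E b ?o \<in> hom_set A ?X E" by (rule A.cmp_closed[OF ob(1,3) E'(1) b(1) o])
      show "\<phi> ?X [(E, 0, a), (?Y, 0, ?D)] \<in> hom_set A ?X E" using E D a dC(1) by simp
    qed
    finally show ?thesis .
  qed
  \<comment> \<open>Second use of exactness of C, now for the \<epsilon>-part.\<close>
  obtain b2 where b2: "b2 \<in> hom_set A ?Z E" "cmp A ?Y ?Z E b2 (dif C n) = ?a"
    using A.acyclic_factor[OF abA CA ac E a2 aD2] .
  have "(?bh \<oplus>\<^bsub>mor A ?Y E\<^esub> ?a) \<oplus>\<^bsub>mor A ?Y E\<^esub> ?f = a'"
  proof -
    have "(?bh \<oplus>\<^bsub>mor A ?Y E\<^esub> ?a) \<oplus>\<^bsub>mor A ?Y E\<^esub> ?f = ?bh \<oplus>\<^bsub>mor A ?Y E\<^esub> (?f \<oplus>\<^bsub>mor A ?Y E\<^esub> ?a)"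
      using bf a2 by (simp add: YE.a_ac)
    also have "?f \<oplus>\<^bsub>mor A ?Y E\<^esub> ?a = a' \<ominus>\<^bsub>mor A ?Y E\<^esub> ?bh"
      using bf a(2) YE.minus_eq_iff_add[of "a' \<ominus>\<^bsub>mor A ?Y E\<^esub> ?bh" ?f ?a] a2 by (simp add: YE.a_comm)
    also have "?bh \<oplus>\<^bsub>mor A ?Y E\<^esub> (a' \<ominus>\<^bsub>mor A ?Y E\<^esub> ?bh) = a'"
      using bf a(2) YE.minus_eq_iff_add[of a' ?bh "a' \<ominus>\<^bsub>mor A ?Y E\<^esub> ?bh"] by (simp add: YE.a_comm)
    finally show ?thesis .
  qed
  then have "cmp B (Go ?Y) (Go ?Z) (Go E) (Gm ?Z E (b, b2)) ?dB' = t'"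
    unfolding G_cmp[OF dC(1) dC(1) E b(1) b2(1) dC(2) hC] b(2) b2(2) G[symmetric] by simp
  \<comment> \<open>The extension t' factors through the outgoing differential, which is zero on the
    cycles; so t = 0.\<close>
  then have "?t = cmp B Z (Go ?Y) (Go E) (cmp B (Go ?Y) (Go ?Z) (Go E) (Gm ?Z E (b, b2)) ?dB') u"
    using t'(2) by simp
  also have "\<dots> = cmp B Z (Go ?Z) (Go E) (Gm ?Z E (b, b2)) (cmp B Z (Go ?Y) (Go ?Z) ?dB' u)"
    by (rule B.cmp_assoc) (use ob E E' b b2 dB U dC in simp_all)
  also have "\<dots> = \<zero>\<^bsub>mor B Z (Go E)\<^esub>"
    unfolding U(3) using ob E E' b b2 dC U by simp
  finally show False using t0 by simp
qed

section \<open>From a deformation of the complex to a solution h\<close>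

lemma G_split:
  assumes X: "injective_object A X" and Y: "injective_object A Y"
    and f: "f \<in> hom_set A X Y" and g: "g \<in> hom_set A Y X"
    and gf: "cmp A X Y X g f = idn A X" and fg: "cmp A Y X Y f g = idn A Y"
  obtains r where "r \<in> hom_set B (Go Y) (Go X)"
    "cmp B (Go X) (Go Y) (Go X) r (Gm X Y (f, \<zero>\<^bsub>mor A X Y\<^esub>)) = idn B (Go X)"
    "cmp B (Go Y) (Go X) (Go Y) (Gm X Y (f, \<zero>\<^bsub>mor A X Y\<^esub>)) r = idn B (Go Y)"
proof -
  have ob: "X \<in> obs A" "Y \<in> obs A" using X Y by simp_all
  interpret XX: abelian_group "mor A X X" using ob A.hom_group by blast
  interpret YY: abelian_group "mor A Y Y" using ob A.hom_group by blast
  let ?F = "Gm X Y (f, \<zero>\<^bsub>mor A X Y\<^esub>)"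
  let ?i = "\<lambda>X. \<ominus>\<^bsub>mor A X X\<^esub> \<phi> X [(X, 0, idn A X), (X, 0, idn A X)]"
  let ?p = "\<phi> X [(X, 0, g), (Y, 0, f)]" and ?q = "\<phi> Y [(Y, 0, f), (X, 0, g)]"
  \<comment> \<open>A lift g + c\<epsilon> is inverse to f + 0\<epsilon> only if its \<epsilon>-part
    compensates \<phi>(g, f), or \<phi>(f, g) on the other side, and also produces the correction
    \<open>?i\<close> in the identities of the linear deformation.\<close>
  let ?x = "?i X \<ominus>\<^bsub>mor A X X\<^esub> ?p" and ?y = "?i Y \<ominus>\<^bsub>mor A Y Y\<^esub> ?q"
  have pq: "?p \<in> hom_set A X X" "?q \<in> hom_set A Y Y" and i: "?i X \<in> hom_set A X X" "?i Y \<in> hom_set A Y Y"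
    using X Y ob f g by simp_all
  have xy: "?x \<in> hom_set A X X" "?y \<in> hom_set A Y Y" using pq i by simp_all
  \<comment> \<open>Since g and f are inverse to each other, these solve cf = x and fc' = y.\<close>
  let ?c = "cmp A Y X X ?x g" and ?c' = "cmp A Y Y X g ?y"
  have cc: "?c \<in> hom_set A Y X" "?c' \<in> hom_set A Y X" using ob g xy by simp_all
  have "cmp A X Y X ?c f = cmp A X X X ?x (cmp A X Y X g f)"
    by (rule A.cmp_assoc) (use ob f g xy in simp_all)
  then have cf: "cmp A X Y X ?c f = ?x" unfolding gf using ob xy by simp
  have "cmp A Y X Y f ?c' = cmp A Y Y Y (cmp A Y X Y f g) ?y"
    by (rule A.cmp_assoc[symmetric]) (use ob f g xy in simp_all)
  then have fc: "cmp A Y X Y f ?c' = ?y" unfolding fg using ob xy by simp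
  have "?x \<oplus>\<^bsub>mor A X X\<^esub> ?p = ?i X" using pq i xy XX.minus_eq_iff_add[of "?i X" ?p ?x] by simp
  then have l: "cmp B (Go X) (Go Y) (Go X) (Gm Y X (g, ?c)) ?F = idn B (Go X)"
    using G_cmp[OF X Y X g cc(1) f A.hom_zero[OF ob]] X Y ob f g xy gf cf G_idn[OF X] by simp
  have "?y \<oplus>\<^bsub>mor A Y Y\<^esub> ?q = ?i Y" using pq i xy YY.minus_eq_iff_add[of "?i Y" ?q ?y] by simp
  then have r: "cmp B (Go Y) (Go X) (Go Y) ?F (Gm Y X (g, ?c')) = idn B (Go Y)"
    using G_cmp[OF Y X Y f A.hom_zero[OF ob] g cc(2)] X Y ob f g xy fg fc G_idn[OF Y] by simp
  \<comment> \<open>A left and a right inverse of one morphism agree, so c and c' need no direct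
    comparison.\<close>
  have "Gm Y X (g, ?c) = Gm Y X (g, ?c')"
    by (rule B.two_sided_inverse[OF _ _ _ _ _ l r]) (use X Y ob f g cc in simp_all)
  then show thesis using that[of "Gm Y X (g, ?c)"] l r X Y g cc by simp
qed

text \<open>J is isomorphic to some \<open>Go E\<close>. Isomorphic objects have isomorphic kernels
  of \<epsilon>, whence \<open>Fo K\<close> and \<open>Fo E\<close> are isomorphic; F is fully
  faithful, so the isomorphism comes from A, and \<open>G_split\<close> lifts it back to
  \<open>Go K\<close> and \<open>Go E\<close> over the given maps.\<close>

lemma lift_iso:
  assumes J: "injective_object B J" and K: "injective_object A K"
    and v: "is_kernel B J J (eps J) (Fo K) v"
  obtains \<theta> \<theta>' where "\<theta> \<in> hom_set B (Go K) J" "\<theta>' \<in> hom_set B J (Go K)"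
    "cmp B (Go K) J (Go K) \<theta>' \<theta> = idn B (Go K)" "cmp B J (Go K) J \<theta> \<theta>' = idn B J"
    "cmp B (Fo K) (Go K) J \<theta> (\<kappa> K) = v"
proof -
  obtain E \<alpha> \<beta> where E: "injective_object A E" and \<alpha>: "\<alpha> \<in> hom_set B (Go E) J"
    and \<beta>: "\<beta> \<in> hom_set B J (Go E)" and \<beta>\<alpha>: "cmp B (Go E) J (Go E) \<beta> \<alpha> = idn B (Go E)"
    and \<alpha>\<beta>: "cmp B J (Go E) J \<alpha> \<beta> = idn B J"
    using G_ess_surj[OF J] .
  have ob: "J \<in> obs B" "K \<in> obs A" "E \<in> obs A" "Fo K \<in> obs B" "Fo E \<in> obs B" "Go K \<in> obs B" "Go E \<in> obs B"
    using J K E by simp_all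
  note V = B.is_kernelD[OF v]
  note \<kappa>E = B.is_kernelD[OF \<kappa>[OF E]]
  have mv: "mono_mor B (Fo K) J v" by (rule B.kernel_mono[OF v ob(1) ob(1)]) (use ob in simp)
  \<comment> \<open>Every morphism commutes with \<epsilon>, so maps killed by \<epsilon> stay
    killed after composition; this makes \<alpha> and \<beta> restrict to the kernels.\<close>
  have factor: "cmp B X Y Y (eps Y) (cmp B X Z Y f g) = \<zero>\<^bsub>mor B X Y\<^esub>"
    if "X \<in> obs B" "Y \<in> obs B" "Z \<in> obs B" "f \<in> hom_set B Z Y" "g \<in> hom_set B X Z"
      "cmp B X Z Z (eps Z) g = \<zero>\<^bsub>mor B X Z\<^esub>" for X Y Z f g
  proof -
    have "cmp B X Y Y (eps Y) (cmp B X Z Y f g) = cmp B X Z Y (cmp B Z Y Y (eps Y) f) g"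
      by (rule B.cmp_assoc[symmetric]) (use that in simp_all)
    also have "\<dots> = cmp B X Z Y f (cmp B X Z Z (eps Z) g)"
      unfolding eps_natural[OF that(3,2,4)] by (rule B.cmp_assoc) (use that in simp_all)
    finally show ?thesis using that by simp
  qed
  have bv: "cmp B (Fo K) J (Go E) \<beta> v \<in> hom_set B (Fo K) (Go E)" using ob \<beta> V by simp
  obtain w where w: "w \<in> hom_set B (Fo K) (Fo E)"
    "cmp B (Fo K) (Fo E) (Go E) (\<kappa> E) w = cmp B (Fo K) J (Go E) \<beta> v"
    using B.kernel_factor[OF \<kappa>[OF E] V(1) bv factor[OF V(1) ob(7,1) \<beta> V(2,3)]] .
  have ak: "cmp B (Fo E) (Go E) J \<alpha> (\<kappa> E) \<in> hom_set B (Fo E) J" using ob \<alpha> \<kappa>E by simp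
  obtain w' where w': "w' \<in> hom_set B (Fo E) (Fo K)"
    "cmp B (Fo E) (Fo K) J v w' = cmp B (Fo E) (Go E) J \<alpha> (\<kappa> E)"
    using B.kernel_factor[OF v ob(5) ak factor[OF ob(5,1,7) \<alpha> \<kappa>E(2,3)]] .
  have abv: "cmp B (Fo K) (Go E) J \<alpha> (cmp B (Fo K) J (Go E) \<beta> v) = v"
  proof -
    have "cmp B (Fo K) (Go E) J \<alpha> (cmp B (Fo K) J (Go E) \<beta> v) = cmp B (Fo K) J J (cmp B J (Go E) J \<alpha> \<beta>) v"
      by (rule B.cmp_assoc[symmetric]) (use ob \<alpha> \<beta> V in simp_all)
    then show ?thesis unfolding \<alpha>\<beta> using ob V by simp
  qed
  have bak: "cmp B (Fo E) J (Go E) \<beta> (cmp B (Fo E) (Go E) J \<alpha> (\<kappa> E)) = \<kappa> E"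
  proof -
    have "cmp B (Fo E) J (Go E) \<beta> (cmp B (Fo E) (Go E) J \<alpha> (\<kappa> E))
        = cmp B (Fo E) (Go E) (Go E) (cmp B (Go E) J (Go E) \<beta> \<alpha>) (\<kappa> E)"
      by (rule B.cmp_assoc[symmetric]) (use ob \<alpha> \<beta> \<kappa>E in simp_all)
    then show ?thesis unfolding \<beta>\<alpha> using ob \<kappa>E by simp
  qed
  \<comment> \<open>The composites of w and w' are tested after the monomorphisms v and
    \<open>\<kappa> E\<close>, where they reduce to \<alpha>\<beta> = 1 and \<beta>\<alpha> =
    1.\<close>
  have w'w: "cmp B (Fo K) (Fo E) (Fo K) w' w = idn B (Fo K)"
  proof (rule B.mono_mor_cancel[OF mv ob(4)])
    have "cmp B (Fo K) (Fo K) J v (cmp B (Fo K) (Fo E) (Fo K) w' w)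
        = cmp B (Fo K) (Fo E) J (cmp B (Fo E) (Fo K) J v w') w"
      by (rule B.cmp_assoc[symmetric]) (use ob V w w' in simp_all)
    also have "\<dots> = cmp B (Fo K) (Go E) J \<alpha> (cmp B (Fo K) (Fo E) (Go E) (\<kappa> E) w)"
      unfolding w'(2) by (rule B.cmp_assoc) (use ob \<alpha> \<kappa>E w in simp_all)
    also have "\<dots> = v" unfolding w(2) by (rule abv)
    finally show "cmp B (Fo K) (Fo K) J v (cmp B (Fo K) (Fo E) (Fo K) w' w)
        = cmp B (Fo K) (Fo K) J v (idn B (Fo K))" using ob V by simp
  qed (use ob w w' in simp_all)
  have ww': "cmp B (Fo E) (Fo K) (Fo E) w w' = idn B (Fo E)"
  proof (rule B.mono_mor_cancel[OF \<kappa>_mono[OF E] ob(5)])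
    have "cmp B (Fo E) (Fo E) (Go E) (\<kappa> E) (cmp B (Fo E) (Fo K) (Fo E) w w')
        = cmp B (Fo E) (Fo K) (Go E) (cmp B (Fo K) (Fo E) (Go E) (\<kappa> E) w) w'"
      by (rule B.cmp_assoc[symmetric]) (use ob \<kappa>E w w' in simp_all)
    also have "\<dots> = cmp B (Fo E) J (Go E) \<beta> (cmp B (Fo E) (Fo K) J v w')"
      unfolding w(2) by (rule B.cmp_assoc) (use ob \<beta> V w' in simp_all)
    also have "\<dots> = \<kappa> E" unfolding w'(2) by (rule bak)
    finally show "cmp B (Fo E) (Fo E) (Go E) (\<kappa> E) (cmp B (Fo E) (Fo K) (Fo E) w w')
        = cmp B (Fo E) (Fo E) (Go E) (\<kappa> E) (idn B (Fo E))" using ob \<kappa>E by simp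
  qed (use ob w w' in simp_all)
  obtain b where b: "b \<in> hom_set A K E" "Fm K E b = w" using F_full[OF ob(2,3) w(1)] .
  obtain b' where b': "b' \<in> hom_set A E K" "Fm E K b' = w'" using F_full[OF ob(3,2) w'(1)] .
  have b'b: "cmp A K E K b' b = idn A K"
    by (rule F_eq[OF _ ob(2,2)]) (use ob b b' w'w in \<open>simp_all add: F_cmp F_idn\<close>)
  have bb': "cmp A E K E b b' = idn A E"
    by (rule F_eq[OF _ ob(3,3)]) (use ob b b' ww' in \<open>simp_all add: F_cmp F_idn\<close>)
  \<comment> \<open>The naturality of \<kappa> does not see the second component of a pair, so zero
    can be taken for it.\<close>
  let ?g = "Gm K E (b, \<zero>\<^bsub>mor A K E\<^esub>)"
  have g: "?g \<in> hom_set B (Go K) (Go E)" using K E b ob by simp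
  obtain r where r: "r \<in> hom_set B (Go E) (Go K)"
    "cmp B (Go K) (Go E) (Go K) r ?g = idn B (Go K)" "cmp B (Go E) (Go K) (Go E) ?g r = idn B (Go E)"
    using G_split[OF K E b(1) b'(1) b'b bb'] .
  let ?\<theta> = "cmp B (Go K) (Go E) J \<alpha> ?g" and ?\<theta>' = "cmp B J (Go E) (Go K) r \<beta>"
  have \<theta>: "?\<theta> \<in> hom_set B (Go K) J" "?\<theta>' \<in> hom_set B J (Go K)" using ob \<alpha> \<beta> g r by simp_all
  show thesis
  proof (rule that[OF \<theta>])
    have "cmp B (Go K) J (Go K) ?\<theta>' ?\<theta> = cmp B (Go K) (Go E) (Go K) r (cmp B (Go K) J (Go E) \<beta> ?\<theta>)"
      by (rule B.cmp_assoc) (use ob \<theta> \<beta> r in simp_all)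
    also have "cmp B (Go K) J (Go E) \<beta> ?\<theta> = cmp B (Go K) (Go E) (Go E) (cmp B (Go E) J (Go E) \<beta> \<alpha>) ?g"
      by (rule B.cmp_assoc[symmetric]) (use ob \<alpha> \<beta> g in simp_all)
    finally show "cmp B (Go K) J (Go K) ?\<theta>' ?\<theta> = idn B (Go K)" unfolding \<beta>\<alpha> using ob g r by simp
    have "cmp B J (Go K) J ?\<theta> ?\<theta>' = cmp B J (Go E) J \<alpha> (cmp B J (Go K) (Go E) ?g ?\<theta>')"
      by (rule B.cmp_assoc) (use ob \<theta> \<alpha> g in simp_all)
    also have "cmp B J (Go K) (Go E) ?g ?\<theta>' = cmp B J (Go E) (Go E) (cmp B (Go E) (Go K) (Go E) ?g r) \<beta>"
      by (rule B.cmp_assoc[symmetric]) (use ob \<beta> g r in simp_all)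
    finally show "cmp B J (Go K) J ?\<theta> ?\<theta>' = idn B J" unfolding r(3) using ob \<beta> \<alpha>\<beta> by simp
    have "cmp B (Fo K) (Go K) J ?\<theta> (\<kappa> K) = cmp B (Fo K) (Go E) J \<alpha> (cmp B (Fo K) (Go K) (Go E) ?g (\<kappa> K))"
      by (rule B.cmp_assoc) (use ob \<alpha> g K in simp_all)
    also have "cmp B (Fo K) (Go K) (Go E) ?g (\<kappa> K) = cmp B (Fo K) J (Go E) \<beta> v"
      unfolding \<kappa>_natural[OF K E b(1) A.hom_zero[OF ob(2,3)]] b(2) w(2) ..
    finally show "cmp B (Fo K) (Go K) J ?\<theta> (\<kappa> K) = v" unfolding abv .
  qed
qed

text \<open>Transporting the differential of J along isomorphisms \<open>G K\<^sup>n \<cong> J\<^sup>n\<close> over the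
  identity of \<open>F K\<^sup>n\<close> turns it into \<open>G(\<delta> + h\<epsilon>)\<close>.\<close>

lemma deforms_to_imp:
  assumes "deforms_to k A B Fo Fm C C'"
  obtains K h where "K \<in> complexes_plus (Inj A)" "homotopy_equivalent (Inj A) K C"
    "h \<in> carrier (com_hom (Inj A) K K 1)"
    "com_d (Inj A) K K 1 h = \<ominus>\<^bsub>com_hom (Inj A) K K 2\<^esub> obstruction_cocycle A \<phi> K"
proof -
  obtain J K v where J: "J \<in> complexes_plus (Inj B)" and K: "K \<in> complexes_plus (Inj A)"
    and KC: "homotopy_equivalent (Inj A) K C"
    and v: "\<And>n. is_kernel B (obj J n) (obj J n) (eps (obj J n)) (Fo (obj K n)) (v n)"
    and vd: "\<And>n. cmp B (Fo (obj K n)) (obj J n) (obj J (n + 1)) (dif J n) (v n)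
      = cmp B (Fo (obj K n)) (Fo (obj K (n + 1))) (obj J (n + 1)) (v (n + 1))
          (Fm (obj K n) (obj K (n + 1)) (dif K n))"
    using assms unfolding deforms_to_def by blast
  interpret IB: lincat "dual_numbers k" "Inj B" by (rule B.Inj_lincat)
  have J': "J \<in> complexes (Inj B)" using J by (simp add: complexes_plus_def)
  then have JB: "J \<in> complexes B" by (rule complexes_Inj)
  have Jinj: "injective_object B (obj J n)" for n using IB.complexesD(1)[OF J', of n] by simp
  have K': "K \<in> complexes (Inj A)" using K by (simp add: complexes_plus_def)
  note dK = Inj_complexesD[OF K'] and dJ = B.complexesD[OF JB]
  have "\<exists>\<theta> \<theta>'. \<theta> \<in> hom_set B (Go (obj K n)) (obj J n) \<and> \<theta>' \<in> hom_set B (obj J n) (Go (obj K n)) \<and>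
    cmp B (Go (obj K n)) (obj J n) (Go (obj K n)) \<theta>' \<theta> = idn B (Go (obj K n)) \<and>
    cmp B (obj J n) (Go (obj K n)) (obj J n) \<theta> \<theta>' = idn B (obj J n) \<and>
    cmp B (Fo (obj K n)) (Go (obj K n)) (obj J n) \<theta> (\<kappa> (obj K n)) = v n" for n
    by (rule lift_iso[OF Jinj dK(1) v[of n]]) blast
  then obtain \<theta> \<theta>' where \<theta>: "\<And>n. \<theta> n \<in> hom_set B (Go (obj K n)) (obj J n)"
    and \<theta>': "\<And>n. \<theta>' n \<in> hom_set B (obj J n) (Go (obj K n))"
    and \<theta>'\<theta>: "\<And>n. cmp B (Go (obj K n)) (obj J n) (Go (obj K n)) (\<theta>' n) (\<theta> n) = idn B (Go (obj K n))"
    and \<theta>\<theta>': "\<And>n. cmp B (obj J n) (Go (obj K n)) (obj J n) (\<theta> n) (\<theta>' n) = idn B (obj J n)"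
    and \<theta>\<kappa>: "\<And>n. cmp B (Fo (obj K n)) (Go (obj K n)) (obj J n) (\<theta> n) (\<kappa> (obj K n)) = v n"
    by metis
  have ob: "obj J n \<in> obs B" "obj K n \<in> obs A" "Fo (obj K n) \<in> obs B" "Go (obj K n) \<in> obs B" for n
    using dJ dK(1)[of n] by simp_all
  have \<kappa>K: "\<kappa> (obj K n) \<in> hom_set B (Fo (obj K n)) (Go (obj K n))" for n using dK(1) by (rule \<kappa>_closed)
  have vh: "v n \<in> hom_set B (Fo (obj K n)) (obj J n)" for n using B.is_kernelD(2)[OF v] .
  \<comment> \<open>D is the differential of J conjugated by \<theta>; T is the intermediate map
    before \<theta>' is applied, kept apart so that \<theta>\<theta>' = 1 can be cancelled in the
    square of D.\<close>
  define T where "T n = cmp B (Go (obj K n)) (obj J n) (obj J (n + 1)) (dif J n) (\<theta> n)" for n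
  define D where "D n = cmp B (Go (obj K n)) (obj J (n + 1)) (Go (obj K (n + 1))) (\<theta>' (n + 1)) (T n)" for n
  have T: "T n \<in> hom_set B (Go (obj K n)) (obj J (n + 1))" for n
    unfolding T_def by (rule B.cmp_closed) (use ob dJ \<theta> in simp_all)
  have D: "D n \<in> hom_set B (Go (obj K n)) (Go (obj K (n + 1)))" for n
    unfolding D_def by (rule B.cmp_closed) (use ob T \<theta>' in simp_all)
  have \<theta>D: "cmp B (Go (obj K n)) (Go (obj K (n + 1))) (obj J (n + 1)) (\<theta> (n + 1)) (D n) = T n" for n
  proof -
    have "cmp B (Go (obj K n)) (Go (obj K (n + 1))) (obj J (n + 1)) (\<theta> (n + 1)) (D n)
      = cmp B (Go (obj K n)) (obj J (n + 1)) (obj J (n + 1))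
          (cmp B (obj J (n + 1)) (Go (obj K (n + 1))) (obj J (n + 1)) (\<theta> (n + 1)) (\<theta>' (n + 1))) (T n)"
      unfolding D_def by (rule B.cmp_assoc[symmetric]) (use ob T \<theta> \<theta>' in simp_all)
    then show ?thesis unfolding \<theta>\<theta>' using B.cmp_id_left[OF ob(4,1) T] by simp
  qed
  \<comment> \<open>The inner factor \<theta>\<theta>' disappears through \<open>\<theta>D\<close>,
    which leaves the square of the differential of J between \<theta>' and \<theta>.\<close>
  have DD: "cmp B (Go (obj K n)) (Go (obj K (n + 1))) (Go (obj K (n + 2))) (D (n + 1)) (D n)
      = \<zero>\<^bsub>mor B (Go (obj K n)) (Go (obj K (n + 2)))\<^esub>" for n
  proof -
    have e: "n + 1 + 1 = n + 2" by simp
    note T1 = T[of "n + 1", unfolded e] and t1 = \<theta>'[of "n + 2"] and d1 = dJ(2)[of "n + 1", unfolded e]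
    have "cmp B (Go (obj K n)) (Go (obj K (n + 1))) (Go (obj K (n + 2))) (D (n + 1)) (D n)
      = cmp B (Go (obj K n)) (obj J (n + 2)) (Go (obj K (n + 2))) (\<theta>' (n + 2))
          (cmp B (Go (obj K n)) (Go (obj K (n + 1))) (obj J (n + 2)) (T (n + 1)) (D n))"
      unfolding D_def[of "n + 1"] e by (rule B.cmp_assoc) (rule ob t1 T1 D)+
    also have "cmp B (Go (obj K n)) (Go (obj K (n + 1))) (obj J (n + 2)) (T (n + 1)) (D n)
      = cmp B (Go (obj K n)) (obj J (n + 1)) (obj J (n + 2)) (dif J (n + 1)) (T n)"
      unfolding T_def[of "n + 1"] e \<theta>D[of n, symmetric] by (rule B.cmp_assoc) (rule ob d1 \<theta> D)+
    also have "\<dots> = cmp B (Go (obj K n)) (obj J n) (obj J (n + 2))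
        (cmp B (obj J n) (obj J (n + 1)) (obj J (n + 2)) (dif J (n + 1)) (dif J n)) (\<theta> n)"
      unfolding T_def by (rule B.cmp_assoc[symmetric]) (rule ob d1 dJ(2) \<theta>)+
    also have "\<dots> = \<zero>\<^bsub>mor B (Go (obj K n)) (obj J (n + 2))\<^esub>"
      unfolding dJ(3) by (rule B.cmp_zero_left) (rule ob \<theta>)+
    finally show ?thesis using B.cmp_zero_right[OF ob(4,1,4) t1] by simp
  qed
  have "\<exists>h. h \<in> hom_set A (obj K n) (obj K (n + 1)) \<and> D n = Gm (obj K n) (obj K (n + 1)) (dif K n, h)" for n
  proof -
    let ?X = "obj K n" and ?Y = "obj K (n + 1)"
    obtain f h where f: "f \<in> hom_set A ?X ?Y" and h: "h \<in> hom_set A ?X ?Y" and G: "Gm ?X ?Y (f, h) = D n"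
      using G_full[OF dK(1) dK(1) D] .
    \<comment> \<open>Restriction to the kernel of \<epsilon> isolates the first component of D:
      there D acts as F of the differential of K, and since \<kappa> is a monomorphism and F is
      faithful, that component is \<open>dif K n\<close>.\<close>
    have "cmp B (Fo ?X) (Go ?X) (Go ?Y) (D n) (\<kappa> ?X)
      = cmp B (Fo ?X) (obj J (n + 1)) (Go ?Y) (\<theta>' (n + 1)) (cmp B (Fo ?X) (Go ?X) (obj J (n + 1)) (T n) (\<kappa> ?X))"
      unfolding D_def by (rule B.cmp_assoc) (rule ob \<theta>' T \<kappa>K)+
    also have "cmp B (Fo ?X) (Go ?X) (obj J (n + 1)) (T n) (\<kappa> ?X)
      = cmp B (Fo ?X) (obj J n) (obj J (n + 1)) (dif J n) (v n)"
      unfolding T_def \<theta>\<kappa>[symmetric] by (rule B.cmp_assoc) (rule ob dJ(2) \<theta> \<kappa>K)+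
    also have "\<dots> = cmp B (Fo ?X) (Fo ?Y) (obj J (n + 1)) (v (n + 1)) (Fm ?X ?Y (dif K n))"
      by (rule vd)
    also have "cmp B (Fo ?X) (obj J (n + 1)) (Go ?Y) (\<theta>' (n + 1)) \<dots>
      = cmp B (Fo ?X) (Fo ?Y) (Go ?Y) (cmp B (Fo ?Y) (obj J (n + 1)) (Go ?Y) (\<theta>' (n + 1)) (v (n + 1))) (Fm ?X ?Y (dif K n))"
      by (rule B.cmp_assoc[symmetric]) (rule ob \<theta>' vh F_closed dK(2))+
    also have "cmp B (Fo ?Y) (obj J (n + 1)) (Go ?Y) (\<theta>' (n + 1)) (v (n + 1))
      = cmp B (Fo ?Y) (Go ?Y) (Go ?Y) (cmp B (Go ?Y) (obj J (n + 1)) (Go ?Y) (\<theta>' (n + 1)) (\<theta> (n + 1))) (\<kappa> ?Y)"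
      unfolding \<theta>\<kappa>[symmetric] by (rule B.cmp_assoc[symmetric]) (rule ob \<theta> \<theta>' \<kappa>K)+
    also have "\<dots> = \<kappa> ?Y" unfolding \<theta>'\<theta> by (rule B.cmp_id_left[OF ob(3,4) \<kappa>K])
    finally have "cmp B (Fo ?X) (Fo ?Y) (Go ?Y) (\<kappa> ?Y) (Fm ?X ?Y f)
        = cmp B (Fo ?X) (Fo ?Y) (Go ?Y) (\<kappa> ?Y) (Fm ?X ?Y (dif K n))"
      unfolding G[symmetric] \<kappa>_natural[OF dK(1) dK(1) f h] .
    from B.mono_mor_cancel[OF \<kappa>_mono[OF dK(1)] ob(3) _ _ this]
    have "Fm ?X ?Y f = Fm ?X ?Y (dif K n)" using ob f dK(2) by simp
    from F_eq[OF this ob(2,2) f dK(2)] have "f = dif K n" .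
    then show ?thesis using h G by (intro exI[of _ h]) simp
  qed
  from choice[OF allI, OF this]
  obtain h where "\<forall>n. h n \<in> hom_set A (obj K n) (obj K (n + 1)) \<and>
      D n = Gm (obj K n) (obj K (n + 1)) (dif K n, h n)" ..
  then have h: "\<And>n. h n \<in> hom_set A (obj K n) (obj K (n + 1))"
    and Dh: "\<And>n. D n = Gm (obj K n) (obj K (n + 1)) (dif K n, h n)"
    by simp_all
  have hc: "h \<in> carrier (com_hom (Inj A) K K 1)" using h by (simp add: com_hom_def)
  have "com_d (Inj A) K K 1 h = \<ominus>\<^bsub>com_hom (Inj A) K K 2\<^esub> obstruction_cocycle A \<phi> K"
  proof (rule iffD1[OF deformed_square[OF K' hc]], rule allI)
    fix n :: int
    have e: "n + 1 + 1 = n + 2" by simp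
    show "cmp B (Go (obj K n)) (Go (obj K (n + 1))) (Go (obj K (n + 2)))
      (Gm (obj K (n + 1)) (obj K (n + 2)) (dif K (n + 1), h (n + 1)))
      (Gm (obj K n) (obj K (n + 1)) (dif K n, h n)) = \<zero>\<^bsub>mor B (Go (obj K n)) (Go (obj K (n + 2)))\<^esub>"
      using DD[of n] unfolding Dh e .
  qed
  with K KC hc show thesis by (rule that)
qed

end

section \<open>The characteristic morphism as the family of obstructions\<close>

theorem corollary4p9:
  fixes k :: "'r ring"
    and A :: "('o, 'm, 'r) lincat"
    and B :: "('p, 'n, 'r \<times> 'r) lincat"
    and Fo :: "'o \<Rightarrow> 'p" and Fm :: "'o \<Rightarrow> 'o \<Rightarrow> 'm \<Rightarrow> 'n"
    and c :: "('o, 'm) cochain set" and \<phi> :: "('o, 'm) cochain"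
  assumes "field k"
    and "abelian_category k A"
    and "enough_injectives A"
    and "c \<in> HH_ab k A 2"
    and "\<phi> \<in> c"
  shows "char_mor A c \<in> graded_centre2 (Inj A)
    \<and> (\<forall>C \<in> complexes_plus (Inj A). char_mor A c C = obstruction A \<phi> C)
    \<and> (deformation_along k A \<phi> B Fo Fm \<longrightarrow>
        (\<forall>C \<in> complexes_plus (Inj A).
           (obstruction A \<phi> C = ext_class (Inj A) C C 2 \<zero>\<^bsub>com_hom (Inj A) C C 2\<^esub> \<longleftrightarrow>
             (\<exists>C' \<in> complexes_plus B. deforms_to k A B Fo Fm C C')) \<and>
           (bounded_cohomology A C \<longrightarrow>
             (obstruction A \<phi> C = ext_class (Inj A) C C 2 \<zero>\<^bsub>com_hom (Inj A) C C 2\<^esub> \<longleftrightarrow>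
               (\<exists>C' \<in> complexes_plus B. bounded_cohomology B C' \<and> deforms_to k A B Fo Fm C C')))))"
proof (intro conjI ballI impI)
  have A: "lincat k A" using assms(2) by (simp add: lincat_def abelian_category_def)
  note c\<phi> = A assms(4,5)
  show char: "char_mor A c C = obstruction A \<phi> C" if "C \<in> complexes_plus (Inj A)" for C
    by (rule char_mor_eq_obstruction[OF c\<phi>]) (use that in \<open>simp add: complexes_plus_def\<close>)
  show "char_mor A c \<in> graded_centre2 (Inj A)"
    by (rule obstruction_central[OF c\<phi> char])
  fix C
  assume "deformation_along k A \<phi> B Fo Fm" and C: "C \<in> complexes_plus (Inj A)"
  then obtain Go Gm \<kappa> where def: "abelian_deformation k A B Fo Fm"
    "linear_equivalence (dual_numbers k) (linear_deformation (Inj A) \<phi>) (Inj B) Go Gm"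
    "\<And>E. injective_object A E \<Longrightarrow> is_kernel B (Go E) (Go E) (eps_mor k B (Go E)) (Fo E) (\<kappa> E)"
    "\<And>E E' f f'. \<lbrakk>injective_object A E; injective_object A E'; f \<in> hom_set A E E'; f' \<in> hom_set A E E'\<rbrakk>
      \<Longrightarrow> cmp B (Fo E) (Go E) (Go E') (Gm E E' (f, f')) (\<kappa> E)
        = cmp B (Fo E) (Fo E') (Go E') (\<kappa> E') (Fm E E' f)"
    unfolding deformation_along_def Inj_simps by blast
  interpret deformation_equivalence k A \<phi> B Fo Fm Go Gm \<kappa>
    using deformation_equivalence.intro[OF assms(1-3) HH_class_cocycle[OF c\<phi> assms(5)] _ _ def(2-4)] def(1)
    by (simp add: abelian_deformation_def)
  have C': "C \<in> complexes (Inj A)" using C by (simp add: complexes_plus_def)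
  note vanish = obstruction_vanishes_iff[OF c\<phi>]
  have necessary: "obstruction A \<phi> C = ext_class (Inj A) C C 2 \<zero>\<^bsub>com_hom (Inj A) C C 2\<^esub>"
    if D: "deforms_to k A B Fo Fm C D" for D
  proof -
    obtain K h where K: "K \<in> complexes_plus (Inj A)" "homotopy_equivalent (Inj A) K C"
      "h \<in> carrier (com_hom (Inj A) K K 1)"
      "com_d (Inj A) K K 1 h = \<ominus>\<^bsub>com_hom (Inj A) K K 2\<^esub> obstruction_cocycle A \<phi> K"
      using deforms_to_imp[OF D] .
    have "K \<in> complexes (Inj A)" using K(1) by (simp add: complexes_plus_def)
    then show ?thesis
      using obstruction_vanishes_transport[OF c\<phi> C K(1,2)] vanish K(3,4) by blast
  qed
  \<comment> \<open>One witness serves both equivalences: the lift built from h is exact wherever C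
    is, so a bound for the cohomology of C is also one for the lift.\<close>
  have sufficient: "\<exists>D \<in> complexes_plus B. deforms_to k A B Fo Fm C D \<and>
      (bounded_cohomology A C \<longrightarrow> bounded_cohomology B D)"
    if 0: "obstruction A \<phi> C = ext_class (Inj A) C C 2 \<zero>\<^bsub>com_hom (Inj A) C C 2\<^esub>"
  proof -
    obtain h where h: "h \<in> carrier (com_hom (Inj A) C C 1)"
      "com_d (Inj A) C C 1 h = \<ominus>\<^bsub>com_hom (Inj A) C C 2\<^esub> obstruction_cocycle A \<phi> C"
      using iffD1[OF vanish[OF C'] 0] by blast
    have "bounded_cohomology B (deformed C h)" if b: "bounded_cohomology A C"
    proof -
      obtain N where N: "\<And>n Z u H q. N \<le> \<bar>n\<bar> \<Longrightarrow> is_cohomology A C n Z u H q \<Longrightarrow> zero_object A H"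
        using b unfolding bounded_cohomology_def by blast
      show ?thesis
        unfolding bounded_cohomology_def
        by (intro exI[of _ N] allI impI) (rule deformed_acyclic[OF C' h N])
    qed
    then show ?thesis using deformed_complex(2)[OF C h] deformed_deforms_to[OF C h] by blast
  qed
  show "obstruction A \<phi> C = ext_class (Inj A) C C 2 \<zero>\<^bsub>com_hom (Inj A) C C 2\<^esub> \<longleftrightarrow>
      (\<exists>C' \<in> complexes_plus B. deforms_to k A B Fo Fm C C')"
    using necessary sufficient by blast
  \<comment> \<open>A deformation with bounded cohomology is in particular a deformation, so the
    necessity shown for bounded below complexes applies unchanged.\<close>
  show "obstruction A \<phi> C = ext_class (Inj A) C C 2 \<zero>\<^bsub>com_hom (Inj A) C C 2\<^esub> \<longleftrightarrow>
      (\<exists>C' \<in> complexes_plus B. bounded_cohomology B C' \<and> deforms_to k A B Fo Fm C C')"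
    if "bounded_cohomology A C"
    using necessary sufficient that by blast
qed

end
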